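(* Let $F\subset\mathbb{R}^3$ be a self-affine sponge, the attractor of $\{S_i\}_{i\in\mathcal I}$. Then $$\overline{\dim}_{\mathrm B} F\le \overline{s_0}.$$ Moreover, if $F$ is an $S_3$-sponge, an $S_2$-partially ordered sponge, or an ordered sponge and, in addition, $\{S_i\}_{i\in\mathcal I}$ satisfies the cuboidal open set condition (COSC), then $$\underline{s_0}\le \underline{\dim}_{\mathrm B}F\le\overline{\dim}_{\mathrm B}F\le\overline{s_0}.$$ In particular (in this latter situation), if $\overline{p_1}=\underline{p_1}$ and $\overline{p_2}=\underline{p_2}$, then the box dimension of $F$ exists and $\dim_{\mathrm B}F=\overline{s_0}=\underline{s_0}$.
   Context: **Sponges.** Let $\mathcal I$ be a finite set with at least two elements and let $\{S_i\}_{i\in\mathcal I}$ be affine contractions of $\mathbb{R}^3$ such that the linear part of each $S_i$ is a generalised permutation matrix (exactly one nonzero entry in each row and in each column) and $S_i([0,1]^3)\subset[0,1]^3$. The attractor $F$ is the unique non-empty compact set with $F=\bigcup_{i\in\mathcal I}S_i(F)$, and is called a self-affine sponge. Each linear part induces a permutation of the three coordinate axes; $G$ denotes the group generated by these permutations. **Words.** $\mathcal I^*=\bigcup_{n\ge1}\mathcal I^n$; for $\mathbf i=i_1\cdots i_n$, $S_{\mathbf i}=S_{i_1}\circ\cdots\circ S_{i_n}$, and $\alpha_1(\mathbf i)\ge\alpha_2(\mathbf i)\ge\alpha_3(\mathbf i)$ are the singular values of the linear part of $S_{\mathbf i}$. **Dimensions.** $N_\delta(E)$ is the minimum number of boxes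 (cubes) of sidelength $\delta$ needed to cover $E$; $\overline{\dim}_{\mathrm B}E$ and $\underline{\dim}_{\mathrm B}E$ are the limsup and liminf of $\log N_\delta(E)/(-\log\delta)$ as $\delta\to0$, and $\dim_{\mathrm B}E$ is the common value if they agree. The quasi-Assouad dimension is $\dim_{\mathrm{qA}}E=\lim_{\varepsilon\to0}h_E(\varepsilon)$, where $h_E(\varepsilon)$ is the infimum of those $\alpha$ for which there is $C>0$ with $N_r(B(x,R)\cap E)\le C(R/r)^\alpha$ for all $0<r\le R^{1+\varepsilon}<1$ and $x\in E$. **Projections.** For $\mathbf i\in\mathcal I^*$ let $\pi^1_{\mathbf i}$ be the projection onto the coordinate axis parallel to the longest edges of the cuboid $S_{\mathbf i}([0,1]^3)$, and $\pi^2_{\mathbf i}$ the projection onto the coordinate plane perpendicular to its shortest edges (if these are not unique, choose one possibility arbitrarily). Put $\underline{p_1}(\mathbf i)=\dim_{\mathrm B}\pi^1_{\mathbf i}F$ (this box dimension exists), $\overline{p_1}(\mathbf i)=\dim_{\mathrm{qA}}\pi^1_{\mathbf i}F$, $\overline{p_2}(\mathbf i)=\overline{\dim}_{\mathrm B}\pi^2_{\mathbf i}F$, $\underline{p_2}(\mathbf i)=\underline{\dim}_{\mathrm B}\pi^2_{\mathbf i}F$. **Pressure.** For $s\ge0$, $$\overline\psi^s(\mathbf i)=\alpha_1(\mathbf i)^{\overline{p_1}(\mathbf i)}\alpha_2(\mathbf i)^{\overline{p_2}(\mathbf i)-\overline{p_1}(\mathbf i)}\alpha_3(\mathbf i)^{s-\overline{p_2}(\mathbf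 i)},\qquad \underline\psi^s(\mathbf i)=\alpha_1(\mathbf i)^{\underline{p_1}(\mathbf i)}\alpha_2(\mathbf i)^{\underline{p_2}(\mathbf i)-\underline{p_1}(\mathbf i)}\alpha_3(\mathbf i)^{s-\underline{p_2}(\mathbf i)}.$$ The limits $\overline P(s)=\lim_k\big(\sum_{\mathbf i\in\mathcal I^k}\overline\psi^s(\mathbf i)\big)^{1/k}$ and $\underline P(s)=\lim_k\big(\sum_{\mathbf i\in\mathcal I^k}\underline\psi^s(\mathbf i)\big)^{1/k}$ exist and are continuous and strictly decreasing in $s$; $\overline{s_0}>0$ and $\underline{s_0}>0$ are the unique values with $\overline P(\overline{s_0})=1$ and $\underline P(\underline{s_0})=1$. **Classes of sponges.** - $F$ is an $S_3$-sponge if $G\cong S_3$ (the full symmetric group on the three axes). - $F$ is an ordered sponge if every linear part is diagonal, $\mathrm{diag}(a_i^1,a_i^2,a_i^3)$, and there is one permutation $\sigma$ of $\{1,2,3\}$ with $|a_i^{\sigma(1)}|\ge|a_i^{\sigma(2)}|\ge|a_i^{\sigma(3)}|$ for all $i\in\mathcal I$. - $F$ is an $S_2$-partially ordered sponge if every linear part is of the form $$\begin{pmatrix} a_i^1&0&0\\ 0&a_i^2&0\\ 0&0&a_i^3\end{pmatrix}\quad\text{or}\quad\begin{pmatrix} 0&a_i^1&0\\ a_i^2&0&0\\ 0&0&a_i^3\end{pmatrix},$$ with at least one of each type, and $\min\{|a_i^1|,|a_i^2|\}\ge|a_i^3|$ for all $i$. In these three classes the quantities $\overline{p_1}(\mathbf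 i),\underline{p_1}(\mathbf i),\overline{p_2}(\mathbf i),\underline{p_2}(\mathbf i)$ do not depend on $\mathbf i$ and are written $\overline{p_1},\underline{p_1},\overline{p_2},\underline{p_2}$ (in the ordered case one always projects to the $\sigma(1)$-axis and to the plane of the $\sigma(1),\sigma(2)$ axes; in the $S_2$-partially ordered case always to the first or second axis and to the plane of the first two axes). **COSC.** $\{S_i\}_{i\in\mathcal I}$ satisfies the COSC if there is a non-empty open cuboid $C=(a,b)\times(c,d)\times(e,f)\subset\mathbb{R}^3$ such that the sets $S_i(C)$, $i\in\mathcal I$, are pairwise disjoint subsets of $C$. *)

theory Defs
  imports "HOL-Analysis.Analysis" "HOL-Algebra.Bij" "HOL-Algebra.Sym_Groups"
begin

section \<open>Dimensions\<close>

definition cubes :: "real \<Rightarrow> 'a::euclidean_space set set" where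
  "cubes \<delta> = {cbox a (a + \<delta> *\<^sub>R One) |a. True}"

text \<open>
  For bounded sets, to which it is only applied, the infimum is over a non-empty set of
  natural numbers, hence a minimum. A subset of a coordinate axis or plane has the same
  covering number whether it is covered by cubes of the ambient space or by intervals or
  squares of the axis or plane.
\<close>

definition cover_num :: "real \<Rightarrow> 'a::euclidean_space set \<Rightarrow> nat" where
  "cover_num \<delta> E = Inf {card \<C> |\<C>. finite \<C> \<and> \<C> \<subseteq> cubes \<delta> \<and> E \<subseteq> \<Union>\<C>}"

definition upper_box_dim :: "'a::euclidean_space set \<Rightarrow> ereal" where
  "upper_box_dim E = Limsup (at_right 0) (\<lambda>\<delta>. ereal (ln (real (cover_num \<delta> E)) / (- ln \<delta>)))"

definition lower_box_dim :: "'a::euclidean_space set \<Rightarrow> ereal" where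
  "lower_box_dim E = Liminf (at_right 0) (\<lambda>\<delta>. ereal (ln (real (cover_num \<delta> E)) / (- ln \<delta>)))"

text \<open>Meaningful only if the upper and the lower box dimension agree.\<close>

definition box_dim :: "'a::euclidean_space set \<Rightarrow> ereal" where
  "box_dim E = (THE d. lower_box_dim E = d \<and> upper_box_dim E = d)"

definition qA_exponent :: "'a::euclidean_space set \<Rightarrow> real \<Rightarrow> ereal" where
  "qA_exponent E \<epsilon> = Inf {ereal \<alpha> |\<alpha>. \<exists>C>0. \<forall>r R. \<forall>x\<in>E.
     0 < r \<and> 0 < R \<and> r \<le> R powr (1 + \<epsilon>) \<and> R powr (1 + \<epsilon>) < 1 \<longrightarrow>
     real (cover_num r (cball x R \<inter> E)) \<le> C * (R / r) powr \<alpha>}"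

definition qA_dim :: "'a::euclidean_space set \<Rightarrow> ereal" where
  "qA_dim E = Lim (at_right 0) (qA_exponent E)"


section \<open>Linear algebra\<close>

definition affine_map :: "(real^3 \<Rightarrow> real^3) \<Rightarrow> bool" where
  "affine_map f \<longleftrightarrow> (\<exists>A b. f = (\<lambda>x. A *v x + b))"

definition linear_part :: "(real^3 \<Rightarrow> real^3) \<Rightarrow> real^3^3" where
  "linear_part f = matrix (\<lambda>x. f x - f 0)"

definition gen_perm_matrix :: "real^'n^'n \<Rightarrow> bool" where
  "gen_perm_matrix A \<longleftrightarrow> (\<forall>i. \<exists>!j. A $ i $ j \<noteq> 0) \<and> (\<forall>j. \<exists>!i. A $ i $ j \<noteq> 0)"

text \<open>
  The singular values are the square roots of the eigenvalues of \<open>A\<^sup>T A\<close>, listed in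
  decreasing order; the characteristic polynomial accounts for their multiplicities.
\<close>

definition singular_values :: "real^'n^'n \<Rightarrow> real list" where
  "singular_values A = (THE xs. length xs = CARD('n) \<and> sorted_wrt (\<ge>) xs \<and> (\<forall>x\<in>set xs. 0 \<le> x) \<and>
     (\<forall>t. det (mat t - transpose A ** A) = (\<Prod>x\<leftarrow>xs. t - x\<^sup>2)))"

text \<open>The matrix \<open>A\<close> maps the \<open>j\<close>-th coordinate axis to the \<open>axis_perm A j\<close>-th one.\<close>

definition axis_perm :: "real^3^3 \<Rightarrow> 3 \<Rightarrow> 3" where
  "axis_perm A j = (THE i. A $ i $ j \<noteq> 0)"

definition coord_proj :: "3 set \<Rightarrow> real^3 \<Rightarrow> real^3" where
  "coord_proj K x = (\<chi> k. if k \<in> K then x $ k else 0)"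


section \<open>Sponges and words\<close>

definition unit_cube :: "(real^3) set" where
  "unit_cube = cbox 0 1"

definition sponge_ifs :: "'i set \<Rightarrow> ('i \<Rightarrow> real^3 \<Rightarrow> real^3) \<Rightarrow> bool" where
  "sponge_ifs I S \<longleftrightarrow> finite I \<and> 2 \<le> card I \<and>
     (\<forall>i\<in>I. affine_map (S i) \<and> (\<exists>c<1. c-lipschitz_on UNIV (S i)) \<and>
            gen_perm_matrix (linear_part (S i)) \<and> S i ` unit_cube \<subseteq> unit_cube)"

definition attractor :: "'i set \<Rightarrow> ('i \<Rightarrow> real^3 \<Rightarrow> real^3) \<Rightarrow> (real^3) set \<Rightarrow> bool" where
  "attractor I S F \<longleftrightarrow> compact F \<and> F \<noteq> {} \<and> F = (\<Union>i\<in>I. S i ` F)"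

definition words_of_length :: "'i set \<Rightarrow> nat \<Rightarrow> 'i list set" where
  "words_of_length I k = {w. length w = k \<and> set w \<subseteq> I}"

definition words :: "'i set \<Rightarrow> 'i list set" where
  "words I = (\<Union>k\<in>{1..}. words_of_length I k)"

definition word_map :: "('i \<Rightarrow> real^3 \<Rightarrow> real^3) \<Rightarrow> 'i list \<Rightarrow> real^3 \<Rightarrow> real^3" where
  "word_map S w = foldr (\<lambda>i f. S i \<circ> f) w id"

text \<open>The list of singular values is indexed from 0, the numbers \<open>\<alpha>\<^sub>1, \<alpha>\<^sub>2, \<alpha>\<^sub>3\<close> from 1.\<close>

definition alpha :: "('i \<Rightarrow> real^3 \<Rightarrow> real^3) \<Rightarrow> nat \<Rightarrow> 'i list \<Rightarrow> real" where
  "alpha S k w = singular_values (linear_part (word_map S w)) ! (k - 1)"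


section \<open>Projections\<close>

definition edge_length :: "(real^3) set \<Rightarrow> 3 \<Rightarrow> real" where
  "edge_length Q k = diameter ((\<lambda>x. x $ k) ` Q)"

text \<open>
  The arbitrary choices in the definition of the two projections are made by functions
  \<open>l\<close> and \<open>m\<close>: the cuboid of the word \<open>w\<close> has its longest edges parallel to the axis
  \<open>l w\<close> and its shortest edges parallel to the axis \<open>m w\<close>.
\<close>

definition axis_choice ::
    "'i set \<Rightarrow> ('i \<Rightarrow> real^3 \<Rightarrow> real^3) \<Rightarrow> ('i list \<Rightarrow> 3) \<Rightarrow> ('i list \<Rightarrow> 3) \<Rightarrow> bool" where
  "axis_choice I S l m \<longleftrightarrow> (\<forall>w\<in>words I. \<forall>k.
     edge_length (word_map S w ` unit_cube) k \<le> edge_length (word_map S w ` unit_cube) (l w) \<and>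
     edge_length (word_map S w ` unit_cube) (m w) \<le> edge_length (word_map S w ` unit_cube) k)"

definition proj1 :: "('i list \<Rightarrow> 3) \<Rightarrow> 'i list \<Rightarrow> real^3 \<Rightarrow> real^3" where
  "proj1 l w = coord_proj {l w}"

definition proj2 :: "('i list \<Rightarrow> 3) \<Rightarrow> 'i list \<Rightarrow> real^3 \<Rightarrow> real^3" where
  "proj2 m w = coord_proj (- {m w})"

definition lower_p1 :: "(real^3) set \<Rightarrow> ('i list \<Rightarrow> 3) \<Rightarrow> 'i list \<Rightarrow> real" where
  "lower_p1 F l w = real_of_ereal (box_dim (proj1 l w ` F))"

definition upper_p1 :: "(real^3) set \<Rightarrow> ('i list \<Rightarrow> 3) \<Rightarrow> 'i list \<Rightarrow> real" where
  "upper_p1 F l w = real_of_ereal (qA_dim (proj1 l w ` F))"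

definition lower_p2 :: "(real^3) set \<Rightarrow> ('i list \<Rightarrow> 3) \<Rightarrow> 'i list \<Rightarrow> real" where
  "lower_p2 F m w = real_of_ereal (lower_box_dim (proj2 m w ` F))"

definition upper_p2 :: "(real^3) set \<Rightarrow> ('i list \<Rightarrow> 3) \<Rightarrow> 'i list \<Rightarrow> real" where
  "upper_p2 F m w = real_of_ereal (upper_box_dim (proj2 m w ` F))"


section \<open>Pressure\<close>

definition sing_fun ::
    "('i \<Rightarrow> real^3 \<Rightarrow> real^3) \<Rightarrow> ('i list \<Rightarrow> real) \<Rightarrow> ('i list \<Rightarrow> real) \<Rightarrow> real \<Rightarrow> 'i list \<Rightarrow> real" where
  "sing_fun S p1 p2 s w =
     alpha S 1 w powr p1 w * alpha S 2 w powr (p2 w - p1 w) * alpha S 3 w powr (s - p2 w)"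

definition pressure ::
    "'i set \<Rightarrow> ('i \<Rightarrow> real^3 \<Rightarrow> real^3) \<Rightarrow> ('i list \<Rightarrow> real) \<Rightarrow> ('i list \<Rightarrow> real) \<Rightarrow> real \<Rightarrow> real" where
  "pressure I S p1 p2 s = lim (\<lambda>k. root k (\<Sum>w\<in>words_of_length I k. sing_fun S p1 p2 s w))"

definition pressure_zero ::
    "'i set \<Rightarrow> ('i \<Rightarrow> real^3 \<Rightarrow> real^3) \<Rightarrow> ('i list \<Rightarrow> real) \<Rightarrow> ('i list \<Rightarrow> real) \<Rightarrow> real" where
  "pressure_zero I S p1 p2 = (THE s. 0 < s \<and> pressure I S p1 p2 s = 1)"

definition upper_s0 :: "'i set \<Rightarrow> ('i \<Rightarrow> real^3 \<Rightarrow> real^3) \<Rightarrow> (real^3) set \<Rightarrow>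
    ('i list \<Rightarrow> 3) \<Rightarrow> ('i list \<Rightarrow> 3) \<Rightarrow> real" where
  "upper_s0 I S F l m = pressure_zero I S (upper_p1 F l) (upper_p2 F m)"

definition lower_s0 :: "'i set \<Rightarrow> ('i \<Rightarrow> real^3 \<Rightarrow> real^3) \<Rightarrow> (real^3) set \<Rightarrow>
    ('i list \<Rightarrow> 3) \<Rightarrow> ('i list \<Rightarrow> 3) \<Rightarrow> real" where
  "lower_s0 I S F l m = pressure_zero I S (lower_p1 F l) (lower_p2 F m)"


section \<open>Classes of sponges\<close>

text \<open>\<open>BijGroup UNIV\<close> is the group of all permutations of the three axes.\<close>

definition S3_sponge :: "'i set \<Rightarrow> ('i \<Rightarrow> real^3 \<Rightarrow> real^3) \<Rightarrow> bool" where
  "S3_sponge I S \<longleftrightarrow>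
     subgroup_generated (BijGroup UNIV) ((\<lambda>i. axis_perm (linear_part (S i))) ` I) \<cong> sym_group 3"

definition ordered_sponge :: "'i set \<Rightarrow> ('i \<Rightarrow> real^3 \<Rightarrow> real^3) \<Rightarrow> (3 \<Rightarrow> 3) \<Rightarrow> bool" where
  "ordered_sponge I S \<sigma> \<longleftrightarrow> bij \<sigma> \<and> (\<forall>i\<in>I. let A = linear_part (S i) in
     (\<forall>j k. j \<noteq> k \<longrightarrow> A $ j $ k = 0) \<and>
     \<bar>A $ \<sigma> 1 $ \<sigma> 1\<bar> \<ge> \<bar>A $ \<sigma> 2 $ \<sigma> 2\<bar> \<and> \<bar>A $ \<sigma> 2 $ \<sigma> 2\<bar> \<ge> \<bar>A $ \<sigma> 3 $ \<sigma> 3\<bar>)"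

definition diag_matrix :: "real \<Rightarrow> real \<Rightarrow> real \<Rightarrow> real^3^3" where
  "diag_matrix a b c = vector [vector [a, 0, 0], vector [0, b, 0], vector [0, 0, c]]"

definition swap_matrix :: "real \<Rightarrow> real \<Rightarrow> real \<Rightarrow> real^3^3" where
  "swap_matrix a b c = vector [vector [0, a, 0], vector [b, 0, 0], vector [0, 0, c]]"

definition S2_sponge :: "'i set \<Rightarrow> ('i \<Rightarrow> real^3 \<Rightarrow> real^3) \<Rightarrow> bool" where
  "S2_sponge I S \<longleftrightarrow>
     (\<forall>i\<in>I. \<exists>a b c. (linear_part (S i) = diag_matrix a b c \<or> linear_part (S i) = swap_matrix a b c)
                     \<and> min \<bar>a\<bar> \<bar>b\<bar> \<ge> \<bar>c\<bar>) \<and>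
     (\<exists>i\<in>I. \<exists>a b c. linear_part (S i) = diag_matrix a b c) \<and>
     (\<exists>i\<in>I. \<exists>a b c. linear_part (S i) = swap_matrix a b c)"

definition COSC :: "'i set \<Rightarrow> ('i \<Rightarrow> real^3 \<Rightarrow> real^3) \<Rightarrow> bool" where
  "COSC I S \<longleftrightarrow> (\<exists>u v. box u v \<noteq> {} \<and> (\<forall>i\<in>I. S i ` box u v \<subseteq> box u v) \<and>
     disjoint_family_on (\<lambda>i. S i ` box u v) I)"

text \<open>
  In the partially ordered and ordered classes the choices are made in a fixed way when
  edges have equal length; only then the dimensions of the projections are independent of
  the word. The pressures do not depend on the choices.
\<close>

definition S2_choice :: "'i set \<Rightarrow> ('i list \<Rightarrow> 3) \<Rightarrow> ('i list \<Rightarrow> 3) \<Rightarrow> bool" where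
  "S2_choice I l m \<longleftrightarrow> (\<forall>w\<in>words I. l w \<in> {1, 2} \<and> m w = 3)"

definition ordered_choice ::
    "'i set \<Rightarrow> (3 \<Rightarrow> 3) \<Rightarrow> ('i list \<Rightarrow> 3) \<Rightarrow> ('i list \<Rightarrow> 3) \<Rightarrow> bool" where
  "ordered_choice I \<sigma> l m \<longleftrightarrow> (\<forall>w\<in>words I. l w = \<sigma> 1 \<and> m w = \<sigma> 3)"

end

theory Submission
  imports Defs
begin

text \<open>
  The image of the unit cube under the map of a word \<open>w\<close> is a cuboid with edges
  \<open>\<alpha>\<^sub>1 \<ge> \<alpha>\<^sub>2 \<ge> \<alpha>\<^sub>3\<close>, and the image of \<open>F\<close> inside it, the cylinder of \<open>w\<close>, is a copy of \<open>F\<close>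
  stretched along the axes. Everything rests on the number of cubes of side length \<open>\<alpha>\<^sub>3\<close> that
  the cylinder needs. Ignoring the shortest edge, it is about
  \<open>(\<alpha>\<^sub>1 / \<alpha>\<^sub>2)\<^bsup>p1\<^esup> (\<alpha>\<^sub>2 / \<alpha>\<^sub>3)\<^bsup>p2\<^esup>\<close>: cover the projection of \<open>F\<close> to a plane at scale
  \<open>\<alpha>\<^sub>3 / \<alpha>\<^sub>2\<close>, which takes \<open>(\<alpha>\<^sub>2 / \<alpha>\<^sub>3)\<^bsup>p2\<^esup>\<close> squares, and then each square along the longest axis
  at scale \<open>\<alpha>\<^sub>3 / \<alpha>\<^sub>1\<close>, which takes \<open>(\<alpha>\<^sub>1 / \<alpha>\<^sub>2)\<^bsup>p1\<^esup>\<close> parts. Multiplied by \<open>\<alpha>\<^sub>3\<^bsup>s\<^esup>\<close> this is the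
  singular value function.

  The second step compares two scales in the projection to an axis near a given point, and for
  an upper bound this is what the quasi-Assouad dimension controls (\<open>cov_cyl_upper\<close>). For a
  lower bound one needs many separated squares that contain a copy of \<open>F\<close> whose projection to
  the longest axis is as long as the square. This is where the three classes enter: by the
  ordering of the edges, or by a word that exchanges two axes, copies with the right
  orientation are available (\<open>aligned_cylinders\<close>, \<open>cov_cyl_lower\<close>).

  The box dimension of the projections to the axes exists because their covering numbers are
  supermultiplicative (\<open>axis_box_dim_exists\<close>).

  The sums that define the pressure are neither sub- nor supermultiplicative in general.
  However, every word can be extended by a bounded number of letters to a word that induces the identity on the axes, and
  such words with a fixed longest and a fixed shortest axis are closed under concatenation, with
  multiplicative weights. Hence the sums over these words are supermultiplicative, and the
  largest of their growth rates is the pressure (\<open>total_root_tendsto\<close>). Below the zero of the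
  pressure, some such sum over words of one length is at least 1, and concatenating the words
  produces a family of cylinders of any given size with total weight at least 1
  (\<open>stopped_loops\<close>). Their covering numbers add up because the open set condition bounds how many
  of them a small cube can meet. Above the zero, the sum of the weights of all words converges,
  which bounds the covering numbers of \<open>F\<close> from above.
\<close>

section \<open>Covering numbers with respect to some of the coordinates\<close>

text \<open>A bound for the diameter of the projection to the axes in \<open>K\<close>, in the maximum norm.\<close>

definition thin :: "3 set \<Rightarrow> real \<Rightarrow> (real^3) set \<Rightarrow> bool" where
  "thin K \<delta> B \<longleftrightarrow> (\<forall>x\<in>B. \<forall>y\<in>B. \<forall>k\<in>K. \<bar>x $ k - y $ k\<bar> \<le> \<delta>)"

text \<open>
  The covering number of the projection to the axes in \<open>K\<close>, in terms of the set itself. A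
  cover consists of arbitrary sets of small diameter instead of cubes, so that preimages of
  covers are covers again.
\<close>

definition cov :: "3 set \<Rightarrow> real \<Rightarrow> (real^3) set \<Rightarrow> nat" where
  "cov K \<delta> A = Inf {card \<C> |\<C>. finite \<C> \<and> (\<forall>B\<in>\<C>. thin K \<delta> B) \<and> A \<subseteq> \<Union>\<C>}"

lemma bounded_imp_thin:
  assumes "bounded A"
  obtains D where "0 < D" and "thin K D A"
proof -
  obtain D where D: "\<And>x y. x \<in> A \<Longrightarrow> y \<in> A \<Longrightarrow> dist x y \<le> D"
    using bounded_two_points[of A] assms by blast
  have "\<bar>x $ k - y $ k\<bar> \<le> max D 1" if "x \<in> A" "y \<in> A" for x y k
    using D[OF that] component_le_norm_cart[of "x - y" k] by (simp add: dist_norm)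
  then have "thin K (max D 1) A"
    unfolding thin_def by blast
  then show thesis
    using that[of "max D 1"] by simp
qed

lemma cov_le:
  assumes "finite J" "\<And>j. j \<in> J \<Longrightarrow> thin K \<delta> (B j)" "A \<subseteq> (\<Union>j\<in>J. B j)"
  shows "cov K \<delta> A \<le> card J"
proof -
  have "cov K \<delta> A \<le> card (B ` J)"
    unfolding cov_def
  proof (rule cInf_lower)
    have "finite (B ` J) \<and> (\<forall>B'\<in>B ` J. thin K \<delta> B') \<and> A \<subseteq> \<Union> (B ` J)"
      using assms by simp
    then show "card (B ` J) \<in> {card \<C> |\<C>. finite \<C> \<and> (\<forall>B\<in>\<C>. thin K \<delta> B) \<and> A \<subseteq> \<Union> \<C>}"
      by blast
  qed simp
  also have "\<dots> \<le> card J"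
    using assms(1) by (rule card_image_le)
  finally show ?thesis .
qed

lemma thin_split:
  assumes "0 < \<delta>" "thin K D A" "D \<le> real n * \<delta>"
  obtains \<C> where "finite \<C>" "card \<C> \<le> (2 * n + 1) ^ 3" "\<forall>B\<in>\<C>. thin K \<delta> B" "A \<subseteq> \<Union>\<C>"
proof (cases "A = {}")
  case True
  then show thesis using that[of "{}"] by simp
next
  case False
  then obtain x0 where x0: "x0 \<in> A" by blast
  define J where "J = (UNIV :: 3 set) \<rightarrow>\<^sub>E {..2 * n}"
  define c where "c x k = (if k \<in> K then nat \<lfloor>(x $ k - x0 $ k + D) / \<delta>\<rfloor> else 0)" for x :: "real^3" and k
  define B where "B f = {x \<in> A. c x = f}" for f
  have finJ: "finite J"
    unfolding J_def by (intro finite_PiE) auto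
  have cardJ: "card J = (2 * n + 1) ^ 3"
    unfolding J_def by (subst card_PiE) auto
  have nn: "0 \<le> (x $ k - x0 $ k + D) / \<delta>" "(x $ k - x0 $ k + D) / \<delta> \<le> 2 * real n"
    if "x \<in> A" "k \<in> K" for x k
  proof -
    have "\<bar>x $ k - x0 $ k\<bar> \<le> D"
      using assms(2) that x0 unfolding thin_def by blast
    then show "0 \<le> (x $ k - x0 $ k + D) / \<delta>" "(x $ k - x0 $ k + D) / \<delta> \<le> 2 * real n"
      using assms(1,3) by (auto simp: field_simps)
  qed
  have "c x \<in> J" if "x \<in> A" for x
  proof -
    have "c x k \<le> 2 * n" for k
    proof (cases "k \<in> K")
      case True
      have "\<lfloor>(x $ k - x0 $ k + D) / \<delta>\<rfloor> \<le> \<lfloor>2 * real n\<rfloor>"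
        using nn(2)[OF that True] by (rule floor_mono)
      also have "\<dots> = int (2 * n)" by (simp add: floor_eq_iff)
      finally show ?thesis unfolding c_def using True by simp
    qed (simp add: c_def)
    then show ?thesis unfolding J_def by auto
  qed
  then have "A \<subseteq> (\<Union>f\<in>J. B f)" unfolding B_def by blast
  moreover have "thin K \<delta> (B f)" for f
    unfolding thin_def
  proof (intro ballI)
    fix x y k assume xy: "x \<in> B f" "y \<in> B f" and k: "k \<in> K"
    then have A: "x \<in> A" "y \<in> A" and "c x k = c y k" unfolding B_def by auto
    then have "\<lfloor>(x $ k - x0 $ k + D) / \<delta>\<rfloor> = \<lfloor>(y $ k - x0 $ k + D) / \<delta>\<rfloor>"
      using nn(1)[OF A(1) k] nn(1)[OF A(2) k] k unfolding c_def by (simp add: eq_nat_nat_iff)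
    then have "\<bar>(x $ k - x0 $ k + D) / \<delta> - (y $ k - x0 $ k + D) / \<delta>\<bar> < 1"
      by linarith
    then have "\<bar>(x $ k - y $ k) / \<delta>\<bar> < 1"
      by (simp add: diff_divide_distrib[symmetric])
    then show "\<bar>x $ k - y $ k\<bar> \<le> \<delta>"
      using assms(1) by (simp add: abs_divide)
  qed
  moreover have "card (B ` J) \<le> (2 * n + 1) ^ 3"
    using card_image_le[OF finJ, of B] cardJ by simp
  ultimately show thesis
    using that[of "B ` J"] finJ by blast
qed

lemma cov_obtain:
  assumes "bounded A" "0 < \<delta>"
  obtains \<C> where "finite \<C>" "\<forall>B\<in>\<C>. thin K \<delta> B" "A \<subseteq> \<Union>\<C>" "card \<C> = cov K \<delta> A"
proof -
  obtain D where D: "0 < D" "thin K D A"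
    using bounded_imp_thin[OF assms(1)] by blast
  obtain n where n: "D / \<delta> \<le> real n"
    using real_arch_simple by blast
  then have "D \<le> real n * \<delta>" using assms(2) by (simp add: field_simps)
  then obtain \<C> where "finite \<C>" "card \<C> \<le> (2 * n + 1) ^ 3" "\<forall>B\<in>\<C>. thin K \<delta> B" "A \<subseteq> \<Union>\<C>"
    by (rule thin_split[OF assms(2) D(2)])
  then have "{card \<C> |\<C>. finite \<C> \<and> (\<forall>B\<in>\<C>. thin K \<delta> B) \<and> A \<subseteq> \<Union>\<C>} \<noteq> {}"
    by blast
  from Inf_nat_def1[OF this] obtain \<C>' where "finite \<C>'" "\<forall>B\<in>\<C>'. thin K \<delta> B" "A \<subseteq> \<Union>\<C>'" "card \<C>' = cov K \<delta> A"
    unfolding cov_def[symmetric] by auto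
  then show thesis by (rule that)
qed

text \<open>
  Covering numbers can only drop along a map that does not bring points closer together: a
  cover of the target is pulled back. Monotonicity in all arguments and the behaviour under
  affine maps are instances.
\<close>

lemma cov_transfer:
  assumes "bounded A'" "0 < \<delta>'" "h ` A \<subseteq> A'"
    and "\<And>x y k. x \<in> A \<Longrightarrow> y \<in> A \<Longrightarrow> \<forall>k\<in>K'. \<bar>h x $ k - h y $ k\<bar> \<le> \<delta>' \<Longrightarrow> k \<in> K \<Longrightarrow> \<bar>x $ k - y $ k\<bar> \<le> \<delta>"
  shows "cov K \<delta> A \<le> cov K' \<delta>' A'"
proof -
  obtain \<C> where C: "finite \<C>" "\<forall>B\<in>\<C>. thin K' \<delta>' B" "A' \<subseteq> \<Union>\<C>" "card \<C> = cov K' \<delta>' A'"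
    using cov_obtain[OF assms(1,2)] by blast
  have "cov K \<delta> A \<le> card \<C>"
  proof (rule cov_le[where B = "\<lambda>B. {x \<in> A. h x \<in> B}"])
    fix B assume "B \<in> \<C>"
    then have "thin K' \<delta>' B" using C(2) by blast
    then show "thin K \<delta> {x \<in> A. h x \<in> B}"
      unfolding thin_def using assms(4) by blast
  next
    show "A \<subseteq> (\<Union>B\<in>\<C>. {x \<in> A. h x \<in> B})"
    proof
      fix x assume "x \<in> A"
      then have "h x \<in> \<Union>\<C>" using C(3) assms(3) by (meson image_subset_iff subsetD)
      then show "x \<in> (\<Union>B\<in>\<C>. {x \<in> A. h x \<in> B})" using \<open>x \<in> A\<close> by simp
    qed
  qed (rule C(1))
  then show ?thesis using C(4) by simp
qed

lemma cov_mono: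
  assumes "bounded A'" "0 < \<delta>'" "A \<subseteq> A'" "K \<subseteq> K'" "\<delta>' \<le> \<delta>"
  shows "cov K \<delta> A \<le> cov K' \<delta>' A'"
proof -
  have "\<bar>x $ k - y $ k\<bar> \<le> \<delta>"
    if "\<forall>k\<in>K'. \<bar>x $ k - y $ k\<bar> \<le> \<delta>'" "k \<in> K" for x y :: "real^3" and k
    using that assms(4,5) by (meson order_trans subsetD)
  then show ?thesis
    using assms(1-3) by (intro cov_transfer[where h = "\<lambda>x. x"]) auto
qed

lemma cov_pos:
  assumes "bounded A" "0 < \<delta>" "A \<noteq> {}"
  shows "1 \<le> cov K \<delta> A"
proof -
  obtain \<C> where C: "finite \<C>" "A \<subseteq> \<Union>\<C>" "card \<C> = cov K \<delta> A"
    using cov_obtain[OF assms(1,2)] by metis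
  then have "\<C> \<noteq> {}" using assms(3) by auto
  then show ?thesis using C by (metis One_nat_def Suc_leI card_gt_0_iff)
qed

lemma ceiling_factor:
  fixes x :: real assumes "1 \<le> x"
  obtains n :: nat where "x \<le> real n" "real ((2 * n + 1) ^ 3) \<le> (5 * x) ^ 3"
proof -
  define n where "n = nat \<lceil>x\<rceil>"
  have n: "x \<le> real n" "real n \<le> x + 1"
    unfolding n_def using assms by linarith+
  then have "(2 * real n + 1) ^ 3 \<le> (5 * x) ^ 3"
    using assms by (intro power_mono) auto
  then show thesis using that[of n] n by (simp add: add.commute)
qed

lemma cov_thin_le:
  assumes "0 < \<delta>" "\<delta> \<le> D" "thin K D A"
  shows "real (cov K \<delta> A) \<le> (5 * D / \<delta>) ^ 3"
proof -
  have "1 \<le> D / \<delta>" using assms by simp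
  then obtain n where n: "D / \<delta> \<le> real n" "real ((2 * n + 1) ^ 3) \<le> (5 * (D / \<delta>)) ^ 3"
    by (rule ceiling_factor)
  have "D \<le> real n * \<delta>" using n(1) assms(1) by (simp add: field_simps)
  then obtain \<C> where C: "finite \<C>" "card \<C> \<le> (2 * n + 1) ^ 3" "\<forall>B\<in>\<C>. thin K \<delta> B" "A \<subseteq> \<Union>\<C>"
    by (rule thin_split[OF assms(1,3)])
  have "cov K \<delta> A \<le> card \<C>"
    using C cov_le[of \<C> K \<delta> "\<lambda>B. B" A] by simp
  then have "cov K \<delta> A \<le> (2 * n + 1) ^ 3" using C(2) by linarith
  then have "real (cov K \<delta> A) \<le> real ((2 * n + 1) ^ 3)" by (rule of_nat_mono)
  with n show ?thesis by simp
qed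

lemma cov_refine:
  assumes "bounded A" "0 < \<delta>" "\<delta> \<le> \<delta>'"
  shows "real (cov K \<delta> A) \<le> (5 * \<delta>' / \<delta>) ^ 3 * real (cov K \<delta>' A)"
proof -
  have "0 < \<delta>'" using assms by simp
  then obtain \<C> where C: "finite \<C>" "\<forall>B\<in>\<C>. thin K \<delta>' B" "A \<subseteq> \<Union>\<C>" "card \<C> = cov K \<delta>' A"
    using cov_obtain[OF assms(1)] by blast
  have "1 \<le> \<delta>' / \<delta>" using assms by simp
  then obtain n where n: "\<delta>' / \<delta> \<le> real n" "real ((2 * n + 1) ^ 3) \<le> (5 * (\<delta>' / \<delta>)) ^ 3"
    by (rule ceiling_factor)
  have "\<exists>\<D>. finite \<D> \<and> card \<D> \<le> (2 * n + 1) ^ 3 \<and> (\<forall>B\<in>\<D>. thin K \<delta> B) \<and> B' \<subseteq> \<Union>\<D>" if "B' \<in> \<C>" for B'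
  proof -
    have "thin K \<delta>' B'" "\<delta>' \<le> real n * \<delta>" using C that n assms by (auto simp: field_simps)
    then obtain \<D> where "finite \<D>" "card \<D> \<le> (2 * n + 1) ^ 3" "\<forall>B\<in>\<D>. thin K \<delta> B" "B' \<subseteq> \<Union>\<D>"
      by (rule thin_split[OF assms(2)])
    then show ?thesis by (intro exI[of _ \<D>] conjI)
  qed
  then obtain \<D> where D: "\<And>B. B \<in> \<C> \<Longrightarrow> finite (\<D> B)" "\<And>B. B \<in> \<C> \<Longrightarrow> card (\<D> B) \<le> (2 * n + 1) ^ 3"
    "\<And>B B'. B \<in> \<C> \<Longrightarrow> B' \<in> \<D> B \<Longrightarrow> thin K \<delta> B'" "\<And>B. B \<in> \<C> \<Longrightarrow> B \<subseteq> \<Union>(\<D> B)"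
    by metis
  have "cov K \<delta> A \<le> card (\<Union>B\<in>\<C>. \<D> B)"
  proof (rule cov_le[where B = "\<lambda>B. B"])
    show "A \<subseteq> (\<Union>B\<in>(\<Union>B\<in>\<C>. \<D> B). B)"
    proof
      fix x assume "x \<in> A"
      then obtain B where B: "B \<in> \<C>" "x \<in> B" using C(3) by blast
      then obtain B' where "B' \<in> \<D> B" "x \<in> B'" using D(4)[OF B(1)] by blast
      then show "x \<in> (\<Union>B\<in>(\<Union>B\<in>\<C>. \<D> B). B)" using B(1) by auto
    qed
    show "finite (\<Union>B\<in>\<C>. \<D> B)" using C(1) D(1) by (rule finite_UN_I)
    show "thin K \<delta> B" if "B \<in> (\<Union>B\<in>\<C>. \<D> B)" for B
      using that D(3) by (elim UN_E)
  qed
  also have "\<dots> \<le> (\<Sum>B\<in>\<C>. card (\<D> B))"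
    using C(1) by (rule card_UN_le)
  also have "\<dots> \<le> card \<C> * (2 * n + 1) ^ 3"
    using sum_bounded_above[of \<C> "\<lambda>B. card (\<D> B)" "(2 * n + 1) ^ 3"] D(2) by simp
  finally have "real (cov K \<delta> A) \<le> real (card \<C> * (2 * n + 1) ^ 3)" by (rule of_nat_mono)
  also have "\<dots> = real ((2 * n + 1) ^ 3) * real (cov K \<delta>' A)" using C(4) by simp
  also have "\<dots> \<le> (5 * (\<delta>' / \<delta>)) ^ 3 * real (cov K \<delta>' A)"
    using n(2) by (intro mult_right_mono) auto
  finally show ?thesis by simp
qed

lemma cov_UN_le:
  assumes "finite T" "0 < \<delta>" "\<And>t. t \<in> T \<Longrightarrow> bounded (P t)" "A \<subseteq> (\<Union>t\<in>T. P t)"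
  shows "cov K \<delta> A \<le> (\<Sum>t\<in>T. cov K \<delta> (P t))"
proof -
  have "\<exists>\<C>. finite \<C> \<and> (\<forall>B\<in>\<C>. thin K \<delta> B) \<and> P t \<subseteq> \<Union>\<C> \<and> card \<C> = cov K \<delta> (P t)" if "t \<in> T" for t
    using cov_obtain[OF assms(3)[OF that] assms(2), of K] by metis
  then obtain \<C> where C: "\<And>t. t \<in> T \<Longrightarrow> finite (\<C> t)" "\<And>t B. t \<in> T \<Longrightarrow> B \<in> \<C> t \<Longrightarrow> thin K \<delta> B"
    "\<And>t. t \<in> T \<Longrightarrow> P t \<subseteq> \<Union>(\<C> t)" "\<And>t. t \<in> T \<Longrightarrow> card (\<C> t) = cov K \<delta> (P t)"
    by metis
  have "cov K \<delta> A \<le> card (Sigma T \<C>)"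
  proof (rule cov_le[where B = snd])
    show "finite (Sigma T \<C>)" using assms(1) C(1) by (rule finite_SigmaI)
    show "thin K \<delta> (snd p)" if "p \<in> Sigma T \<C>" for p using that C(2) by auto
    show "A \<subseteq> (\<Union>p\<in>Sigma T \<C>. snd p)"
    proof
      fix x assume "x \<in> A"
      then obtain t where t: "t \<in> T" "x \<in> P t" using assms(4) by blast
      then obtain B where "B \<in> \<C> t" "x \<in> B" using C(3) by blast
      then show "x \<in> (\<Union>p\<in>Sigma T \<C>. snd p)" using t(1) by (intro UN_I[of "(t, B)"]) auto
    qed
  qed
  also have "\<dots> = (\<Sum>t\<in>T. cov K \<delta> (P t))"
    using assms(1) C(1,4) by (subst card_SigmaI) auto
  finally show ?thesis .
qed

text \<open>
  If no set of diameter \<open>\<delta>\<close> meets more than \<open>M\<close> of the pieces, then a cover of the whole set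
  counts as a cover of each piece, and each of its members is counted at most \<open>M\<close> times.
\<close>

lemma sum_cov_le:
  assumes "bounded A" "0 < \<delta>" "finite V" "\<And>v. v \<in> V \<Longrightarrow> P v \<subseteq> A"
    and "\<And>B. thin K \<delta> B \<Longrightarrow> card {v \<in> V. B \<inter> P v \<noteq> {}} \<le> M"
  shows "(\<Sum>v\<in>V. cov K \<delta> (P v)) \<le> M * cov K \<delta> A"
proof -
  obtain \<C> where C: "finite \<C>" "\<forall>B\<in>\<C>. thin K \<delta> B" "A \<subseteq> \<Union>\<C>" "card \<C> = cov K \<delta> A"
    using cov_obtain[OF assms(1,2)] by blast
  have "(\<Sum>v\<in>V. cov K \<delta> (P v)) \<le> (\<Sum>v\<in>V. card {B \<in> \<C>. B \<inter> P v \<noteq> {}})"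
  proof (rule sum_mono)
    fix v assume "v \<in> V"
    then have "P v \<subseteq> \<Union>\<C>" using C(3) assms(4) by blast
    then have "P v \<subseteq> (\<Union>B\<in>{B \<in> \<C>. B \<inter> P v \<noteq> {}}. B)" by blast
    then show "cov K \<delta> (P v) \<le> card {B \<in> \<C>. B \<inter> P v \<noteq> {}}"
      by (intro cov_le[where B = "\<lambda>B. B"]) (use C(1,2) in auto)
  qed
  also have "\<dots> = (\<Sum>B\<in>\<C>. card {v \<in> V. B \<inter> P v \<noteq> {}})"
    by (rule sum_multicount_gen) (use assms(3) C(1) in auto)
  also have "\<dots> \<le> (\<Sum>B\<in>\<C>. M)"
    using C(2) assms(5) by (intro sum_mono) auto
  finally show ?thesis using C(4) by (simp add: mult.commute)
qed

lemma sum_cov_separated: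
  assumes "bounded A" "0 < \<delta>" "finite V" "\<And>v. v \<in> V \<Longrightarrow> P v \<subseteq> A"
    and "\<And>v v' x y. v \<in> V \<Longrightarrow> v' \<in> V \<Longrightarrow> v \<noteq> v' \<Longrightarrow> x \<in> P v \<Longrightarrow> y \<in> P v' \<Longrightarrow> \<exists>k\<in>K. \<delta> < \<bar>x $ k - y $ k\<bar>"
  shows "(\<Sum>v\<in>V. cov K \<delta> (P v)) \<le> cov K \<delta> A"
proof -
  have "card {v \<in> V. B \<inter> P v \<noteq> {}} \<le> 1" if B: "thin K \<delta> B" for B
  proof -
    have "v = v'" if "v \<in> V" "v' \<in> V" "B \<inter> P v \<noteq> {}" "B \<inter> P v' \<noteq> {}" for v v'
    proof (rule ccontr)
      assume "v \<noteq> v'"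
      obtain x where x: "x \<in> B" "x \<in> P v" using \<open>B \<inter> P v \<noteq> {}\<close> by blast
      obtain y where y: "y \<in> B" "y \<in> P v'" using \<open>B \<inter> P v' \<noteq> {}\<close> by blast
      obtain k where "k \<in> K" "\<delta> < \<bar>x $ k - y $ k\<bar>"
        using assms(5)[OF \<open>v \<in> V\<close> \<open>v' \<in> V\<close> \<open>v \<noteq> v'\<close> x(2) y(2)] by blast
      then show False using B x(1) y(1) unfolding thin_def by (meson not_le)
    qed
    then show ?thesis
      by (subst One_nat_def, subst card_le_Suc0_iff_eq) (use assms(3) in auto)
  qed
  from sum_cov_le[OF assms(1-4) this] show ?thesis by simp
qed

definition separated :: "3 set \<Rightarrow> real \<Rightarrow> (real^3) set \<Rightarrow> bool" where
  "separated K \<eta> X \<longleftrightarrow> (\<forall>x\<in>X. \<forall>y\<in>X. x \<noteq> y \<longrightarrow> (\<exists>k\<in>K. \<eta> < \<bar>x $ k - y $ k\<bar>))"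

lemma card_separated_le:
  assumes "bounded A" "0 < \<eta>" "finite X" "X \<subseteq> A" "separated K \<eta> X"
  shows "card X \<le> cov K \<eta> A"
proof -
  have "card X = (\<Sum>x\<in>X. 1)" by simp
  also have "\<dots> \<le> (\<Sum>x\<in>X. cov K \<eta> {x})"
    using assms(2) by (intro sum_mono cov_pos) auto
  also have "\<dots> \<le> cov K \<eta> A"
    using assms by (intro sum_cov_separated) (auto simp: separated_def)
  finally show ?thesis .
qed

text \<open>The balls of radius \<open>\<eta>\<close> around a maximal separated set are a cover.\<close>

lemma maximal_separated:
  assumes "bounded A" "0 < \<eta>"
  obtains X where "finite X" "X \<subseteq> A" "separated K \<eta> X" "cov K (2 * \<eta>) A \<le> card X"
proof -
  define Q where "Q X \<longleftrightarrow> finite X \<and> X \<subseteq> A \<and> separated K \<eta> X" for X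
  have "Q {}" unfolding Q_def separated_def by simp
  moreover have "\<forall>X. Q X \<longrightarrow> card X \<le> cov K \<eta> A"
    using card_separated_le[OF assms] unfolding Q_def by blast
  ultimately obtain X where X: "Q X" and max: "\<And>Y. Q Y \<Longrightarrow> card Y \<le> card X"
    using ex_has_greatest_nat[of Q "{}" card] by (metis le_imp_less_Suc)
  have "cov K (2 * \<eta>) A \<le> card X"
  proof (rule cov_le[where B = "\<lambda>x. {y. \<forall>k\<in>K. \<bar>y $ k - x $ k\<bar> \<le> \<eta>}"])
    show "A \<subseteq> (\<Union>x\<in>X. {y. \<forall>k\<in>K. \<bar>y $ k - x $ k\<bar> \<le> \<eta>})"
    proof
      fix y assume y: "y \<in> A"
      show "y \<in> (\<Union>x\<in>X. {y. \<forall>k\<in>K. \<bar>y $ k - x $ k\<bar> \<le> \<eta>})"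
      proof (rule ccontr)
        assume "\<not> ?thesis"
        then have far: "\<exists>k\<in>K. \<eta> < \<bar>y $ k - x $ k\<bar>" if "x \<in> X" for x
          using that by (auto simp: not_le)
        then have "y \<notin> X" using assms(2) by force
        moreover have "Q (insert y X)"
          using X far y unfolding Q_def separated_def by (auto simp: abs_minus_commute)
        ultimately show False
          using max[of "insert y X"] X unfolding Q_def by simp
      qed
    qed
    show "thin K (2 * \<eta>) {y. \<forall>k\<in>K. \<bar>y $ k - x $ k\<bar> \<le> \<eta>}" for x
      unfolding thin_def
    proof (intro ballI)
      fix y z k assume "y \<in> {y. \<forall>k\<in>K. \<bar>y $ k - x $ k\<bar> \<le> \<eta>}" "z \<in> {y. \<forall>k\<in>K. \<bar>y $ k - x $ k\<bar> \<le> \<eta>}" "k \<in> K"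
      then have "\<bar>y $ k - x $ k\<bar> \<le> \<eta>" "\<bar>z $ k - x $ k\<bar> \<le> \<eta>" by auto
      then show "\<bar>y $ k - z $ k\<bar> \<le> 2 * \<eta>" by linarith
    qed
  qed (use X in \<open>simp add: Q_def\<close>)
  then show thesis using that X unfolding Q_def by blast
qed

lemma mem_cubes_cart: "Q \<in> cubes \<delta> \<longleftrightarrow> (\<exists>a :: real^3. Q = {x. \<forall>k. a $ k \<le> x $ k \<and> x $ k \<le> a $ k + \<delta>})"
proof -
  have "(One :: real^3) $ k = 1" for k
    unfolding cart_eq_inner_axis
    by (rule inner_sum_Basis) (simp add: axis_in_Basis_iff)
  then have "cbox a (a + \<delta> *\<^sub>R One) = {x. \<forall>k. a $ k \<le> x $ k \<and> x $ k \<le> a $ k + \<delta>}" for a :: "real^3"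
    by (auto simp: mem_box_cart)
  then show ?thesis unfolding cubes_def by auto
qed

lemma coord_proj_UNIV: "coord_proj UNIV ` A = A"
  by (simp add: coord_proj_def)

lemma cover_num_coord_proj:
  assumes "bounded A" "0 < \<delta>"
  shows "cover_num \<delta> (coord_proj K ` A) = cov K \<delta> A"
proof (rule antisym)
  obtain \<C> where C: "finite \<C>" "\<forall>B\<in>\<C>. thin K \<delta> B" "A \<subseteq> \<Union>\<C>" "card \<C> = cov K \<delta> A"
    using cov_obtain[OF assms] by blast
  define a where "a B = (\<chi> k. if k \<in> K then Inf ((\<lambda>x. x $ k) ` B) else 0)" for B :: "(real^3) set"
  define Q where "Q B = {x. \<forall>k. a B $ k \<le> x $ k \<and> x $ k \<le> a B $ k + \<delta>}" for B
  have Q: "coord_proj K x \<in> Q B" if "B \<in> \<C>" "x \<in> B" for B x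
  proof -
    have "a B $ k \<le> x $ k \<and> x $ k \<le> a B $ k + \<delta>" if k: "k \<in> K" for k
    proof -
      have le: "x $ k - \<delta> \<le> y $ k" if "y \<in> B" for y
      proof -
        have "\<bar>x $ k - y $ k\<bar> \<le> \<delta>"
          using C(2) \<open>B \<in> \<C>\<close> \<open>x \<in> B\<close> k that unfolding thin_def by blast
        then show ?thesis by linarith
      qed
      then have "bdd_below ((\<lambda>x. x $ k) ` B)" by (intro bdd_belowI) auto
      then have "Inf ((\<lambda>x. x $ k) ` B) \<le> x $ k" using \<open>x \<in> B\<close> by (intro cInf_lower) auto
      moreover have "x $ k - \<delta> \<le> Inf ((\<lambda>x. x $ k) ` B)"
        using le \<open>x \<in> B\<close> by (intro cInf_greatest) auto
      ultimately show ?thesis using k unfolding a_def by simp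
    qed
    then show ?thesis unfolding Q_def coord_proj_def using assms(2) by (auto simp: a_def)
  qed
  have "Q B \<in> cubes \<delta>" for B
    unfolding mem_cubes_cart Q_def by blast
  moreover have "coord_proj K ` A \<subseteq> \<Union> (Q ` \<C>)"
    using Q C(3) by blast
  ultimately have QC: "finite (Q ` \<C>) \<and> Q ` \<C> \<subseteq> cubes \<delta> \<and> coord_proj K ` A \<subseteq> \<Union> (Q ` \<C>)"
    using C(1) by blast
  have "cover_num \<delta> (coord_proj K ` A) \<le> card (Q ` \<C>)"
    unfolding cover_num_def by (rule cInf_lower) (use QC in blast, simp)
  also have "\<dots> \<le> cov K \<delta> A" using C card_image_le by metis
  finally show "cover_num \<delta> (coord_proj K ` A) \<le> cov K \<delta> A" .
  have "{card \<C> |\<C>. finite \<C> \<and> \<C> \<subseteq> cubes \<delta> \<and> coord_proj K ` A \<subseteq> \<Union> \<C>} \<noteq> {}"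
    using QC by blast
  from Inf_nat_def1[OF this] obtain \<D> where D: "finite \<D>" "\<D> \<subseteq> cubes \<delta>" "coord_proj K ` A \<subseteq> \<Union> \<D>"
    "card \<D> = cover_num \<delta> (coord_proj K ` A)"
    unfolding cover_num_def[symmetric] by auto
  have "cov K \<delta> A \<le> card \<D>"
  proof (rule cov_le[where B = "\<lambda>B. {x. coord_proj K x \<in> B}"])
    fix B assume "B \<in> \<D>"
    then obtain a where a: "B = {x. \<forall>k. a $ k \<le> x $ k \<and> x $ k \<le> a $ k + \<delta>}"
      using D(2) mem_cubes_cart by blast
    show "thin K \<delta> {x. coord_proj K x \<in> B}"
      unfolding thin_def
    proof (intro ballI)
      fix x y k assume "x \<in> {x. coord_proj K x \<in> B}" "y \<in> {x. coord_proj K x \<in> B}" "k \<in> K"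
      then have "a $ k \<le> x $ k \<and> x $ k \<le> a $ k + \<delta>" "a $ k \<le> y $ k \<and> y $ k \<le> a $ k + \<delta>"
        unfolding a coord_proj_def by (auto dest!: spec[of _ k])
      then show "\<bar>x $ k - y $ k\<bar> \<le> \<delta>" by linarith
    qed
  qed (use D in auto)
  then show "cov K \<delta> A \<le> cover_num \<delta> (coord_proj K ` A)" using D(4) by simp
qed

section \<open>Dimensions as growth exponents of covering numbers\<close>

lemma log_ratio_le_iff:
  fixes \<delta> x t :: real
  assumes "0 < \<delta>" "\<delta> < 1" "0 < x"
  shows "ln x / (- ln \<delta>) \<le> t \<longleftrightarrow> x \<le> \<delta> powr (- t)" "t \<le> ln x / (- ln \<delta>) \<longleftrightarrow> \<delta> powr (- t) \<le> x"
proof -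
  have "ln \<delta> < 0" using assms by simp
  then have *: "ln x / (- ln \<delta>) \<le> t \<longleftrightarrow> ln x \<le> ln (\<delta> powr (- t))"
    "t \<le> ln x / (- ln \<delta>) \<longleftrightarrow> ln (\<delta> powr (- t)) \<le> ln x"
    using assms by (auto simp add: field_simps ln_powr)
  have p: "0 < \<delta> powr (- t)" using assms by simp
  show "ln x / (- ln \<delta>) \<le> t \<longleftrightarrow> x \<le> \<delta> powr (- t)" "t \<le> ln x / (- ln \<delta>) \<longleftrightarrow> \<delta> powr (- t) \<le> x"
    by (simp_all only: * ln_le_cancel_iff[OF assms(3) p] ln_le_cancel_iff[OF p assms(3)])
qed

lemma tendsto_log_ratio_const: "((\<lambda>\<delta>. c / (- ln \<delta>) + t) \<longlongrightarrow> (t :: real)) (at_right 0)"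
proof -
  have "filterlim (\<lambda>\<delta>. - ln \<delta>) at_top (at_right (0 :: real))"
    using ln_at_0 by (simp add: filterlim_uminus_at_top)
  then have "((\<lambda>\<delta>. c / (- ln \<delta>)) \<longlongrightarrow> 0) (at_right 0)"
    by (intro real_tendsto_divide_at_top[OF tendsto_const])
  then show ?thesis using tendsto_add[OF _ tendsto_const[of t]] by fastforce
qed

lemma log_ratio_shift:
  fixes t :: real
  assumes "0 < \<delta>" "\<delta> < 1" "0 < C"
  shows "ln (C * \<delta> powr (- t)) / (- ln \<delta>) = ln C / (- ln \<delta>) + t"
proof -
  have "ln \<delta> < 0" using assms by simp
  then show ?thesis using assms by (simp add: ln_mult ln_powr field_simps)
qed

lemma eventually_at_right_0_lt1: "eventually (\<lambda>\<delta>::real. 0 < \<delta> \<and> \<delta> < 1) (at_right 0)"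
  unfolding eventually_at_right_field by (rule exI[of _ 1]) simp

lemma upper_box_dim_le:
  assumes "bounded A" "A \<noteq> {}" "0 < C" "\<And>\<delta>. 0 < \<delta> \<Longrightarrow> \<delta> < 1 \<Longrightarrow> real (cov K \<delta> A) \<le> C * \<delta> powr (- t)"
  shows "upper_box_dim (coord_proj K ` A) \<le> ereal t"
proof -
  have "upper_box_dim (coord_proj K ` A) \<le> Limsup (at_right 0) (\<lambda>\<delta>. ereal (ln C / (- ln \<delta>) + t))"
    unfolding upper_box_dim_def
  proof (rule Limsup_mono, rule eventually_mono[OF eventually_at_right_0_lt1])
    fix \<delta> :: real assume d: "0 < \<delta> \<and> \<delta> < 1"
    have "1 \<le> cov K \<delta> A" using cov_pos assms d by blast
    then have "ln (real (cov K \<delta> A)) \<le> ln (C * \<delta> powr (- t))"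
      using assms(4)[of \<delta>] d by (intro ln_mono) auto
    then have "ln (real (cov K \<delta> A)) / (- ln \<delta>) \<le> ln (C * \<delta> powr (- t)) / (- ln \<delta>)"
      using d by (intro divide_right_mono) auto
    then show "ereal (ln (real (cover_num \<delta> (coord_proj K ` A))) / (- ln \<delta>)) \<le> ereal (ln C / (- ln \<delta>) + t)"
      using d assms(1,3) by (simp only: cover_num_coord_proj log_ratio_shift ereal_less_eq)
  qed
  also have "\<dots> = ereal t"
    by (intro lim_imp_Limsup tendsto_ereal tendsto_log_ratio_const) simp
  finally show ?thesis .
qed

lemma lower_box_dim_ge:
  assumes "bounded A" "0 < C" "\<And>\<delta>. 0 < \<delta> \<Longrightarrow> \<delta> < 1 \<Longrightarrow> C * \<delta> powr (- t) \<le> real (cov K \<delta> A)"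
  shows "ereal t \<le> lower_box_dim (coord_proj K ` A)"
proof -
  have "ereal t = Liminf (at_right 0) (\<lambda>\<delta>. ereal (ln C / (- ln \<delta>) + t))"
    by (intro lim_imp_Liminf[symmetric] tendsto_ereal tendsto_log_ratio_const) simp
  also have "\<dots> \<le> lower_box_dim (coord_proj K ` A)"
    unfolding lower_box_dim_def
  proof (rule Liminf_mono, rule eventually_mono[OF eventually_at_right_0_lt1])
    fix \<delta> :: real assume d: "0 < \<delta> \<and> \<delta> < 1"
    have "0 < C * \<delta> powr (- t)" using d assms(2) by simp
    then have "ln (C * \<delta> powr (- t)) \<le> ln (real (cov K \<delta> A))"
      using assms(3)[of \<delta>] d by (intro ln_mono) auto
    then have "ln (C * \<delta> powr (- t)) / (- ln \<delta>) \<le> ln (real (cov K \<delta> A)) / (- ln \<delta>)"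
      using d by (intro divide_right_mono) auto
    then show "ereal (ln C / (- ln \<delta>) + t) \<le> ereal (ln (real (cover_num \<delta> (coord_proj K ` A))) / (- ln \<delta>))"
      using d assms(1,2) by (simp only: cover_num_coord_proj log_ratio_shift ereal_less_eq)
  qed
  finally show ?thesis .
qed

text \<open>
  The definition of the box dimensions only concerns small scales. The constant absorbs the
  scales between some \<open>d\<close> and 1, where covering numbers are bounded.
\<close>

lemma upper_box_dim_bound:
  assumes "bounded A" "A \<noteq> {}" "upper_box_dim (coord_proj K ` A) < ereal t" "0 \<le> t"
  obtains C where "0 < C" "\<And>\<delta>. 0 < \<delta> \<Longrightarrow> \<delta> \<le> 1 \<Longrightarrow> real (cov K \<delta> A) \<le> C * \<delta> powr (- t)"
proof -
  have "eventually (\<lambda>\<delta>. ereal (ln (real (cover_num \<delta> (coord_proj K ` A))) / (- ln \<delta>)) < ereal t) (at_right 0)"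
    using assms(3) unfolding upper_box_dim_def by (rule Limsup_lessD)
  then obtain b where b: "0 < b" "\<And>\<delta>. 0 < \<delta> \<Longrightarrow> \<delta> < b \<Longrightarrow> ln (real (cover_num \<delta> (coord_proj K ` A))) / (- ln \<delta>) < t"
    unfolding eventually_at_right_field by auto
  define d where "d = min b 1 / 2"
  have d: "0 < d" "d < b" "d < 1" using b(1) unfolding d_def by auto
  show thesis
  proof (rule that)
    show "0 < max 1 (real (cov K d A))" by simp
    fix \<delta> :: real assume del: "0 < \<delta>" "\<delta> \<le> 1"
    have p1: "1 \<le> \<delta> powr (- t)" using del assms(4) by (simp add: powr_mono2' powr_minus one_le_inverse_iff powr_le1)
    have "real (cov K \<delta> A) \<le> max 1 (real (cov K d A)) * \<delta> powr (- t)"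
    proof (cases "\<delta> < d")
      case True
      have "1 \<le> cov K \<delta> A" using cov_pos assms(1,2) del by blast
      moreover have "ln (real (cov K \<delta> A)) / (- ln \<delta>) \<le> t"
        using b(2)[of \<delta>] True d del assms(1) by (simp add: cover_num_coord_proj less_imp_le)
      ultimately have "real (cov K \<delta> A) \<le> \<delta> powr (- t)"
        using True d del by (subst (asm) log_ratio_le_iff(1)) auto
      also have "\<dots> \<le> max 1 (real (cov K d A)) * \<delta> powr (- t)"
        using mult_right_mono[of 1 "max 1 (real (cov K d A))" "\<delta> powr (- t)"] by simp
      finally show ?thesis .
    next
      case False
      then have "cov K \<delta> A \<le> cov K d A" using assms(1) d by (intro cov_mono) auto
      then have "real (cov K \<delta> A) \<le> max 1 (real (cov K d A)) * 1" by simp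
      also have "\<dots> \<le> max 1 (real (cov K d A)) * \<delta> powr (- t)"
        using p1 by (intro mult_left_mono) auto
      finally show ?thesis .
    qed
    then show "real (cov K \<delta> A) \<le> max 1 (real (cov K d A)) * \<delta> powr (- t)" .
  qed
qed

lemma lower_box_dim_bound:
  assumes "bounded A" "A \<noteq> {}" "ereal t < lower_box_dim (coord_proj K ` A)"
  obtains C where "0 < C" "\<And>\<delta>. 0 < \<delta> \<Longrightarrow> \<delta> \<le> 1 \<Longrightarrow> C * \<delta> powr (- t) \<le> real (cov K \<delta> A)"
proof -
  have "eventually (\<lambda>\<delta>. ereal t < ereal (ln (real (cover_num \<delta> (coord_proj K ` A))) / (- ln \<delta>))) (at_right 0)"
    using assms(3) unfolding lower_box_dim_def by (rule less_LiminfD)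
  then obtain b where b: "0 < b" "\<And>\<delta>. 0 < \<delta> \<Longrightarrow> \<delta> < b \<Longrightarrow> t < ln (real (cover_num \<delta> (coord_proj K ` A))) / (- ln \<delta>)"
    unfolding eventually_at_right_field by auto
  define d where "d = min b 1 / 2"
  have d: "0 < d" "d < b" "d < 1" using b(1) unfolding d_def by auto
  show thesis
  proof (rule that)
    show "0 < min 1 (d powr t)" using d by simp
    fix \<delta> :: real assume del: "0 < \<delta>" "\<delta> \<le> 1"
    have c1: "1 \<le> real (cov K \<delta> A)" using cov_pos[OF assms(1) del(1) assms(2)] by simp
    show "min 1 (d powr t) * \<delta> powr (- t) \<le> real (cov K \<delta> A)"
    proof (cases "\<delta> < d")
      case True
      have "t \<le> ln (real (cov K \<delta> A)) / (- ln \<delta>)"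
        using b(2)[of \<delta>] True d del assms(1) by (simp add: cover_num_coord_proj less_imp_le)
      then have "\<delta> powr (- t) \<le> real (cov K \<delta> A)"
        using True d del c1 by (subst (asm) log_ratio_le_iff(2)) auto
      moreover have "min 1 (d powr t) * \<delta> powr (- t) \<le> 1 * \<delta> powr (- t)"
        by (intro mult_right_mono) auto
      ultimately show ?thesis by simp
    next
      case False
      have "min 1 (d powr t) * \<delta> powr (- t) \<le> 1"
      proof (cases "0 \<le> t")
        case True
        have "min 1 (d powr t) * \<delta> powr (- t) \<le> d powr t * \<delta> powr (- t)"
          by (intro mult_right_mono) auto
        also have "\<dots> \<le> \<delta> powr t * \<delta> powr (- t)"
          using True False d by (intro mult_right_mono powr_mono2) auto
        also have "\<dots> = 1" using del by (simp add: powr_minus)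
        finally show ?thesis .
      next
        case False
        then have "\<delta> powr (- t) \<le> 1" using del by (simp add: powr_le1)
        then show ?thesis by (meson min.cobounded1 mult_le_one powr_ge_zero)
      qed
      with c1 show ?thesis by simp
    qed
  qed
qed

lemma lower_box_dim_nonneg:
  assumes "bounded A" "A \<noteq> {}"
  shows "0 \<le> lower_box_dim (coord_proj K ` A)"
proof -
  have "1 * \<delta> powr (- 0) \<le> real (cov K \<delta> A)" if "0 < \<delta>" for \<delta>
    using cov_pos[OF assms(1) that assms(2), of K] that by simp
  then show ?thesis
    using lower_box_dim_ge[OF assms(1), of 1 0 K] by (simp add: zero_ereal_def)
qed

lemma lower_box_dim_le_upper_box_dim: "lower_box_dim E \<le> upper_box_dim E"
  unfolding lower_box_dim_def upper_box_dim_def by (rule Liminf_le_Limsup) simp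

lemma upper_box_dim_le_3:
  assumes "bounded A" "A \<noteq> {}"
  shows "upper_box_dim (coord_proj K ` A) \<le> 3"
proof -
  obtain D where D: "0 < D" "thin K D A" using bounded_imp_thin[OF assms(1)] by blast
  define D' where "D' = max D 1"
  have D': "thin K D' A" "1 \<le> D'" using D unfolding thin_def D'_def by (auto simp: max.coboundedI1)
  have "real (cov K \<delta> A) \<le> (5 * D') ^ 3 * \<delta> powr (- 3)" if "0 < \<delta>" "\<delta> < 1" for \<delta>
  proof -
    have "real (cov K \<delta> A) \<le> (5 * D' / \<delta>) ^ 3"
      using that D' by (intro cov_thin_le) auto
    also have "\<dots> = (5 * D') ^ 3 * \<delta> powr (- 3)"
      using that by (simp add: power_divide powr_minus powr_numeral field_simps)
    finally show ?thesis .
  qed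
  then have "upper_box_dim (coord_proj K ` A) \<le> ereal 3"
    using D' by (intro upper_box_dim_le[OF assms, of "(5 * D') ^ 3"]) auto
  then show ?thesis by simp
qed

lemma box_dim_real:
  assumes "bounded A" "A \<noteq> {}"
  shows "ereal (real_of_ereal (upper_box_dim (coord_proj K ` A))) = upper_box_dim (coord_proj K ` A)"
    "ereal (real_of_ereal (lower_box_dim (coord_proj K ` A))) = lower_box_dim (coord_proj K ` A)"
    "0 \<le> upper_box_dim (coord_proj K ` A)"
proof -
  note * = lower_box_dim_nonneg[OF assms, of K] lower_box_dim_le_upper_box_dim[of "coord_proj K ` A"]
    upper_box_dim_le_3[OF assms, of K]
  then show "0 \<le> upper_box_dim (coord_proj K ` A)" by simp
  have "upper_box_dim (coord_proj K ` A) < \<infinity>" "lower_box_dim (coord_proj K ` A) < \<infinity>"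
    "- \<infinity> < upper_box_dim (coord_proj K ` A)" "- \<infinity> < lower_box_dim (coord_proj K ` A)"
    using * by (auto intro: le_less_trans less_le_trans)
  then show "ereal (real_of_ereal (upper_box_dim (coord_proj K ` A))) = upper_box_dim (coord_proj K ` A)"
    "ereal (real_of_ereal (lower_box_dim (coord_proj K ` A))) = lower_box_dim (coord_proj K ` A)"
    by (auto simp: ereal_real less_ereal.simps)
qed

lemma ereal_le_if_reals_below_le:
  fixes x y :: ereal
  assumes "\<And>t. ereal t < x \<Longrightarrow> ereal t \<le> y"
  shows "x \<le> y"
  using assms ereal_dense2[of y x] by (metis not_le)

lemma box_dim_mono:
  assumes "bounded A" "A \<noteq> {}" "bounded A'" "A' \<noteq> {}" "0 < M"
    and "\<And>\<delta>. 0 < \<delta> \<Longrightarrow> \<delta> < 1 \<Longrightarrow> real (cov K \<delta> A) \<le> M * real (cov K' \<delta> A')"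
  shows "upper_box_dim (coord_proj K ` A) \<le> upper_box_dim (coord_proj K' ` A')"
    and "lower_box_dim (coord_proj K ` A) \<le> lower_box_dim (coord_proj K' ` A')"
proof -
  show "upper_box_dim (coord_proj K ` A) \<le> upper_box_dim (coord_proj K' ` A')"
  proof (rule ereal_le_real)
    fix t assume "upper_box_dim (coord_proj K' ` A') \<le> ereal t"
    then have t: "0 \<le> t"
      using box_dim_real(3)[OF assms(3,4), of K'] by (metis ereal_less_eq(5) order_trans)
    show "upper_box_dim (coord_proj K ` A) \<le> ereal t"
    proof (rule ereal_le_epsilon2)
      fix e :: real assume "0 < e"
      have "upper_box_dim (coord_proj K' ` A') < ereal (t + e)"
        using \<open>upper_box_dim (coord_proj K' ` A') \<le> ereal t\<close> \<open>0 < e\<close> by (auto intro: le_less_trans)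
      then obtain C where C: "0 < C" "\<And>\<delta>. 0 < \<delta> \<Longrightarrow> \<delta> \<le> 1 \<Longrightarrow> real (cov K' \<delta> A') \<le> C * \<delta> powr (- (t + e))"
        by (rule upper_box_dim_bound[OF assms(3,4)]) (use t \<open>0 < e\<close> in auto)
      have "real (cov K \<delta> A) \<le> (M * C) * \<delta> powr (- (t + e))" if "0 < \<delta>" "\<delta> < 1" for \<delta>
      proof -
        have "M * real (cov K' \<delta> A') \<le> M * (C * \<delta> powr (- (t + e)))"
          using C(2)[of \<delta>] that assms(5) by (intro mult_left_mono) auto
        then show ?thesis using assms(6)[OF that] by simp
      qed
      then have "upper_box_dim (coord_proj K ` A) \<le> ereal (t + e)"
        using C(1) assms(5) by (intro upper_box_dim_le[OF assms(1,2), of "M * C"]) auto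
      then show "upper_box_dim (coord_proj K ` A) \<le> ereal t + ereal e" by simp
    qed
  qed
  show "lower_box_dim (coord_proj K ` A) \<le> lower_box_dim (coord_proj K' ` A')"
  proof (rule ereal_le_if_reals_below_le)
    fix t assume t: "ereal t < lower_box_dim (coord_proj K ` A)"
    obtain C where C: "0 < C" "\<And>\<delta>. 0 < \<delta> \<Longrightarrow> \<delta> \<le> 1 \<Longrightarrow> C * \<delta> powr (- t) \<le> real (cov K \<delta> A)"
      using lower_box_dim_bound[OF assms(1,2) t] by blast
    have "C / M * \<delta> powr (- t) \<le> real (cov K' \<delta> A')" if "0 < \<delta>" "\<delta> < 1" for \<delta>
      using C(2)[of \<delta>] that assms(5,6) by (simp add: field_simps) (meson less_imp_le order_trans)
    then show "ereal t \<le> lower_box_dim (coord_proj K' ` A')"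
      using C(1) assms(5) by (intro lower_box_dim_ge[OF assms(3), of "C / M"]) auto
  qed
qed

text \<open>
  The part of the set that projects into an interval of length \<open>2 R\<close> on the \<open>k\<close>-th axis: the
  balls of the projection, seen in the set itself.
\<close>

definition slab :: "3 \<Rightarrow> real^3 \<Rightarrow> real \<Rightarrow> (real^3) set \<Rightarrow> (real^3) set" where
  "slab k x R A = {y \<in> A. \<bar>y $ k - x $ k\<bar> \<le> R}"

definition qA_bound :: "3 \<Rightarrow> (real^3) set \<Rightarrow> real \<Rightarrow> real \<Rightarrow> bool" where
  "qA_bound k A \<epsilon> \<alpha> \<longleftrightarrow> (\<exists>C>0. \<forall>r R. \<forall>x\<in>A. 0 < r \<and> 0 < R \<and> r \<le> R powr (1 + \<epsilon>) \<and> R < 1 \<longrightarrow>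
     real (cov {k} r (slab k x R A)) \<le> C * (R / r) powr \<alpha>)"

lemma thin_slab: "thin {k} (2 * R) (slab k x R A)"
  unfolding thin_def
proof (intro ballI)
  fix y z j assume "y \<in> slab k x R A" "z \<in> slab k x R A" "j \<in> {k}"
  then have "\<bar>y $ k - x $ k\<bar> \<le> R" "\<bar>z $ k - x $ k\<bar> \<le> R" "j = k" unfolding slab_def by auto
  then show "\<bar>y $ j - z $ j\<bar> \<le> 2 * R" by simp
qed

lemma bounded_slab: "bounded A \<Longrightarrow> bounded (slab k x R A)"
  unfolding slab_def by (rule bounded_subset) auto

lemma coord_proj_axis: "coord_proj {k} x = axis k (x $ k)"
  unfolding coord_proj_def axis_def by (auto simp: vec_eq_iff)

lemma cball_Int_coord_proj:
  "cball (coord_proj {k} x) R \<inter> coord_proj {k} ` A = coord_proj {k} ` slab k x R A"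
proof -
  have "dist (coord_proj {k} x) (coord_proj {k} y) = \<bar>y $ k - x $ k\<bar>" for y
  proof -
    have axis: "coord_proj {k} x - coord_proj {k} y = (x $ k - y $ k) *\<^sub>R axis k 1"
      unfolding coord_proj_axis by (auto simp: vec_eq_iff axis_def)
    then show ?thesis by (simp add: dist_norm axis abs_minus_commute)
  qed
  then show ?thesis unfolding slab_def by auto
qed

lemma qA_exponent_eq:
  assumes "bounded A" "0 < \<epsilon>"
  shows "qA_exponent (coord_proj {k} ` A) \<epsilon> = Inf {ereal \<alpha> |\<alpha>. qA_bound k A \<epsilon> \<alpha>}"
proof -
  have "R powr (1 + \<epsilon>) < 1 \<longleftrightarrow> R < 1" if "0 < R" for R :: real
    using powr_less_mono2[of "1 + \<epsilon>" R 1] ge_one_powr_ge_zero[of R "1 + \<epsilon>"] that assms(2)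
    by (metis add_pos_pos less_eq_real_def not_le powr_one_eq_one zero_less_one)
  then have "(\<forall>x\<in>coord_proj {k} ` A. 0 < r \<and> 0 < R \<and> r \<le> R powr (1 + \<epsilon>) \<and> R powr (1 + \<epsilon>) < 1 \<longrightarrow>
       real (cover_num r (cball x R \<inter> coord_proj {k} ` A)) \<le> b) \<longleftrightarrow>
      (\<forall>x\<in>A. 0 < r \<and> 0 < R \<and> r \<le> R powr (1 + \<epsilon>) \<and> R < 1 \<longrightarrow> real (cov {k} r (slab k x R A)) \<le> b)" for r R b
    using cover_num_coord_proj[OF bounded_slab[OF assms(1)]]
    by (auto simp add: cball_Int_coord_proj)
  then show ?thesis
    unfolding qA_exponent_def qA_bound_def by presburger
qed

lemma qA_bound_antimono:
  assumes "qA_bound k A \<epsilon> \<alpha>" "\<epsilon> \<le> \<epsilon>'"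
  shows "qA_bound k A \<epsilon>' \<alpha>"
proof -
  obtain C where C: "0 < C" "\<And>r R x. x \<in> A \<Longrightarrow> 0 < r \<Longrightarrow> 0 < R \<Longrightarrow> r \<le> R powr (1 + \<epsilon>) \<Longrightarrow> R < 1 \<Longrightarrow>
     real (cov {k} r (slab k x R A)) \<le> C * (R / r) powr \<alpha>"
    using assms(1) unfolding qA_bound_def by blast
  have "real (cov {k} r (slab k x R A)) \<le> C * (R / r) powr \<alpha>"
    if "x \<in> A" "0 < r" "0 < R" "r \<le> R powr (1 + \<epsilon>')" "R < 1" for r R x
  proof -
    have "R powr (1 + \<epsilon>') \<le> R powr (1 + \<epsilon>)"
      using that assms(2) by (intro powr_mono') auto
    then show ?thesis using C(2) that by (meson order_trans)
  qed
  then show ?thesis using C(1) unfolding qA_bound_def by blast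
qed

lemma qA_bound_3:
  assumes "0 < \<epsilon>"
  shows "qA_bound k A \<epsilon> 3"
proof -
  have "real (cov {k} r (slab k x R A)) \<le> 1000 * (R / r) powr 3"
    if "0 < r" "0 < R" "r \<le> R powr (1 + \<epsilon>)" "R < 1" for r R x
  proof -
    have "R powr (1 + \<epsilon>) \<le> R powr 1"
      using that assms by (intro powr_mono') auto
    then have "r \<le> 2 * R" using that by simp
    then have "real (cov {k} r (slab k x R A)) \<le> (5 * (2 * R) / r) ^ 3"
      using that by (intro cov_thin_le thin_slab) auto
    also have "\<dots> = 1000 * (R / r) powr 3"
      using that by (simp add: powr_numeral power_divide power_mult_distrib)
    finally show ?thesis .
  qed
  then show ?thesis unfolding qA_bound_def by (intro exI[of _ 1000]) auto
qed

lemma qA_bound_nonneg: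
  assumes "bounded A" "A \<noteq> {}" "0 < \<epsilon>" "qA_bound k A \<epsilon> \<alpha>"
  shows "0 \<le> \<alpha>"
proof (rule ccontr)
  assume "\<not> 0 \<le> \<alpha>"
  then have neg: "\<alpha> < 0" by simp
  obtain x where x: "x \<in> A" using assms(2) by blast
  obtain C where C: "0 < C" "\<And>r R x. x \<in> A \<Longrightarrow> 0 < r \<Longrightarrow> 0 < R \<Longrightarrow> r \<le> R powr (1 + \<epsilon>) \<Longrightarrow> R < 1 \<Longrightarrow>
     real (cov {k} r (slab k x R A)) \<le> C * (R / r) powr \<alpha>"
    using assms(4) unfolding qA_bound_def by blast
  \<comment> \<open>The scale \<open>r = y / 2\<close> is admissible for \<open>R = 1/2\<close> and makes the bound less than 1.\<close>
  define y where "y = min ((1/2) powr \<epsilon>) ((1 / (2 * C)) powr (1 / (- \<alpha>)))"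
  have y: "0 < y" "y \<le> (1/2) powr \<epsilon>" "y \<le> (1 / (2 * C)) powr (1 / (- \<alpha>))"
    unfolding y_def using C(1) by auto
  have "y powr (- \<alpha>) \<le> ((1 / (2 * C)) powr (1 / (- \<alpha>))) powr (- \<alpha>)"
    using y neg by (intro powr_mono2) auto
  also have "\<dots> = 1 / (2 * C)"
    using neg C(1) by (simp add: powr_powr)
  finally have "C * y powr (- \<alpha>) \<le> 1 / 2"
    using C(1) by (simp add: field_simps)
  moreover have "(1 / 2) powr (1 + \<epsilon>) = 1 / 2 * (1/2) powr \<epsilon>"
    by (simp add: powr_add)
  then have "real (cov {k} (y / 2) (slab k x (1/2) A)) \<le> C * ((1/2) / (y / 2)) powr \<alpha>"
    using y by (intro C(2)[OF x]) auto
  moreover have "((1/2) / (y / 2)) powr \<alpha> = y powr (- \<alpha>)"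
    using y(1) by (simp add: powr_divide powr_minus_divide)
  moreover have "1 \<le> cov {k} (y / 2) (slab k x (1/2) A)"
    using x y(1) by (intro cov_pos bounded_slab assms(1)) (auto simp: slab_def)
  ultimately show False by simp
qed

lemma qA_exponent_antimono:
  assumes "bounded A" "0 < \<epsilon>" "\<epsilon> \<le> \<epsilon>'"
  shows "qA_exponent (coord_proj {k} ` A) \<epsilon>' \<le> qA_exponent (coord_proj {k} ` A) \<epsilon>"
  using assms qA_bound_antimono[OF _ assms(3)]
  by (simp add: qA_exponent_eq) (rule Inf_superset_mono, auto)

lemma qA_exponent_bounds:
  assumes "bounded A" "A \<noteq> {}" "0 < \<epsilon>"
  shows "0 \<le> qA_exponent (coord_proj {k} ` A) \<epsilon>" "qA_exponent (coord_proj {k} ` A) \<epsilon> \<le> 3"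
proof -
  show "0 \<le> qA_exponent (coord_proj {k} ` A) \<epsilon>"
    unfolding qA_exponent_eq[OF assms(1,3)]
    using qA_bound_nonneg[OF assms] by (auto intro!: Inf_greatest)
  have "qA_exponent (coord_proj {k} ` A) \<epsilon> \<le> ereal 3"
    unfolding qA_exponent_eq[OF assms(1,3)]
    using qA_bound_3[OF assms(3)] by (auto intro!: Inf_lower)
  then show "qA_exponent (coord_proj {k} ` A) \<epsilon> \<le> 3" by simp
qed

text \<open>
  The condition \<open>r \<le> R\<^bsup>1+\<epsilon>\<^esup>\<close> weakens as \<open>\<epsilon>\<close> decreases, so the limit defining the
  quasi-Assouad dimension is a supremum.
\<close>

lemma qA_dim_eq_SUP:
  assumes "bounded A"
  shows "qA_dim (coord_proj {k} ` A) = (SUP \<epsilon>\<in>{0<..}. qA_exponent (coord_proj {k} ` A) \<epsilon>)"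
  (is "_ = ?s")
proof -
  have "(qA_exponent (coord_proj {k} ` A) \<longlongrightarrow> ?s) (at_right 0)"
  proof (rule increasing_tendsto)
    show "eventually (\<lambda>\<epsilon>. qA_exponent (coord_proj {k} ` A) \<epsilon> \<le> ?s) (at_right 0)"
      by (rule eventually_mono[OF eventually_at_right_0_lt1]) (auto intro: SUP_upper)
    fix a assume "a < ?s"
    then obtain e where e: "0 < e" "a < qA_exponent (coord_proj {k} ` A) e"
      by (auto simp: less_SUP_iff)
    then show "eventually (\<lambda>\<epsilon>. a < qA_exponent (coord_proj {k} ` A) \<epsilon>) (at_right 0)"
      unfolding eventually_at_right_field
      using qA_exponent_antimono[OF assms] by (intro exI[of _ e]) (auto intro: less_le_trans)
  qed
  then show ?thesis
    unfolding qA_dim_def by (intro tendsto_Lim) auto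
qed

lemma qA_dim_bounds:
  assumes "bounded A" "A \<noteq> {}"
  shows "0 \<le> qA_dim (coord_proj {k} ` A)"
    and "ereal (real_of_ereal (qA_dim (coord_proj {k} ` A))) = qA_dim (coord_proj {k} ` A)"
    and "0 < \<epsilon> \<Longrightarrow> qA_exponent (coord_proj {k} ` A) \<epsilon> \<le> qA_dim (coord_proj {k} ` A)"
proof -
  have le: "qA_exponent (coord_proj {k} ` A) \<epsilon> \<le> qA_dim (coord_proj {k} ` A)" if "0 < \<epsilon>" for \<epsilon>
    unfolding qA_dim_eq_SUP[OF assms(1)] using that by (intro SUP_upper) auto
  then show "0 < \<epsilon> \<Longrightarrow> qA_exponent (coord_proj {k} ` A) \<epsilon> \<le> qA_dim (coord_proj {k} ` A)" .
  show "0 \<le> qA_dim (coord_proj {k} ` A)"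
    using qA_exponent_bounds(1)[OF assms, of 1] le[of 1] by (meson order_trans zero_less_one)
  moreover have "qA_dim (coord_proj {k} ` A) \<le> 3"
    unfolding qA_dim_eq_SUP[OF assms(1)] using qA_exponent_bounds(2)[OF assms] by (intro SUP_least) auto
  ultimately show "ereal (real_of_ereal (qA_dim (coord_proj {k} ` A))) = qA_dim (coord_proj {k} ` A)"
    by (intro ereal_real') (auto simp: abs_eq_infinity_cases)
qed

text \<open>
  What the quasi-Assouad dimension provides: an estimate for all pairs of scales, up to a
  factor that is subexponential in \<open>- ln r\<close>. When \<open>r\<close> is too close to \<open>R\<close> for the definition to
  apply, \<open>R / r\<close> is itself such a factor.
\<close>

lemma qA_dim_cov_bound:
  assumes "bounded A" "A \<noteq> {}" "0 < e"
  obtains C where "0 < C" "\<And>r R x. x \<in> A \<Longrightarrow> 0 < r \<Longrightarrow> r \<le> 2 * R \<Longrightarrow> R \<le> 1/2 \<Longrightarrow>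
    real (cov {k} r (slab k x R A)) \<le> C * r powr (- e) * (R / r) powr real_of_ereal (qA_dim (coord_proj {k} ` A))"
proof -
  define q where "q = real_of_ereal (qA_dim (coord_proj {k} ` A))"
  define \<eta> where "\<eta> = e / 3"
  have \<eta>: "0 < \<eta>" unfolding \<eta>_def using assms(3) by simp
  have q: "ereal q = qA_dim (coord_proj {k} ` A)" "0 \<le> q"
    unfolding q_def using qA_dim_bounds[OF assms(1,2)] by (auto simp: real_of_ereal_pos)
  have "qA_exponent (coord_proj {k} ` A) \<eta> < ereal (q + e)"
    using qA_dim_bounds(3)[OF assms(1,2) \<eta>, of k] unfolding q(1)[symmetric]
    by (rule le_less_trans) (simp add: assms(3))
  then obtain \<alpha> where \<alpha>: "\<alpha> < q + e" "qA_bound k A \<eta> \<alpha>"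
    unfolding qA_exponent_eq[OF assms(1) \<eta>] Inf_less_iff by auto
  obtain C where C: "0 < C" "\<And>r R x. x \<in> A \<Longrightarrow> 0 < r \<Longrightarrow> 0 < R \<Longrightarrow> r \<le> R powr (1 + \<eta>) \<Longrightarrow> R < 1 \<Longrightarrow>
     real (cov {k} r (slab k x R A)) \<le> C * (R / r) powr \<alpha>"
    using \<alpha>(2) unfolding qA_bound_def by blast
  define C' where "C' = max C (1000 * 2 powr e * 2 powr q)"
  show thesis
  proof (rule that, fold q_def)
    show "0 < C'" unfolding C'_def using C(1) by simp
    fix r R :: real and x assume h: "x \<in> A" "0 < r" "r \<le> 2 * R" "R \<le> 1/2"
    then have R: "0 < R" by linarith
    show "real (cov {k} r (slab k x R A)) \<le> C' * r powr (- e) * (R / r) powr q"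
    proof (cases "r \<le> R powr (1 + \<eta>)")
      case True
      have "R powr (1 + \<eta>) \<le> R powr 1" using R h \<eta> by (intro powr_mono') auto
      then have Rr: "1 \<le> R / r" using True h R by simp
      have "real (cov {k} r (slab k x R A)) \<le> C * (R / r) powr \<alpha>"
        using C(2) h R True by simp
      also have "\<dots> \<le> C * ((R / r) powr e * (R / r) powr q)"
        using Rr \<alpha>(1) C(1) by (intro mult_left_mono) (auto simp: powr_add[symmetric] intro!: powr_mono)
      also have "\<dots> \<le> C' * (r powr (- e) * (R / r) powr q)"
      proof (intro mult_mono)
        have "(R / r) powr e \<le> (1 / r) powr e"
          using h R assms(3) by (intro powr_mono2 divide_right_mono) auto
        also have "\<dots> = r powr (- e)" using h by (simp add: powr_divide powr_minus_divide)
        finally show "(R / r) powr e \<le> r powr (- e)" .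
      qed (use C(1) in \<open>auto simp: C'_def\<close>)
      finally show ?thesis by (simp add: mult.assoc)
    next
      case False
      have Rr: "1/2 \<le> R / r" using h by (simp add: field_simps)
      have "R * R powr \<eta> < r" using False R by (simp add: powr_add)
      then have "R / r \<le> R powr (- \<eta>)"
        using R h(2) by (simp add: powr_minus field_simps)
      also have "\<dots> \<le> (r / 2) powr (- \<eta>)"
        using h R \<eta> by (intro powr_mono2') auto
      finally have Rr': "R / r \<le> (r / 2) powr (- \<eta>)" .
      have "real (cov {k} r (slab k x R A)) \<le> (5 * (2 * R) / r) ^ 3"
        using h R by (intro cov_thin_le thin_slab) auto
      also have "\<dots> = 1000 * (R / r) ^ 3"
        by (simp add: power_divide power_mult_distrib)
      also have "\<dots> \<le> 1000 * ((r / 2) powr (- \<eta>)) ^ 3"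
        using Rr' R h by (intro mult_left_mono power_mono) auto
      also have "((r / 2) powr (- \<eta>)) ^ 3 = (r / 2) powr (- e)"
        using h(2) by (simp add: \<eta>_def powr_powr flip: powr_numeral)
      also have "\<dots> = 2 powr e * r powr (- e)"
        using h(2) by (simp add: powr_divide powr_minus_divide)
      also have "1000 * (2 powr e * r powr (- e)) = (1000 * 2 powr e * 2 powr q) * r powr (- e) * (1/2) powr q"
        by (simp add: powr_divide)
      also have "\<dots> \<le> C' * r powr (- e) * (R / r) powr q"
        using Rr q(2) by (intro mult_mono[OF mult_right_mono powr_mono2]) (auto simp: C'_def le_max_iff_disj)
      finally show ?thesis .
    qed
  qed
qed

text \<open>
  Rescaling by \<open>\<rho>\<close> does not preserve the condition \<open>r \<le> R\<^bsup>1+\<epsilon>\<^esup>\<close>; using the smaller scale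
  \<open>\<rho>\<^bsup>1+\<epsilon>\<^esup> r\<close> in place of \<open>\<rho> r\<close> repairs this at the price of a constant.
\<close>

lemma qA_dim_mono:
  assumes "bounded A" "bounded A'" "0 < \<rho>" "h ` A \<subseteq> A'"
    and "\<And>x y. x \<in> A \<Longrightarrow> y \<in> A \<Longrightarrow> \<bar>h x $ k' - h y $ k'\<bar> = \<rho> * \<bar>x $ k - y $ k\<bar>" and "\<rho> \<le> 1"
  shows "qA_dim (coord_proj {k} ` A) \<le> qA_dim (coord_proj {k'} ` A')"
proof -
  have "qA_bound k A \<epsilon> \<alpha>" if Q: "qA_bound k' A' \<epsilon> \<alpha>" and "0 < \<epsilon>" for \<epsilon> \<alpha>
  proof -
    obtain C where C: "0 < C" "\<And>r R x. x \<in> A' \<Longrightarrow> 0 < r \<Longrightarrow> 0 < R \<Longrightarrow> r \<le> R powr (1 + \<epsilon>) \<Longrightarrow> R < 1 \<Longrightarrow>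
       real (cov {k'} r (slab k' x R A')) \<le> C * (R / r) powr \<alpha>"
      using Q unfolding qA_bound_def by blast
    have "real (cov {k} r (slab k x R A)) \<le> (C * \<rho> powr (- \<epsilon> * \<alpha>)) * (R / r) powr \<alpha>"
      if h: "x \<in> A" "0 < r" "0 < R" "r \<le> R powr (1 + \<epsilon>)" "R < 1" for r R x
    proof -
      have "\<rho> powr (1 + \<epsilon>) * r \<le> (\<rho> * R) powr (1 + \<epsilon>)"
        using h assms(3) by (simp add: powr_mult mult_left_mono)
      moreover have "\<rho> powr (1 + \<epsilon>) \<le> \<rho> powr 1"
        using assms(3,6) \<open>0 < \<epsilon>\<close> by (intro powr_mono') auto
      then have le: "\<rho> powr (1 + \<epsilon>) * r \<le> \<rho> * r" using h assms(3) by simp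
      moreover have "\<rho> * R \<le> 1 * R" using h assms(6) by (intro mult_right_mono) auto
      then have "\<rho> * R < 1" using h(5) by linarith
      ultimately have "real (cov {k'} (\<rho> powr (1 + \<epsilon>) * r) (slab k' (h x) (\<rho> * R) A')) \<le>
          C * ((\<rho> * R) / (\<rho> powr (1 + \<epsilon>) * r)) powr \<alpha>"
        using h assms(3,4) by (intro C(2)) auto
      also have "(\<rho> * R) / (\<rho> powr (1 + \<epsilon>) * r) = \<rho> powr (- \<epsilon>) * (R / r)"
        using assms(3) by (simp add: powr_add powr_minus field_simps)
      also have "(\<rho> powr (- \<epsilon>) * (R / r)) powr \<alpha> = \<rho> powr (- \<epsilon> * \<alpha>) * (R / r) powr \<alpha>"
        using h assms(3) by (subst powr_mult) (simp_all add: powr_powr)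
      finally have "real (cov {k'} (\<rho> powr (1 + \<epsilon>) * r) (slab k' (h x) (\<rho> * R) A')) \<le>
          (C * \<rho> powr (- \<epsilon> * \<alpha>)) * (R / r) powr \<alpha>" by (simp add: mult.assoc)
      moreover have "cov {k} r (slab k x R A) \<le> cov {k'} (\<rho> powr (1 + \<epsilon>) * r) (slab k' (h x) (\<rho> * R) A')"
      proof (rule cov_transfer[where h = h])
        show "bounded (slab k' (h x) (\<rho> * R) A')" using assms(2) by (rule bounded_slab)
        show "0 < \<rho> powr (1 + \<epsilon>) * r" using h assms(3) by simp
        show "h ` slab k x R A \<subseteq> slab k' (h x) (\<rho> * R) A'"
          unfolding slab_def using assms(3,4,5) h(1) by auto
      next
        fix y z j assume "y \<in> slab k x R A" "z \<in> slab k x R A" "\<forall>j\<in>{k'}. \<bar>h y $ j - h z $ j\<bar> \<le> \<rho> powr (1 + \<epsilon>) * r" "j \<in> {k}"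
        then have "\<rho> * \<bar>y $ k - z $ k\<bar> \<le> \<rho> * r" "j = k"
          using le assms(5)[of y z] unfolding slab_def by auto
        then show "\<bar>y $ j - z $ j\<bar> \<le> r" using assms(3) by simp
      qed
      ultimately show ?thesis by linarith
    qed
    then show ?thesis
      unfolding qA_bound_def using C(1) assms(3) by (intro exI[of _ "C * \<rho> powr (- \<epsilon> * \<alpha>)"]) auto
  qed
  then have "qA_exponent (coord_proj {k} ` A) \<epsilon> \<le> qA_exponent (coord_proj {k'} ` A') \<epsilon>" if "0 < \<epsilon>" for \<epsilon>
    unfolding qA_exponent_eq[OF assms(1) that] qA_exponent_eq[OF assms(2) that]
    using that by (intro Inf_superset_mono) auto
  then show ?thesis
    unfolding qA_dim_eq_SUP[OF assms(1)] qA_dim_eq_SUP[OF assms(2)] by (intro SUP_mono) auto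
qed

section \<open>Cylinders of a sponge\<close>

lemma linear_part_affine:
  assumes "affine_map f"
  shows "f x - f y = linear_part f *v (x - y)"
proof -
  obtain A b where f: "f = (\<lambda>x. A *v x + b)" using assms unfolding affine_map_def by blast
  then have "linear_part f = A" unfolding linear_part_def by (simp add: matrix_vector_mult_0_right)
  then show ?thesis by (simp add: f matrix_vector_mult_diff_distrib)
qed

text \<open>The row counterpart of \<open>axis_perm\<close>, hence for a generalised permutation matrix its inverse.\<close>

definition row_axis :: "real^3^3 \<Rightarrow> 3 \<Rightarrow> 3" where
  "row_axis A k = (THE j. A $ k $ j \<noteq> 0)"

lemma row_axis:
  assumes "gen_perm_matrix A"
  shows "A $ k $ j \<noteq> 0 \<longleftrightarrow> j = row_axis A k"
proof -
  have "\<exists>!j. A $ k $ j \<noteq> 0" using assms unfolding gen_perm_matrix_def by blast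
  from theI'[OF this] this show ?thesis unfolding row_axis_def by blast
qed

lemma axis_perm_row_axis:
  assumes "gen_perm_matrix A"
  shows "axis_perm A (row_axis A k) = k"
proof -
  have "\<exists>!i. A $ i $ row_axis A k \<noteq> 0" using assms unfolding gen_perm_matrix_def by blast
  then show ?thesis unfolding axis_perm_def using row_axis[OF assms] by (intro the1_equality) auto
qed

lemma bij_row_axis:
  assumes "gen_perm_matrix A"
  shows "bij (row_axis A)"
proof -
  have "inj (row_axis A)" using axis_perm_row_axis[OF assms] by (rule inj_on_inverseI)
  then show ?thesis by (simp add: bij_def finite_UNIV_inj_surj)
qed

lemma gen_perm_matrix_mult_vec:
  assumes "gen_perm_matrix A"
  shows "(A *v x) $ k = A $ k $ row_axis A k * x $ row_axis A k"
proof -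
  have "(A *v x) $ k = (\<Sum>j\<in>UNIV. A $ k $ j * x $ j)" by (simp add: matrix_vector_mult_def)
  also have "\<dots> = (\<Sum>j\<in>{row_axis A k}. A $ k $ j * x $ j)"
    using row_axis[OF assms, of k] by (intro sum.mono_neutral_right) auto
  finally show ?thesis by simp
qed

lemma word_map_Nil [simp]: "word_map S [] = id"
  by (simp add: word_map_def)

lemma word_map_Cons [simp]: "word_map S (i # w) = S i \<circ> word_map S w"
  by (simp add: word_map_def)

lemma word_map_append: "word_map S (u @ v) = word_map S u \<circ> word_map S v"
  by (induction u) (simp_all add: comp_assoc)

locale sponge =
  fixes I :: "'i set" and S :: "'i \<Rightarrow> real^3 \<Rightarrow> real^3" and F :: "(real^3) set"
  assumes ifs: "sponge_ifs I S" and attractor: "attractor I S F"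
begin

definition src1 :: "'i \<Rightarrow> 3 \<Rightarrow> 3" where
  "src1 i = row_axis (linear_part (S i))"

definition len1 :: "'i \<Rightarrow> 3 \<Rightarrow> real" where
  "len1 i k = \<bar>linear_part (S i) $ k $ src1 i k\<bar>"

text \<open>
  The map of the word \<open>w\<close> stretches the \<open>src w k\<close>-th axis by the factor \<open>len w k\<close> and puts it
  on the \<open>k\<close>-th one. So \<open>len w k\<close> is an edge length of the image of the unit cube, and the
  image of \<open>F\<close> has the projection of \<open>F\<close> to the axis \<open>src w k\<close> on its \<open>k\<close>-th axis.
\<close>

primrec src :: "'i list \<Rightarrow> 3 \<Rightarrow> 3" where
  "src [] k = k"
| "src (i # w) k = src w (src1 i k)"

primrec len :: "'i list \<Rightarrow> 3 \<Rightarrow> real" where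
  "len [] k = 1"
| "len (i # w) k = len1 i k * len w (src1 i k)"

definition cyl :: "'i list \<Rightarrow> (real^3) set" where
  "cyl w = word_map S w ` F"

lemma finite_I: "finite I" and card_I: "2 \<le> card I"
  using ifs unfolding sponge_ifs_def by auto

lemma I_nonempty: "I \<noteq> {}"
  using card_I by auto

lemma gen_perm: "i \<in> I \<Longrightarrow> gen_perm_matrix (linear_part (S i))"
  using ifs unfolding sponge_ifs_def by auto

lemma S_diff: "i \<in> I \<Longrightarrow> S i x - S i y = linear_part (S i) *v (x - y)"
  using ifs unfolding sponge_ifs_def by (auto intro: linear_part_affine)

lemma S_diff_nth:
  "i \<in> I \<Longrightarrow> S i x $ k - S i y $ k = linear_part (S i) $ k $ src1 i k * (x $ src1 i k - y $ src1 i k)"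
  using gen_perm_matrix_mult_vec[OF gen_perm, of i "x - y" k] S_diff[of i x y]
  unfolding src1_def by (metis vector_minus_component)

lemma abs_S_diff_nth: "i \<in> I \<Longrightarrow> \<bar>S i x $ k - S i y $ k\<bar> = len1 i k * \<bar>x $ src1 i k - y $ src1 i k\<bar>"
  by (simp add: S_diff_nth len1_def abs_mult)

lemma len1_pos: "i \<in> I \<Longrightarrow> 0 < len1 i k"
  using row_axis[OF gen_perm] unfolding len1_def src1_def by auto

lemma len1_less_1:
  assumes "i \<in> I" shows "len1 i k < 1"
proof -
  obtain c where c: "c < 1" "c-lipschitz_on UNIV (S i)"
    using ifs assms unfolding sponge_ifs_def by blast
  define e :: "real^3" where "e = axis (src1 i k) 1"
  have "len1 i k = \<bar>(S i e - S i 0) $ k\<bar>"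
    using abs_S_diff_nth[OF assms, of e k 0] by (simp add: e_def)
  also have "\<dots> \<le> dist (S i e) (S i 0)"
    unfolding dist_norm by (rule component_le_norm_cart)
  also have "\<dots> \<le> c * dist e 0" using c(2) by (rule lipschitz_onD) auto
  finally show ?thesis using c(1) by (simp add: e_def)
qed

lemma bij_src1: "i \<in> I \<Longrightarrow> bij (src1 i)"
  unfolding src1_def by (intro bij_row_axis gen_perm)

definition cmin :: real where "cmin = Min ((\<lambda>(i, k). len1 i k) ` (I \<times> UNIV))"

definition cmax :: real where "cmax = Max ((\<lambda>(i, k). len1 i k) ` (I \<times> UNIV))"

lemma len1_bounds: "i \<in> I \<Longrightarrow> cmin \<le> len1 i k" "i \<in> I \<Longrightarrow> len1 i k \<le> cmax"
  unfolding cmin_def cmax_def using finite_I by (auto intro!: Min_le Max_ge)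

lemma cmin_pos: "0 < cmin"
  unfolding cmin_def using finite_I I_nonempty len1_pos by (subst Min_gr_iff) auto

lemma cmax_less_1: "cmax < 1"
  unfolding cmax_def using finite_I I_nonempty len1_less_1 by (subst Max_less_iff) auto

lemma cmin_le_cmax: "cmin \<le> cmax"
  using len1_bounds I_nonempty by (meson all_not_in_conv order_trans)

lemma cmax_pos: "0 < cmax" and cmin_less_1: "cmin < 1"
  using cmin_pos cmax_less_1 cmin_le_cmax by auto

lemma src_append: "src (u @ v) k = src v (src u k)"
  by (induction u arbitrary: k) auto

lemma len_append: "len (u @ v) k = len u k * len v (src u k)"
  by (induction u arbitrary: k) (auto simp: mult.assoc)

lemma bij_src: "w \<in> lists I \<Longrightarrow> bij (src w)"
proof (induction w)
  case Nil
  have "src [] = id" by auto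
  then show ?case by (simp only: bij_id)
next
  case (Cons i w)
  then have "src (i # w) = src w \<circ> src1 i" "bij (src w)" "bij (src1 i)" by (auto intro: bij_src1)
  then show ?case by (metis bij_comp)
qed

lemma len_bounds:
  assumes "w \<in> lists I"
  shows "cmin ^ length w \<le> len w k" "len w k \<le> cmax ^ length w"
proof -
  have "cmin ^ length w \<le> len w k \<and> len w k \<le> cmax ^ length w"
    using assms
  proof (induction w arbitrary: k)
    case (Cons i w)
    then have i: "i \<in> I" and IH: "cmin ^ length w \<le> len w (src1 i k)" "len w (src1 i k) \<le> cmax ^ length w"
      by auto
    have "0 < cmin ^ length w" using cmin_pos by simp
    then have pos: "0 \<le> len w (src1 i k)" using IH(1) by linarith
    have "cmin * cmin ^ length w \<le> len1 i k * len w (src1 i k)"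
      using IH(1) len1_bounds(1)[OF i, of k] len1_pos[OF i, of k] cmin_pos
      by (intro mult_mono) auto
    moreover have "len1 i k * len w (src1 i k) \<le> cmax * cmax ^ length w"
      using IH(2) len1_bounds(2)[OF i, of k] cmax_pos pos
      by (intro mult_mono) auto
    ultimately show ?case by simp
  qed simp
  then show "cmin ^ length w \<le> len w k" "len w k \<le> cmax ^ length w" by auto
qed

lemma len_pos: "w \<in> lists I \<Longrightarrow> 0 < len w k"
  using len_bounds(1)[of w k] cmin_pos by (meson less_le_trans zero_less_power)

lemma len_le_1: "w \<in> lists I \<Longrightarrow> len w k \<le> 1"
  using len_bounds(2)[of w k] cmax_pos cmax_less_1 by (meson less_imp_le order_trans power_le_one)

lemma len_snoc_bounds:
  assumes "w \<in> lists I" "i \<in> I"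
  shows "cmin * len w k \<le> len (w @ [i]) k" "len (w @ [i]) k \<le> cmax * len w k"
proof -
  have *: "len (w @ [i]) k = len1 i (src w k) * len w k" by (simp add: len_append)
  show "cmin * len w k \<le> len (w @ [i]) k" "len (w @ [i]) k \<le> cmax * len w k"
    unfolding * using len1_bounds[OF assms(2)] len_pos[OF assms(1), of k] by (auto intro: mult_right_mono)
qed

lemma word_map_diff_nth:
  "w \<in> lists I \<Longrightarrow> \<bar>word_map S w x $ k - word_map S w y $ k\<bar> = len w k * \<bar>x $ src w k - y $ src w k\<bar>"
proof (induction w arbitrary: k)
  case (Cons i w)
  then show ?case by (simp add: abs_S_diff_nth)
qed simp

lemma compact_F: "compact F" and F_nonempty: "F \<noteq> {}" and F_eq: "F = (\<Union>i\<in>I. S i ` F)"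
  using attractor unfolding attractor_def by auto

lemma bounded_F: "bounded F"
  using compact_F by (rule compact_imp_bounded)

text \<open>
  A point of \<open>F\<close> at maximal distance from an invariant set \<open>K\<close> is the image of a point that is
  further away still, unless the distance is zero.
\<close>

lemma attractor_subset:
  assumes "closed K" "K \<noteq> {}" "\<And>i. i \<in> I \<Longrightarrow> S i ` K \<subseteq> K"
  shows "F \<subseteq> K"
proof -
  have "continuous_on F (\<lambda>x. infdist x K)" by (intro continuous_intros)
  then obtain x where x: "x \<in> F" "\<And>y. y \<in> F \<Longrightarrow> infdist y K \<le> infdist x K"
    using continuous_attains_sup[OF compact_F F_nonempty] by blast
  then obtain i y where i: "i \<in> I" "y \<in> F" "x = S i y" using F_eq by blast
  obtain c where c: "c < 1" "c-lipschitz_on UNIV (S i)"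
    using ifs i(1) unfolding sponge_ifs_def by blast
  obtain z where z: "z \<in> K" "infdist y K = dist y z"
    using infdist_attains_inf[OF assms(1,2)] by metis
  have "infdist x K \<le> dist x (S i z)" using assms(3)[OF i(1)] z(1) by (intro infdist_le) auto
  also have "\<dots> \<le> c * dist y z" unfolding i(3) using c(2) by (rule lipschitz_onD) auto
  also have "\<dots> = c * infdist y K" using z by simp
  also have "\<dots> \<le> c * infdist x K"
    using x(2)[OF i(2)] c(2) by (intro mult_left_mono) (auto dest: lipschitz_on_nonneg)
  finally have "(1 - c) * infdist x K \<le> 0" by (simp add: algebra_simps)
  then have "infdist x K \<le> 0" using c(1) by (simp add: mult_le_0_iff)
  then have zero: "infdist y K = 0" if "y \<in> F" for y
    using x(2)[OF that] infdist_nonneg[of y K] by linarith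
  show ?thesis
    using zero in_closed_iff_infdist_zero[OF assms(1,2)] by blast
qed

lemma F_subset_unit_cube: "F \<subseteq> unit_cube"
proof (rule attractor_subset)
  show "closed unit_cube" unfolding unit_cube_def by (rule closed_cbox)
  show "unit_cube \<noteq> {}" unfolding unit_cube_def by (auto simp: interval_eq_empty_cart not_less)
  show "S i ` unit_cube \<subseteq> unit_cube" if "i \<in> I" for i
    using ifs that unfolding sponge_ifs_def by blast
qed

lemma abs_diff_F_le_1: "x \<in> F \<Longrightarrow> y \<in> F \<Longrightarrow> \<bar>x $ k - y $ k\<bar> \<le> 1"
proof -
  assume "x \<in> F" "y \<in> F"
  then have "x \<in> cbox 0 1" "y \<in> cbox 0 1" using F_subset_unit_cube unfolding unit_cube_def by auto
  then have "0 \<le> x $ k" "x $ k \<le> 1" "0 \<le> y $ k" "y $ k \<le> 1" by (auto simp: mem_box_cart)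
  then show ?thesis by linarith
qed

lemma cyl_snoc: "x \<in> cyl w \<Longrightarrow> \<exists>i\<in>I. x \<in> cyl (w @ [i])"
proof -
  assume "x \<in> cyl w"
  then obtain y where y: "y \<in> F" "x = word_map S w y" unfolding cyl_def by blast
  then obtain i z where "i \<in> I" "z \<in> F" "y = S i z" using F_eq by blast
  then show ?thesis using y unfolding cyl_def by (auto simp: word_map_append)
qed

lemma cyl_append: "cyl (u @ v) = word_map S u ` cyl v"
  unfolding cyl_def by (simp add: word_map_append image_comp)

lemma cyl_subset: "w \<in> lists I \<Longrightarrow> cyl w \<subseteq> F"
proof (induction w)
  case (Cons i w)
  then have "cyl (i # w) = S i ` cyl w" using cyl_append[of "[i]" w] by simp
  moreover have "S i ` F \<subseteq> F" using equalityD2[OF F_eq] Cons.prems by auto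
  ultimately show ?case using Cons by auto
qed (simp add: cyl_def)

lemma bounded_cyl: "w \<in> lists I \<Longrightarrow> bounded (cyl w)"
  using bounded_F cyl_subset by (rule bounded_subset)

lemma abs_diff_cyl_le:
  assumes "w \<in> lists I" "x \<in> cyl w" "y \<in> cyl w"
  shows "\<bar>x $ k - y $ k\<bar> \<le> len w k"
proof -
  obtain x' y' where xy: "x' \<in> F" "x = word_map S w x'" "y' \<in> F" "y = word_map S w y'"
    using assms unfolding cyl_def by blast
  then have "\<bar>x $ k - y $ k\<bar> = len w k * \<bar>x' $ src w k - y' $ src w k\<bar>"
    using word_map_diff_nth[OF assms(1)] by simp
  also have "\<dots> \<le> len w k * 1"
    using abs_diff_F_le_1 xy len_pos[OF assms(1), of k] by (intro mult_left_mono) auto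
  finally show ?thesis by simp
qed

text \<open>
  Here \<open>\<mu>\<close> is some notion of the size of a cylinder. Following an address of \<open>x\<close>, the size
  drops below \<open>\<delta>\<close>, and it cannot overshoot by more than one step.
\<close>

lemma stopping_word:
  assumes "\<And>w i. w \<in> lists I \<Longrightarrow> i \<in> I \<Longrightarrow> cmin * \<mu> w \<le> \<mu> (w @ [i])"
    and "\<And>w. w \<in> lists I \<Longrightarrow> \<mu> w \<le> cmax ^ length w" and "\<mu> [] = 1"
    and "x \<in> F" "0 < \<delta>" "\<delta> \<le> 1"
  obtains w where "w \<in> lists I" "x \<in> cyl w" "cmin * \<delta> \<le> \<mu> w" "\<mu> w \<le> \<delta>"
proof (rule ccontr)
  assume "\<not> thesis"
  then have no: "\<not> (cmin * \<delta> \<le> \<mu> w \<and> \<mu> w \<le> \<delta>)" if "w \<in> lists I" "x \<in> cyl w" for w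
    using that \<open>\<And>w. w \<in> lists I \<Longrightarrow> x \<in> cyl w \<Longrightarrow> cmin * \<delta> \<le> \<mu> w \<Longrightarrow> \<mu> w \<le> \<delta> \<Longrightarrow> thesis\<close> by blast
  have "\<exists>w\<in>lists I. length w = n \<and> x \<in> cyl w \<and> \<delta> < \<mu> w" for n
  proof (induction n)
    case 0
    have "x \<in> cyl []" using assms(4) by (simp add: cyl_def)
    moreover have "cmin * \<delta> \<le> 1"
      using assms(5,6) cmin_pos cmin_less_1 by (intro mult_le_one) auto
    ultimately show ?case using no[of "[]"] assms(3,6) by auto
  next
    case (Suc n)
    then obtain w where w: "w \<in> lists I" "length w = n" "x \<in> cyl w" "\<delta> < \<mu> w" by blast
    obtain i where i: "i \<in> I" "x \<in> cyl (w @ [i])" using cyl_snoc[OF w(3)] by blast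
    have "cmin * \<delta> \<le> cmin * \<mu> w" using w(4) cmin_pos by simp
    also have "\<dots> \<le> \<mu> (w @ [i])" using assms(1) w(1) i(1) by blast
    finally have "\<delta> < \<mu> (w @ [i])" using no[of "w @ [i]"] w(1) i by auto
    then show ?case using w i by (intro bexI[of _ "w @ [i]"]) auto
  qed
  then have "\<delta> < cmax ^ n" for n using assms(2) by (metis less_le_trans)
  moreover obtain n where "cmax ^ n < \<delta>"
    using real_arch_pow_inv[OF assms(5) cmax_less_1] by blast
  ultimately show False by (meson less_asym)
qed

lemma cov_src_le_cov_cyl:
  assumes "w \<in> lists I" "0 < \<delta>'" "\<And>k. k \<in> K \<Longrightarrow> \<delta>' \<le> len w k * \<delta>"
  shows "cov (src w ` K) \<delta> F \<le> cov K \<delta>' (cyl w)"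
proof (rule cov_transfer[where h = "word_map S w"])
  fix x y j assume h: "\<forall>k\<in>K. \<bar>word_map S w x $ k - word_map S w y $ k\<bar> \<le> \<delta>'" "j \<in> src w ` K"
  then obtain k where k: "k \<in> K" "j = src w k" by blast
  then have "len w k * \<bar>x $ j - y $ j\<bar> \<le> len w k * \<delta>"
    using h(1) assms(3) word_map_diff_nth[OF assms(1)] by (metis order_trans)
  then show "\<bar>x $ j - y $ j\<bar> \<le> \<delta>" using len_pos[OF assms(1), of k] by simp
qed (use assms bounded_cyl in \<open>auto simp: cyl_def\<close>)


section \<open>Axes in the same orbit\<close>

text \<open>
  The permutations of the axes that are induced by words form a group: since some power of
  each is the identity, the word can be extended to one that induces the identity.
\<close>

lemma ex_return_word:
  assumes "w \<in> lists I"
  shows "\<exists>w'\<in>lists I. \<forall>k. src w' (src w k) = k"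
proof -
  have inj: "inj (\<lambda>g :: 3 \<Rightarrow> 3. src w \<circ> g)"
    using bij_src[OF assms] by (auto simp: inj_def bij_def fun_eq_iff)
  obtain n where n: "0 < n" "((\<lambda>g. src w \<circ> g) ^^ n) id = id"
    using funpow_inj_finite[OF inj, of id] by (metis finite_code finite_subset subset_UNIV)
  have pow: "src (concat (replicate m w)) = ((\<lambda>g. src w \<circ> g) ^^ m) id" for m
  proof (induction m)
    case (Suc m)
    have "concat (replicate (Suc m) w) = concat (replicate m w) @ w"
      by (metis append_Nil2 concat.simps concat_append replicate_Suc replicate_append_same)
    then show ?case using Suc by (auto simp: src_append fun_eq_iff)
  qed (auto simp: fun_eq_iff)
  have "src (w @ concat (replicate (n - 1) w)) = id"
    using pow[of n] n by (metis Suc_diff_1 concat.simps(2) replicate_Suc)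
  then have "src (concat (replicate (n - 1) w)) (src w k) = k" for k
    by (metis id_apply src_append)
  moreover have "concat (replicate (n - 1) w) \<in> lists I" using assms by auto
  ultimately show ?thesis by blast
qed

text \<open>The extension only depends on the permutation, of which there are finitely many.\<close>

lemma bounded_return_words:
  obtains L where "\<And>w. w \<in> lists I \<Longrightarrow> \<exists>w'\<in>lists I. length w' \<le> L \<and> (\<forall>k. src w' (src w k) = k)"
proof -
  obtain ret where ret: "\<And>w. w \<in> lists I \<Longrightarrow> ret (src w) \<in> lists I \<and> (\<forall>k. src (ret (src w)) (src w k) = k)"
  proof -
    have "\<forall>f\<in>src ` lists I. \<exists>w'. w' \<in> lists I \<and> (\<forall>k. src w' (f k) = k)"
      using ex_return_word by blast
    then show thesis using that by (metis (no_types, lifting) bchoice imageI)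
  qed
  have "finite (src ` lists I)" by (rule finite_subset[OF subset_UNIV]) simp
  then have "length (ret (src w)) \<le> Max ((\<lambda>f. length (ret f)) ` src ` lists I)" if "w \<in> lists I" for w
    using that by (intro Max_ge) auto
  then show thesis using ret by (intro that) blast
qed

text \<open>
  \<open>F\<close> contains a copy of itself in which the axes in \<open>src w ` K\<close> have been moved to those in
  \<open>K\<close>; going back by a return word gives the inequality in this direction, with the same
  constant for all words.
\<close>

lemma cov_orbit:
  obtains M where "0 < M"
    "\<And>w K \<delta>. w \<in> lists I \<Longrightarrow> 0 < \<delta> \<Longrightarrow> real (cov K \<delta> F) \<le> M * real (cov (src w ` K) \<delta> F)"
proof -
  obtain L where L: "\<And>w. w \<in> lists I \<Longrightarrow> \<exists>w'\<in>lists I. length w' \<le> L \<and> (\<forall>k. src w' (src w k) = k)"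
    using bounded_return_words by blast
  define c where "c = cmin ^ L"
  have c: "0 < c" "c \<le> 1" unfolding c_def using cmin_pos cmin_less_1 by (auto intro: power_le_one)
  show thesis
  proof (rule that)
    show "0 < (5 / c) ^ 3" using c by simp
    fix w K \<delta> assume w: "w \<in> lists I" and d: "0 < (\<delta> :: real)"
    obtain w' where w': "w' \<in> lists I" "length w' \<le> L" "\<And>k. src w' (src w k) = k" using L[OF w] by blast
    have "c \<le> cmin ^ length w'"
      unfolding c_def using w'(2) cmin_pos cmin_less_1 by (intro power_decreasing) auto
    then have len: "c \<le> len w' k" for k using len_bounds(1)[OF w'(1)] by (meson order_trans)
    have "K = src w' ` src w ` K" using w'(3) by (simp add: image_comp)
    then have "cov K \<delta> F \<le> cov (src w ` K) (c * \<delta>) (cyl w')"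
      using cov_src_le_cov_cyl[OF w'(1), of "c * \<delta>" "src w ` K" \<delta>] len c d by simp
    also have "\<dots> \<le> cov (src w ` K) (c * \<delta>) F"
      using c d cyl_subset[OF w'(1)] bounded_F by (intro cov_mono) auto
    finally have "real (cov K \<delta> F) \<le> real (cov (src w ` K) (c * \<delta>) F)" by simp
    also have "\<dots> \<le> (5 * \<delta> / (c * \<delta>)) ^ 3 * real (cov (src w ` K) \<delta> F)"
      using c d bounded_F by (intro cov_refine) auto
    finally show "real (cov K \<delta> F) \<le> (5 / c) ^ 3 * real (cov (src w ` K) \<delta> F)" using d by simp
  qed
qed

lemma box_dim_src:
  assumes "w \<in> lists I"
  shows "upper_box_dim (coord_proj (src w ` K) ` F) = upper_box_dim (coord_proj K ` F)"
    and "lower_box_dim (coord_proj (src w ` K) ` F) = lower_box_dim (coord_proj K ` F)"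
proof -
  obtain M where M: "0 < M"
    "\<And>w K \<delta>. w \<in> lists I \<Longrightarrow> 0 < \<delta> \<Longrightarrow> real (cov K \<delta> F) \<le> M * real (cov (src w ` K) \<delta> F)"
    using cov_orbit by blast
  note le = box_dim_mono[OF bounded_F F_nonempty bounded_F F_nonempty M(1) M(2)]
  obtain w' where w': "w' \<in> lists I" "\<And>k. src w' (src w k) = k" using ex_return_word[OF assms] by blast
  have "K = src w' ` src w ` K" using w'(2) by (simp add: image_comp)
  then show "upper_box_dim (coord_proj (src w ` K) ` F) = upper_box_dim (coord_proj K ` F)"
    "lower_box_dim (coord_proj (src w ` K) ` F) = lower_box_dim (coord_proj K ` F)"
    using le[OF assms, of K] le[OF w'(1), of "src w ` K"] by (metis antisym)+
qed

lemma qA_dim_src: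
  assumes "w \<in> lists I"
  shows "qA_dim (coord_proj {src w k} ` F) = qA_dim (coord_proj {k} ` F)"
proof -
  have le: "qA_dim (coord_proj {src w k} ` F) \<le> qA_dim (coord_proj {k} ` F)" if "w \<in> lists I" for w k
    using cyl_subset[OF that]
    by (intro qA_dim_mono[OF bounded_F bounded_F len_pos[OF that] _ word_map_diff_nth[OF that] len_le_1[OF that]])
      (simp add: cyl_def)
  obtain w' where w': "w' \<in> lists I" "\<And>k. src w' (src w k) = k" using ex_return_word[OF assms] by blast
  show ?thesis using le[OF assms, of k] le[OF w'(1), of "src w k"] w'(2) by (metis antisym)
qed

text \<open>
  A maximal separated set of points, each with a cylinder of the size of the scale around it:
  at the price of a constant, covering numbers count well separated cylinders.
\<close>

lemma separated_cylinders:
  assumes "K \<noteq> {}" "1 \<le> B"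
  obtains c where "0 < c" "\<And>\<rho>. 0 < \<rho> \<Longrightarrow> \<rho> \<le> 1 \<Longrightarrow>
    \<exists>X v. finite X \<and> X \<subseteq> F \<and> separated K (B * \<rho>) X \<and> c * real (cov K \<rho> F) \<le> real (card X) \<and>
      (\<forall>x\<in>X. v x \<in> lists I \<and> x \<in> cyl (v x) \<and> (\<forall>k\<in>K. len (v x) k \<le> \<rho>) \<and> (\<exists>k\<in>K. cmin * \<rho> \<le> len (v x) k))"
proof (rule that)
  show "0 < 1 / (10 * B) ^ 3" using assms(2) by simp
  fix \<rho> :: real assume \<rho>: "0 < \<rho>" "\<rho> \<le> 1"
  obtain X where X: "finite X" "X \<subseteq> F" "separated K (B * \<rho>) X" "cov K (2 * (B * \<rho>)) F \<le> card X"
    using maximal_separated[OF bounded_F, of "B * \<rho>" K] assms(2) \<rho> by auto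
  have "1 * \<rho> \<le> (2 * B) * \<rho>" using assms(2) \<rho> by (intro mult_right_mono) auto
  then have "real (cov K \<rho> F) \<le> (5 * (2 * (B * \<rho>)) / \<rho>) ^ 3 * real (cov K (2 * (B * \<rho>)) F)"
    using assms(2) \<rho> by (intro cov_refine bounded_F) auto
  also have "\<dots> \<le> (10 * B) ^ 3 * real (card X)"
    using X(4) \<rho> assms(2) by (auto intro!: mult_mono)
  finally have card: "1 / (10 * B) ^ 3 * real (cov K \<rho> F) \<le> real (card X)"
    using assms(2) by (simp add: field_simps)
  define \<mu> where "\<mu> w = Max (len w ` K)" for w
  have K: "finite K" by simp
  have \<mu>: "\<exists>k\<in>K. \<mu> w = len w k" "\<And>k. k \<in> K \<Longrightarrow> len w k \<le> \<mu> w" for w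
  proof -
    have "Max (len w ` K) \<in> len w ` K" using assms(1) K by (intro Max_in) auto
    then show "\<exists>k\<in>K. \<mu> w = len w k" unfolding \<mu>_def by (metis imageE)
    show "len w k \<le> \<mu> w" if "k \<in> K" for k using that K unfolding \<mu>_def by (intro Max_ge) auto
  qed
  have "\<exists>w. w \<in> lists I \<and> x \<in> cyl w \<and> (\<forall>k\<in>K. len w k \<le> \<rho>) \<and> (\<exists>k\<in>K. cmin * \<rho> \<le> len w k)" if x: "x \<in> X" for x
  proof -
    have "cmin * \<mu> w \<le> \<mu> (w @ [i])" if "w \<in> lists I" "i \<in> I" for w i
      using \<mu>(1)[of w] \<mu>(2)[of _ "w @ [i]"] len_snoc_bounds(1)[OF that] by (metis order_trans)
    moreover have "\<mu> w \<le> cmax ^ length w" if "w \<in> lists I" for w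
      using \<mu>(1)[of w] len_bounds(2)[OF that] by auto
    moreover have "\<mu> [] = 1" using \<mu>(1)[of "[]"] by auto
    ultimately obtain w where "w \<in> lists I" "x \<in> cyl w" "cmin * \<rho> \<le> \<mu> w" "\<mu> w \<le> \<rho>"
      using stopping_word[of \<mu> x \<rho>] \<rho> X(2) x by blast
    then show ?thesis using \<mu>(1)[of w] \<mu>(2)[of _ w] by (metis order_trans)
  qed
  then obtain v where "\<And>x. x \<in> X \<Longrightarrow> v x \<in> lists I \<and> x \<in> cyl (v x) \<and> (\<forall>k\<in>K. len (v x) k \<le> \<rho>) \<and> (\<exists>k\<in>K. cmin * \<rho> \<le> len (v x) k)"
    by metis
  then show "\<exists>X v. finite X \<and> X \<subseteq> F \<and> separated K (B * \<rho>) X \<and> 1 / (10 * B) ^ 3 * real (cov K \<rho> F) \<le> real (card X) \<and>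
      (\<forall>x\<in>X. v x \<in> lists I \<and> x \<in> cyl (v x) \<and> (\<forall>k\<in>K. len (v x) k \<le> \<rho>) \<and> (\<exists>k\<in>K. cmin * \<rho> \<le> len (v x) k))"
    using X(1-3) card by blast
qed

end

context sponge
begin

section \<open>The box dimension of the projections to the axes\<close>

text \<open>
  At scale \<open>\<rho>\<close> there are about \<open>cov {k} \<rho> F\<close> separated cylinders of size \<open>\<rho>\<close>. The projection of
  each to the axis \<open>k\<close> is a copy, smaller by a factor of about \<open>\<rho>\<close>, of the projection of \<open>F\<close> to
  an axis in the same orbit.
\<close>

lemma cov_axis_supermultiplicative:
  obtains c where "0 < c" "\<And>\<delta> \<rho>. 0 < \<delta> \<Longrightarrow> \<delta> \<le> 1 \<Longrightarrow> 0 < \<rho> \<Longrightarrow> \<rho> \<le> 1 \<Longrightarrow>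
    c * real (cov {k} \<delta> F) * real (cov {k} \<rho> F) \<le> real (cov {k} (\<delta> * \<rho>) F)"
proof -
  obtain M where M: "0 < M"
    "\<And>w K \<delta>. w \<in> lists I \<Longrightarrow> 0 < \<delta> \<Longrightarrow> real (cov K \<delta> F) \<le> M * real (cov (src w ` K) \<delta> F)"
    using cov_orbit by blast
  obtain c where c: "0 < c" "\<And>\<rho>. 0 < \<rho> \<Longrightarrow> \<rho> \<le> 1 \<Longrightarrow>
    \<exists>X v. finite X \<and> X \<subseteq> F \<and> separated {k} (3 * \<rho>) X \<and> c * real (cov {k} \<rho> F) \<le> real (card X) \<and>
      (\<forall>x\<in>X. v x \<in> lists I \<and> x \<in> cyl (v x) \<and> (\<forall>k\<in>{k}. len (v x) k \<le> \<rho>) \<and> (\<exists>k\<in>{k}. cmin * \<rho> \<le> len (v x) k))"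
    by (rule separated_cylinders[of "{k}" 3]) auto
  define M' where "M' = M * (5 / cmin) ^ 3"
  have M': "0 < M'" unfolding M'_def using M(1) cmin_pos by simp
  show thesis
  proof (rule that)
    show "0 < c / M'" using c(1) M' by simp
    fix \<delta> \<rho> :: real assume \<delta>: "0 < \<delta>" "\<delta> \<le> 1" and \<rho>: "0 < \<rho>" "\<rho> \<le> 1"
    obtain X v where X: "finite X" "separated {k} (3 * \<rho>) X" "c * real (cov {k} \<rho> F) \<le> real (card X)"
      and v_all: "\<forall>x\<in>X. v x \<in> lists I \<and> x \<in> cyl (v x) \<and> (\<forall>k\<in>{k}. len (v x) k \<le> \<rho>) \<and> (\<exists>k\<in>{k}. cmin * \<rho> \<le> len (v x) k)"
      using c(2)[OF \<rho>] by blast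
    have v: "v x \<in> lists I" "x \<in> cyl (v x)" "len (v x) k \<le> \<rho>" "cmin * \<rho> \<le> len (v x) k" if "x \<in> X" for x
      using bspec[OF v_all that] by auto
    have \<delta>\<rho>: "\<delta> * \<rho> \<le> \<rho>" using \<delta> \<rho> by simp
    have piece: "real (cov {k} \<delta> F) / M' \<le> real (cov {k} (\<delta> * \<rho>) (cyl (v x)))" if x: "x \<in> X" for x
    proof -
      have "real (cov {k} \<delta> F) \<le> M * real (cov {src (v x) k} \<delta> F)"
        using M(2)[OF v(1)[OF x] \<delta>(1), of "{k}"] by simp
      also have "\<dots> \<le> M * ((5 * (\<delta> / cmin) / \<delta>) ^ 3 * real (cov {src (v x) k} (\<delta> / cmin) F))"
        using M(1) \<delta> cmin_pos cmin_less_1 bounded_F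
        by (intro mult_left_mono cov_refine) (auto simp: field_simps)
      also have "\<dots> = M' * real (cov (src (v x) ` {k}) (\<delta> / cmin) F)"
        using \<delta> by (simp add: M'_def)
      also have "\<dots> \<le> M' * real (cov {k} (\<delta> * \<rho>) (cyl (v x)))"
      proof -
        have "cov (src (v x) ` {k}) (\<delta> / cmin) F \<le> cov {k} (\<delta> * \<rho>) (cyl (v x))"
          using v(4)[OF x] \<delta> \<rho> cmin_pos
          by (intro cov_src_le_cov_cyl v(1)[OF x]) (auto simp: field_simps)
        then show ?thesis using M' by simp
      qed
      finally show ?thesis using M' by (simp add: field_simps)
    qed
    have "c / M' * real (cov {k} \<delta> F) * real (cov {k} \<rho> F) = (c * real (cov {k} \<rho> F)) * (real (cov {k} \<delta> F) / M')"
      by simp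
    also have "\<dots> \<le> real (card X) * (real (cov {k} \<delta> F) / M')"
      using X(3) M' by (intro mult_right_mono) auto
    also have "\<dots> = (\<Sum>x\<in>X. real (cov {k} \<delta> F) / M')" by simp
    also have "\<dots> \<le> (\<Sum>x\<in>X. real (cov {k} (\<delta> * \<rho>) (cyl (v x))))"
      using piece by (rule sum_mono)
    also have "\<dots> = real (\<Sum>x\<in>X. cov {k} (\<delta> * \<rho>) (cyl (v x)))" by simp
    also have "(\<Sum>x\<in>X. cov {k} (\<delta> * \<rho>) (cyl (v x))) \<le> cov {k} (\<delta> * \<rho>) F"
    proof (rule sum_cov_separated[OF bounded_F _ X(1)])
      show "cyl (v x) \<subseteq> F" if "x \<in> X" for x using cyl_subset v(1) that by blast
      fix x y x' y' assume h: "x \<in> X" "y \<in> X" "x \<noteq> y" "x' \<in> cyl (v x)" "y' \<in> cyl (v y)"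
      have "3 * \<rho> < \<bar>x $ k - y $ k\<bar>" using X(2) h unfolding separated_def by auto
      moreover have "\<bar>x' $ k - x $ k\<bar> \<le> \<rho>" "\<bar>y' $ k - y $ k\<bar> \<le> \<rho>"
        using abs_diff_cyl_le[OF v(1) h(4) v(2)] abs_diff_cyl_le[OF v(1) h(5) v(2)] h v(3)
        by (meson order_trans)+
      ultimately show "\<exists>k'\<in>{k}. \<delta> * \<rho> < \<bar>x' $ k' - y' $ k'\<bar>" using \<delta>\<rho> by auto
    qed (use \<delta> \<rho> in simp)
    finally show "c / M' * real (cov {k} \<delta> F) * real (cov {k} \<rho> F) \<le> real (cov {k} (\<delta> * \<rho>) F)"
      by simp
  qed
qed

text \<open>
  By supermultiplicativity, a covering number that is large at one scale \<open>\<delta>\<^sub>0\<close> forces large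
  covering numbers at all the scales \<open>\<delta>\<^sub>0\<^sup>n\<close>, hence at all scales.
\<close>

lemma axis_box_dim_exists: "lower_box_dim (coord_proj {k} ` F) = upper_box_dim (coord_proj {k} ` F)"
proof (rule antisym[OF lower_box_dim_le_upper_box_dim], rule ereal_le_if_reals_below_le)
  fix t assume t: "ereal t < upper_box_dim (coord_proj {k} ` F)"
  show "ereal t \<le> lower_box_dim (coord_proj {k} ` F)"
  proof (cases "0 \<le> t")
    case False
    then have "ereal t \<le> 0" by simp
    then show ?thesis using lower_box_dim_nonneg[OF bounded_F F_nonempty] by (rule order_trans)
  next
    case True
    obtain t' where t': "ereal t < ereal t'" "ereal t' < upper_box_dim (coord_proj {k} ` F)"
      using ereal_dense2[OF t] by blast
    obtain c where c: "0 < c" "\<And>\<delta> \<rho>. 0 < \<delta> \<Longrightarrow> \<delta> \<le> 1 \<Longrightarrow> 0 < \<rho> \<Longrightarrow> \<rho> \<le> 1 \<Longrightarrow>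
      c * real (cov {k} \<delta> F) * real (cov {k} \<rho> F) \<le> real (cov {k} (\<delta> * \<rho>) F)"
      using cov_axis_supermultiplicative by blast
    \<comment> \<open>Below \<open>b\<close>, passing from the exponent \<open>t'\<close> to \<open>t\<close> compensates for the factor \<open>c\<close>.\<close>
    define b where "b = min 1 (c powr (1 / (t' - t)))"
    have b: "0 < b" "b \<le> 1" unfolding b_def using c(1) by auto
    obtain d where d: "0 < d" "d < b" "d powr (- t') \<le> real (cov {k} d F)"
    proof (rule ccontr)
      assume "\<not> thesis"
      then have no: "real (cov {k} d F) < d powr (- t')" if "0 < d" "d < b" for d
        using that \<open>\<And>d. 0 < d \<Longrightarrow> d < b \<Longrightarrow> d powr (- t') \<le> real (cov {k} d F) \<Longrightarrow> thesis\<close>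
        by (meson not_le)
      have "upper_box_dim (coord_proj {k} ` F) \<le> ereal t'"
        unfolding upper_box_dim_def
      proof (rule Limsup_bounded, unfold eventually_at_right_field, intro exI[of _ b] conjI allI impI)
        fix d :: real assume d: "0 < d" "d < b"
        have "1 \<le> cov {k} d F" using cov_pos[OF bounded_F d(1) F_nonempty] .
        then have "ln (real (cov {k} d F)) / (- ln d) \<le> t'"
          using no[OF d] d b by (subst log_ratio_le_iff(1)) auto
        then show "ereal (ln (real (cover_num d (coord_proj {k} ` F))) / (- ln d)) \<le> ereal t'"
          using d by (simp add: cover_num_coord_proj bounded_F)
      qed (rule b(1))
      then show False using t'(2) by simp
    qed
    have d1: "d < 1" using d b by simp
    have "d powr (t' - t) \<le> (c powr (1 / (t' - t))) powr (t' - t)"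
      using d t' by (intro powr_mono2) (auto simp: b_def)
    also have "\<dots> = c" using t' c(1) by (simp add: powr_powr)
    finally have "d powr (t' - t) * d powr (- t') \<le> c * real (cov {k} d F)"
      using d(3) c(1) by (intro mult_mono) auto
    then have big: "d powr (- t) \<le> c * real (cov {k} d F)" by (simp add: powr_add[symmetric])
    have pow: "(d powr (- t)) ^ n \<le> real (cov {k} (d ^ n) F)" for n
    proof (induction n)
      case 0
      show ?case using cov_pos[OF bounded_F _ F_nonempty, of 1 "{k}"] by simp
    next
      case (Suc n)
      have "(d powr (- t)) ^ Suc n \<le> (c * real (cov {k} d F)) * real (cov {k} (d ^ n) F)"
        using big Suc c(1) by (auto intro!: mult_mono)
      also have "\<dots> \<le> real (cov {k} (d * d ^ n) F)"
        using d d1 by (intro c(2)) (auto intro: power_le_one)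
      finally show ?case by simp
    qed
    have "d powr t * \<delta> powr (- t) \<le> real (cov {k} \<delta> F)" if \<delta>: "0 < \<delta>" "\<delta> < 1" for \<delta>
    proof -
      define n where "n = (LEAST n. d ^ n < \<delta>)"
      have n: "d ^ n < \<delta>" unfolding n_def using real_arch_pow_inv[OF \<delta>(1) d1] by (rule LeastI_ex)
      have "n \<noteq> 0" using n \<delta> by (intro notI) simp
      then obtain j where j: "n = Suc j" using not0_implies_Suc by blast
      have j': "\<delta> \<le> d ^ j" using not_less_Least[of j "\<lambda>n. d ^ n < \<delta>"] j unfolding n_def by simp
      have "d powr t * \<delta> powr (- t) = (\<delta> / d) powr (- t)"
        using d \<delta> by (simp add: powr_divide powr_minus field_simps)
      also have "\<dots> \<le> (d ^ j) powr (- t)"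
        using n j d \<delta> True by (intro powr_mono2') (auto simp: field_simps)
      also have "\<dots> = (d powr (- t)) ^ j"
        using d by (simp add: powr_realpow[symmetric] powr_powr mult.commute)
      also have "\<dots> \<le> real (cov {k} (d ^ j) F)" by (rule pow)
      also have "\<dots> \<le> real (cov {k} \<delta> F)"
        using cov_mono[OF bounded_F \<delta>(1) order_refl order_refl j'] by simp
      finally show ?thesis .
    qed
    then show ?thesis using d(1) by (intro lower_box_dim_ge[OF bounded_F, of "d powr t"]) auto
  qed
qed


section \<open>Pressure\<close>

text \<open>
  \<open>chamber w l m\<close> says that \<open>l\<close> is a longest and \<open>m\<close> a shortest axis of the cuboid of \<open>w\<close>;
  then \<open>mid w l m\<close> is the remaining edge length. Written as a product over the edges, it is
  multiplicative and makes sense for \<open>l = m\<close>, which can only happen for cubes.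
\<close>

definition chamber :: "'i list \<Rightarrow> 3 \<Rightarrow> 3 \<Rightarrow> bool" where
  "chamber w l m \<longleftrightarrow> (\<forall>k. len w k \<le> len w l \<and> len w m \<le> len w k)"

definition mid :: "'i list \<Rightarrow> 3 \<Rightarrow> 3 \<Rightarrow> real" where
  "mid w l m = (\<Prod>k\<in>UNIV. len w k) / (len w l * len w m)"

text \<open>
  The singular value function, in a form that shows why it does not depend on the choice of
  the axes: where that choice is ambiguous, the quotient of the two edge lengths is 1.
\<close>

definition wt :: "(3 \<Rightarrow> real) \<Rightarrow> (3 \<Rightarrow> real) \<Rightarrow> real \<Rightarrow> 'i list \<Rightarrow> 3 \<Rightarrow> 3 \<Rightarrow> real" where
  "wt p1 p2 s w l m =
     (len w l / mid w l m) powr p1 l * (mid w l m / len w m) powr p2 m * len w m powr s"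

lemma third_axis:
  fixes l m :: 3
  assumes "l \<noteq> m"
  obtains n where "n \<noteq> l" "n \<noteq> m" "UNIV = {l, n, m}"
proof -
  have "\<exists>n. n \<noteq> l \<and> n \<noteq> m \<and> UNIV = {l, n, m}"
    using assms exhaust_3[of l] exhaust_3[of m] unfolding UNIV_3
    by (elim disjE) (auto intro: exI[of _ 1] exI[of _ 2] exI[of _ 3])
  then show thesis using that by blast
qed

lemma mid_eq:
  assumes "w \<in> lists I" "n \<noteq> l" "n \<noteq> m" "UNIV = {l, n, m}" "l \<noteq> m"
  shows "mid w l m = len w n"
proof -
  have "(\<Prod>k\<in>UNIV. len w k) = (\<Prod>k\<in>{l, n, m}. len w k)" by (simp only: assms(4))
  also have "\<dots> = len w n * (len w l * len w m)" using assms(2,3,5) by simp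
  finally show ?thesis
    using len_pos[OF assms(1), of l] len_pos[OF assms(1), of m] unfolding mid_def by simp
qed

lemma mid_bounds:
  assumes "w \<in> lists I" "chamber w l m"
  shows "k \<noteq> l \<Longrightarrow> len w k \<le> mid w l m" "k \<noteq> m \<Longrightarrow> mid w l m \<le> len w k"
    "len w m \<le> mid w l m" "mid w l m \<le> len w l" "0 < mid w l m"
proof -
  have "(k \<noteq> l \<longrightarrow> len w k \<le> mid w l m) \<and> (k \<noteq> m \<longrightarrow> mid w l m \<le> len w k)
    \<and> len w m \<le> mid w l m \<and> mid w l m \<le> len w l" for k
  proof (cases "l = m")
    case True
    then have eq: "len w j = len w l" for j using assms(2) unfolding chamber_def by (metis antisym)
    have "(\<Prod>k\<in>UNIV. len w k) = (\<Prod>k\<in>(UNIV :: 3 set). len w l)"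
      by (intro prod.cong refl eq)
    then have "mid w l m = len w l"
      using len_pos[OF assms(1), of l] eq[of m] unfolding mid_def by (simp add: power3_eq_cube)
    then show ?thesis using eq by (metis order_refl)
  next
    case False
    obtain n where n: "n \<noteq> l" "n \<noteq> m" "UNIV = {l, n, m}" using third_axis[OF False] by blast
    have "mid w l m = len w n" by (rule mid_eq[OF assms(1) n False])
    moreover have "k = l \<or> k = n \<or> k = m" using n(3) by auto
    ultimately show ?thesis using assms(2) unfolding chamber_def by auto
  qed
  then show "k \<noteq> l \<Longrightarrow> len w k \<le> mid w l m" "k \<noteq> m \<Longrightarrow> mid w l m \<le> len w k"
    "len w m \<le> mid w l m" "mid w l m \<le> len w l" by blast+
  then show "0 < mid w l m" using len_pos[OF assms(1), of m] by linarith
qed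

lemma wt_chamber_cong:
  assumes "w \<in> lists I" "chamber w l m" "chamber w l' m'"
  shows "wt p1 p2 s w l m = wt p1 p2 s w l' m'"
proof -
  have l: "len w l = len w l'" and m: "len w m = len w m'"
    using assms(2,3) unfolding chamber_def by (auto intro: antisym)
  then have mid: "mid w l m = mid w l' m'" unfolding mid_def by simp
  have "(len w l / mid w l m) powr p1 l = (len w l' / mid w l' m') powr p1 l'"
  proof (cases "l = l'")
    case False
    then have "len w l = mid w l m" using mid_bounds(1)[OF assms(1,2), of l'] mid_bounds(4)[OF assms(1,2)] l by simp
    then show ?thesis using l mid mid_bounds(5)[OF assms(1,2)] by simp
  qed (use l mid in simp)
  moreover have "(mid w l m / len w m) powr p2 m = (mid w l' m' / len w m') powr p2 m'"
  proof (cases "m = m'")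
    case False
    then have "len w m = mid w l m" using mid_bounds(2)[OF assms(1,2), of m'] mid_bounds(3)[OF assms(1,2)] m by simp
    then show ?thesis using m mid mid_bounds(5)[OF assms(1,2)] by simp
  qed (use m mid in simp)
  ultimately show ?thesis unfolding wt_def using m by simp
qed

lemma wt_pos: "w \<in> lists I \<Longrightarrow> chamber w l m \<Longrightarrow> 0 < wt p1 p2 s w l m"
  unfolding wt_def using len_pos[of w l] len_pos[of w m] mid_bounds(5)[of w l m]
  by (intro mult_pos_pos) auto

lemma ex_chamber:
  obtains l n m where "l \<noteq> n" "n \<noteq> m" "l \<noteq> m" "UNIV = {l, n, m}" "chamber w l m"
proof -
  have fin: "finite (range (len w))" by simp
  obtain l where l: "Max (range (len w)) = len w l" using Max_in[OF fin] by blast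
  have l': "len w k \<le> len w l" for k unfolding l[symmetric] using fin by (intro Max_ge) auto
  obtain m where m: "Min (range (len w)) = len w m" using Min_in[OF fin] by blast
  have m': "len w m \<le> len w k" for k unfolding m[symmetric] using fin by (intro Min_le) auto
  obtain j where j: "l \<noteq> j" "chamber w l j"
  proof (cases "l = m")
    case True
    then have "chamber w l j" for j using l' m' unfolding chamber_def by (meson order_trans)
    moreover have "\<exists>j. l \<noteq> j" by (metis zero_neq_one)
    ultimately show ?thesis using that by blast
  next
    case False
    then show ?thesis using that l' m' unfolding chamber_def by blast
  qed
  obtain n where n: "n \<noteq> l" "n \<noteq> j" "UNIV = {l, n, j}" using third_axis[OF j(1)] by blast
  show thesis by (rule that[OF n(1)[symmetric] n(2) j(1) n(3) j(2)])
qed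

lemma chamber_mult:
  assumes "u \<in> lists I" "v \<in> lists I" "\<forall>k. src u k = k" "chamber u l m" "chamber v l m"
  shows "chamber (u @ v) l m" "wt p1 p2 s (u @ v) l m = wt p1 p2 s u l m * wt p1 p2 s v l m"
proof -
  have len: "len (u @ v) k = len u k * len v k" for k using assms(3) by (simp add: len_append)
  note pos = len_pos[OF assms(1)] len_pos[OF assms(2)]
  show "chamber (u @ v) l m"
    using assms(4,5) pos unfolding chamber_def len by (auto intro!: mult_mono simp: less_imp_le)
  have mid: "mid (u @ v) l m = mid u l m * mid v l m"
    unfolding mid_def len by (simp add: prod.distrib)
  have mpos: "0 < mid u l m" "0 < mid v l m" using mid_bounds(5) assms by auto
  have fr: "len (u @ v) l / mid (u @ v) l m = (len u l / mid u l m) * (len v l / mid v l m)"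
    "mid (u @ v) l m / len (u @ v) m = (mid u l m / len u m) * (mid v l m / len v m)"
    unfolding len mid by simp_all
  have nonneg: "0 \<le> len u l / mid u l m" "0 \<le> len v l / mid v l m" "0 \<le> mid u l m / len u m" "0 \<le> mid v l m / len v m"
    using pos[of l] pos[of m] mpos by simp_all
  have "(len (u @ v) l / mid (u @ v) l m) powr p1 l = (len u l / mid u l m) powr p1 l * (len v l / mid v l m) powr p1 l"
    using nonneg unfolding fr by (subst powr_mult) simp_all
  moreover have "(mid (u @ v) l m / len (u @ v) m) powr p2 m = (mid u l m / len u m) powr p2 m * (mid v l m / len v m) powr p2 m"
    using nonneg unfolding fr by (subst powr_mult) simp_all
  moreover have "len (u @ v) m powr s = len u m powr s * len v m powr s"
    using pos[of m] unfolding len by (subst powr_mult) simp_all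
  ultimately show "wt p1 p2 s (u @ v) l m = wt p1 p2 s u l m * wt p1 p2 s v l m"
    unfolding wt_def by (simp add: ac_simps)
qed

text \<open>
  Appending a letter changes every edge length by a bounded factor. If it also changes the
  longest axis, then the two longest edges have comparable lengths before and after, so that
  the exponents \<open>p1\<close> of both axes are harmless; the same for the shortest axis.
\<close>

lemma wt_snoc:
  assumes "\<And>k. 0 \<le> p1 k" "\<And>k. 0 \<le> p2 k" "0 \<le> s"
  obtains \<kappa> where "1 \<le> \<kappa>" "\<And>w i l m l' m'. w \<in> lists I \<Longrightarrow> i \<in> I \<Longrightarrow> chamber w l m \<Longrightarrow> chamber (w @ [i]) l' m' \<Longrightarrow>
    wt p1 p2 s w l m \<le> \<kappa> * wt p1 p2 s (w @ [i]) l' m'"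
proof -
  define A where "A = (\<Sum>k\<in>UNIV. p1 k)"
  define B where "B = (\<Sum>k\<in>UNIV. p2 k)"
  have A: "p1 k \<le> A" for k unfolding A_def using assms(1) by (intro member_le_sum) auto
  have B: "p2 k \<le> B" for k unfolding B_def using assms(2) by (intro member_le_sum) auto
  have AB0: "0 \<le> A" "0 \<le> B" unfolding A_def B_def using assms by (auto intro: sum_nonneg)
  \<comment> \<open>The third power is due to the middle edge length, which is expressed by the product of all three.\<close>
  define g where "g = 1 / cmin ^ 3"
  have g1: "1 \<le> g" unfolding g_def using cmin_pos cmin_less_1 by (simp add: power_le_one)
  have cg: "1 / cmin \<le> g"
    unfolding g_def using cmin_pos cmin_less_1 power_decreasing[of 1 3 cmin] by (simp add: frac_le)
  \<comment> \<open>Quotients of edge lengths before and after: with the same axis, or with a bounded quotient before.\<close>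
  have quot: "(a :: real) powr p \<le> g powr P * b powr p'"
    if "0 < a" "0 < b" "0 \<le> p" "p \<le> P" "p = p' \<and> a \<le> g * b \<or> a \<le> g \<and> 1 \<le> b \<and> 0 \<le> p'" for a b p p' P
    using that(5)
  proof
    assume h: "p = p' \<and> a \<le> g * b"
    then have "a powr p \<le> (g * b) powr p" using that by (intro powr_mono2) auto
    also have "\<dots> = g powr p * b powr p" using g1 that by (simp add: powr_mult)
    also have "\<dots> \<le> g powr P * b powr p" using g1 that by (intro mult_right_mono powr_mono) auto
    finally show ?thesis using h by simp
  next
    assume h: "a \<le> g \<and> 1 \<le> b \<and> 0 \<le> p'"
    then have "a powr p \<le> g powr p" using that by (intro powr_mono2) auto
    also have "\<dots> \<le> g powr P * 1" using g1 that by (auto intro: powr_mono)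
    also have "\<dots> \<le> g powr P * b powr p'" using h by (intro mult_left_mono ge_one_powr_ge_zero) auto
    finally show ?thesis .
  qed
  show thesis
  proof (rule that)
    have "1 \<le> g powr A" "1 \<le> g powr B" "1 \<le> g powr s"
      using g1 AB0 assms(3) by (auto intro: ge_one_powr_ge_zero)
    then show "1 \<le> g powr A * g powr B * g powr s"
      by (meson mult_ge1_I)
    fix w i l m l' m'
    assume h: "w \<in> lists I" "i \<in> I" "chamber w l m" "chamber (w @ [i]) l' m'"
    let ?v = "w @ [i]"
    have v: "?v \<in> lists I" using h by simp
    have lo: "cmin * len w k \<le> len ?v k" and hi: "len ?v k \<le> len w k" for k
    proof -
      have "cmax * len w k \<le> 1 * len w k"
        using cmax_less_1 len_pos[OF h(1), of k] by (intro mult_right_mono) auto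
      then show "cmin * len w k \<le> len ?v k" "len ?v k \<le> len w k"
        using len_snoc_bounds[OF h(1,2), of k] by linarith+
    qed
    note pw = len_pos[OF h(1)] and pv = len_pos[OF v]
    note mw = mid_bounds[OF h(1,3)] and mv = mid_bounds[OF v h(4)]
    have ch: "len w k \<le> len w l" "len w m \<le> len w k" "len ?v k \<le> len ?v l'" "len ?v m' \<le> len ?v k" for k
      using h(3,4) unfolding chamber_def by auto
    have Y1: "cmin * len w l \<le> len ?v l'" "len ?v l' \<le> len w l"
      using lo[of l] ch(3)[of l] hi[of l'] ch(1)[of l'] by linarith+
    have Y3: "cmin * len w m \<le> len ?v m'" "len ?v m' \<le> len w m"
      using mult_left_mono[OF ch(2)[of m'], of cmin] lo[of m'] ch(4)[of m] hi[of m] cmin_pos by linarith+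
    have prod_lo: "cmin ^ 3 * (\<Prod>k\<in>UNIV. len w k) \<le> (\<Prod>k\<in>UNIV. len ?v k)"
    proof -
      have "cmin ^ 3 * (\<Prod>k\<in>(UNIV :: 3 set). len w k) = (\<Prod>k\<in>UNIV. cmin * len w k)"
        by (simp add: prod.distrib)
      also have "\<dots> \<le> (\<Prod>k\<in>UNIV. len ?v k)"
        using lo cmin_pos pw by (intro prod_mono) (auto intro: mult_nonneg_nonneg less_imp_le)
      finally show ?thesis .
    qed
    have prod_hi: "(\<Prod>k\<in>UNIV. len ?v k) \<le> (\<Prod>k\<in>UNIV. len w k)"
      using hi pv by (intro prod_mono) (auto intro: less_imp_le)
    have prod_pos: "0 < (\<Prod>k\<in>UNIV. len w k)" "0 < (\<Prod>k\<in>UNIV. len ?v k)"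
      using pw pv by (auto intro: prod_pos)
    have q1: "len w l / mid w l m \<le> g * (len ?v l' / mid ?v l' m')"
    proof -
      have "mid ?v l' m' \<le> (\<Prod>k\<in>UNIV. len w k) / ((cmin * len w l) * (cmin * len w m))"
        unfolding mid_def using prod_hi Y1 Y3 pw pv prod_pos cmin_pos
        by (intro frac_le mult_mono mult_pos_pos) (auto intro: less_imp_le)
      also have "\<dots> = mid w l m / cmin ^ 2"
        unfolding mid_def by (simp add: power2_eq_square ac_simps)
      finally have m2: "mid ?v l' m' \<le> mid w l m / cmin ^ 2" .
      have "len w l / mid w l m = g * ((cmin * len w l) / (mid w l m / cmin ^ 2))"
        unfolding g_def using cmin_pos mw(5) by (simp add: field_simps power2_eq_square power3_eq_cube)
      also have "\<dots> \<le> g * (len ?v l' / mid ?v l' m')"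
        using m2 Y1 g1 mv(5) pv[of l'] by (intro mult_left_mono frac_le) (auto intro: less_imp_le)
      finally show ?thesis .
    qed
    have q2: "mid w l m / len w m \<le> g * (mid ?v l' m' / len ?v m')"
    proof -
      have "cmin ^ 3 * mid w l m = (cmin ^ 3 * (\<Prod>k\<in>UNIV. len w k)) / (len w l * len w m)"
        unfolding mid_def by simp
      also have "\<dots> \<le> mid ?v l' m'"
        unfolding mid_def using prod_lo Y1 Y3 pw pv prod_pos
        by (intro frac_le mult_mono mult_pos_pos) (auto intro: less_imp_le)
      finally have m2: "cmin ^ 3 * mid w l m \<le> mid ?v l' m'" .
      have "mid w l m / len w m = g * (cmin ^ 3 * mid w l m / len w m)"
        unfolding g_def using cmin_pos by simp
      also have "\<dots> \<le> g * (mid ?v l' m' / len ?v m')"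
        using m2 Y3 g1 mv(5) pv[of m'] by (intro mult_left_mono frac_le) (auto intro: less_imp_le)
      finally show ?thesis .
    qed
    have f1: "(len w l / mid w l m) powr p1 l \<le> g powr A * (len ?v l' / mid ?v l' m') powr p1 l'"
    proof (rule quot)
      show "p1 l = p1 l' \<and> len w l / mid w l m \<le> g * (len ?v l' / mid ?v l' m') \<or>
        len w l / mid w l m \<le> g \<and> 1 \<le> len ?v l' / mid ?v l' m' \<and> 0 \<le> p1 l'"
      proof (cases "l = l'")
        case False
        then have "len w l' \<le> mid w l m" using mw(1)[of l'] by auto
        then have "cmin * len w l \<le> mid w l m" using Y1(1) hi[of l'] by linarith
        then have "len w l / mid w l m \<le> 1 / cmin" using cmin_pos mw(5) by (simp add: field_simps)
        then show ?thesis using cg mv(4,5) assms(1) by auto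
      qed (use q1 in simp)
    qed (use pw mw(5) pv mv(5) assms(1) A in auto)
    have f2: "(mid w l m / len w m) powr p2 m \<le> g powr B * (mid ?v l' m' / len ?v m') powr p2 m'"
    proof (rule quot)
      show "p2 m = p2 m' \<and> mid w l m / len w m \<le> g * (mid ?v l' m' / len ?v m') \<or>
        mid w l m / len w m \<le> g \<and> 1 \<le> mid ?v l' m' / len ?v m' \<and> 0 \<le> p2 m'"
      proof (cases "m = m'")
        case False
        then have "mid w l m \<le> len w m'" using mw(2)[of m'] by auto
        then have "cmin * mid w l m \<le> cmin * len w m'" using cmin_pos by simp
        then have "cmin * mid w l m \<le> len w m" using Y3(2) lo[of m'] by linarith
        then have "mid w l m / len w m \<le> 1 / cmin" using cmin_pos pw[of m] by (simp add: field_simps)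
        then show ?thesis using cg mv(3) pv[of m'] assms(2) by auto
      qed (use q2 in simp)
    qed (use pw mw(5) pv mv(5) assms(2) B in auto)
    have "len w m \<le> 1 / cmin * len ?v m'" using Y3 cmin_pos by (simp add: field_simps)
    also have "\<dots> \<le> g * len ?v m'" using cg pv[of m'] by (intro mult_right_mono) auto
    finally have f3: "len w m powr s \<le> g powr s * len ?v m' powr s"
      using pw[of m] pv[of m'] assms(3) by (intro quot) auto
    have "wt p1 p2 s w l m \<le> (g powr A * (len ?v l' / mid ?v l' m') powr p1 l') *
      (g powr B * (mid ?v l' m' / len ?v m') powr p2 m') * (g powr s * len ?v m' powr s)"
      unfolding wt_def by (intro mult_mono f1 f2 f3) auto
    then show "wt p1 p2 s w l m \<le> (g powr A * g powr B * g powr s) * wt p1 p2 s ?v l' m'"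
      unfolding wt_def by (simp add: ac_simps)
  qed
qed

end

lemma root_growth_limit:
  fixes T :: "nat \<Rightarrow> real"
  assumes "0 < \<rho>" "0 < C" "\<And>n. 1 \<le> n \<Longrightarrow> T n \<le> C * \<rho> ^ n"
    and "\<And>\<theta>. 0 < \<theta> \<Longrightarrow> \<theta> < \<rho> \<Longrightarrow> \<exists>c>0. \<forall>n. c * \<theta> ^ n \<le> T n"
  shows "(\<lambda>n. root n (T n)) \<longlonglongrightarrow> \<rho>"
proof -
  have lim: "(\<lambda>n. root n c * \<theta>) \<longlonglongrightarrow> \<theta>" if "0 < c" for c \<theta> :: real
    using tendsto_mult_right[OF LIMSEQ_root_const[OF that], of \<theta>] by simp
  have rt: "root n (c * \<theta> ^ n) = root n c * \<theta>" if "1 \<le> n" "0 < c" "0 < \<theta>" for n c and \<theta> :: real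
    using that by (simp add: real_root_mult real_root_power_cancel)
  show ?thesis
  proof (rule order_tendstoI)
    fix a assume "a < \<rho>"
    define \<theta> where "\<theta> = (max a 0 + \<rho>) / 2"
    have \<theta>: "0 < \<theta>" "\<theta> < \<rho>" "a < \<theta>" using \<open>a < \<rho>\<close> assms(1) unfolding \<theta>_def by auto
    obtain c where c: "0 < c" "\<And>n. c * \<theta> ^ n \<le> T n" using assms(4)[OF \<theta>(1,2)] by blast
    show "eventually (\<lambda>n. a < root n (T n)) sequentially"
      using order_tendstoD(1)[OF lim[OF c(1)] \<theta>(3)] eventually_ge_at_top[of 1]
    proof eventually_elim
      case (elim n)
      have "root n (c * \<theta> ^ n) \<le> root n (T n)" using c(2) elim by (intro real_root_le_mono) auto
      then show ?case using elim rt[of n c \<theta>] c(1) \<theta>(1) by simp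
    qed
  next
    fix a assume "\<rho> < a"
    show "eventually (\<lambda>n. root n (T n) < a) sequentially"
      using order_tendstoD(2)[OF lim[OF assms(2)] \<open>\<rho> < a\<close>] eventually_ge_at_top[of 1]
    proof eventually_elim
      case (elim n)
      have "root n (T n) \<le> root n (C * \<rho> ^ n)" using assms(3) elim by (intro real_root_le_mono) auto
      then show ?case using elim rt[of n C \<rho>] assms(1,2) by simp
    qed
  qed
qed

context sponge
begin

lemma words_of_length_lists: "w \<in> words_of_length I n \<longleftrightarrow> w \<in> lists I \<and> length w = n"
  unfolding words_of_length_def by auto

lemma finite_words_of_length: "finite (words_of_length I n)"
  unfolding words_of_length_def using finite_lists_length_eq[OF finite_I, of n]
  by (simp add: conj_commute)

lemma card_words_of_length: "card (words_of_length I n) = card I ^ n"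
  unfolding words_of_length_def using card_lists_length_eq[OF finite_I, of n]
  by (simp add: conj_commute)

text \<open>
  As the axes are not permuted, edge lengths multiply under concatenation; so loops of the same
  chamber are closed under concatenation, with multiplicative weights.
\<close>

definition loops :: "nat \<Rightarrow> 3 \<Rightarrow> 3 \<Rightarrow> 'i list set" where
  "loops n l m = {w \<in> words_of_length I n. (\<forall>k. src w k = k) \<and> chamber w l m}"

definition loop_sum :: "(3 \<Rightarrow> real) \<Rightarrow> (3 \<Rightarrow> real) \<Rightarrow> real \<Rightarrow> 3 \<Rightarrow> 3 \<Rightarrow> nat \<Rightarrow> real" where
  "loop_sum p1 p2 s l m n = (\<Sum>w\<in>loops n l m. wt p1 p2 s w l m)"

lemma finite_loops: "finite (loops n l m)"
  unfolding loops_def using finite_words_of_length by simp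

lemma loops_lists: "w \<in> loops n l m \<Longrightarrow> w \<in> lists I \<and> chamber w l m"
  unfolding loops_def by (auto simp: words_of_length_lists)

lemma wt_loops_nonneg: "w \<in> loops n l m \<Longrightarrow> 0 \<le> wt p1 p2 s w l m"
  using loops_lists[of w n l m] by (auto intro!: less_imp_le[OF wt_pos])

lemma loop_sum_nonneg: "0 \<le> loop_sum p1 p2 s l m n"
  unfolding loop_sum_def by (intro sum_nonneg wt_loops_nonneg)

lemma loop_sum_mult: "loop_sum p1 p2 s l m a * loop_sum p1 p2 s l m b \<le> loop_sum p1 p2 s l m (a + b)"
proof -
  have mult: "u @ v \<in> loops (a + b) l m" "wt p1 p2 s (u @ v) l m = wt p1 p2 s u l m * wt p1 p2 s v l m"
    if "u \<in> loops a l m" "v \<in> loops b l m" for u v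
    using that chamber_mult[of u v l m]
    by (auto simp: loops_def words_of_length_lists src_append)
  have inj: "inj_on (\<lambda>(u, v). u @ v) (loops a l m \<times> loops b l m)"
    by (auto simp: inj_on_def loops_def words_of_length_lists)
  have "loop_sum p1 p2 s l m a * loop_sum p1 p2 s l m b =
    (\<Sum>(u, v)\<in>loops a l m \<times> loops b l m. wt p1 p2 s u l m * wt p1 p2 s v l m)"
    unfolding loop_sum_def by (simp add: sum_product sum.cartesian_product)
  also have "\<dots> = (\<Sum>(u, v)\<in>loops a l m \<times> loops b l m. wt p1 p2 s (u @ v) l m)"
    using mult(2) by (intro sum.cong) auto
  also have "\<dots> = (\<Sum>w\<in>(\<lambda>(u, v). u @ v) ` (loops a l m \<times> loops b l m). wt p1 p2 s w l m)"
    using inj by (subst sum.reindex) (auto simp: case_prod_unfold)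
  also have "\<dots> \<le> loop_sum p1 p2 s l m (a + b)"
    unfolding loop_sum_def
  proof (rule sum_mono2[OF finite_loops])
    show "(\<lambda>(u, v). u @ v) ` (loops a l m \<times> loops b l m) \<subseteq> loops (a + b) l m"
      using mult(1) by auto
    show "0 \<le> wt p1 p2 s w l m" if "w \<in> loops (a + b) l m - (\<lambda>(u, v). u @ v) ` (loops a l m \<times> loops b l m)" for w
      using that wt_loops_nonneg by (elim DiffE)
  qed
  finally show ?thesis .
qed

end

text \<open>
  Both pressures are of this form; they only differ in the exponents attached to the axes.
\<close>

locale sponge_weights = sponge I S F for I :: "'i set" and S F +
  fixes p1 p2 :: "3 \<Rightarrow> real" and l m :: "'i list \<Rightarrow> 3"
  assumes p1_nonneg: "0 \<le> p1 k" and p2_nonneg: "0 \<le> p2 k"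
    and chamber_lm: "w \<in> lists I \<Longrightarrow> chamber w (l w) (m w)"
begin

definition \<psi> :: "real \<Rightarrow> 'i list \<Rightarrow> real" where
  "\<psi> s w = wt p1 p2 s w (l w) (m w)"

definition total :: "real \<Rightarrow> nat \<Rightarrow> real" where
  "total s n = (\<Sum>w\<in>words_of_length I n. \<psi> s w)"

abbreviation loop :: "real \<Rightarrow> 3 \<Rightarrow> 3 \<Rightarrow> nat \<Rightarrow> real" where
  "loop s \<equiv> loop_sum p1 p2 s"

lemma \<psi>_eq: "w \<in> lists I \<Longrightarrow> chamber w a b \<Longrightarrow> \<psi> s w = wt p1 p2 s w a b"
  unfolding \<psi>_def by (intro wt_chamber_cong chamber_lm)

lemma \<psi>_pos: "w \<in> lists I \<Longrightarrow> 0 < \<psi> s w"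
  unfolding \<psi>_def by (intro wt_pos chamber_lm)

lemma \<psi>_nonneg: "w \<in> lists I \<Longrightarrow> 0 \<le> \<psi> s w"
  by (rule less_imp_le[OF \<psi>_pos])

lemma \<psi>_0_ge_1:
  assumes "w \<in> lists I"
  shows "1 \<le> \<psi> 0 w"
proof -
  note mid = mid_bounds[OF assms chamber_lm[OF assms]] and pos = len_pos[OF assms, of "m w"]
  have "1 \<le> (len w (l w) / mid w (l w) (m w)) powr p1 (l w)" "1 \<le> (mid w (l w) (m w) / len w (m w)) powr p2 (m w)"
    using mid(3-5) pos p1_nonneg p2_nonneg by (auto intro!: ge_one_powr_ge_zero)
  then show ?thesis unfolding \<psi>_def wt_def using pos by (simp add: mult_ge1_I)
qed

lemma \<psi>_add: "\<psi> (s + h) w = \<psi> s w * len w (m w) powr h"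
  unfolding \<psi>_def wt_def by (simp add: powr_add)

lemma total_pos: "0 < total s n"
proof -
  have "words_of_length I n \<noteq> {}"
    using card_words_of_length[of n] card_I by (intro notI) simp
  then show ?thesis
    unfolding total_def using \<psi>_pos finite_words_of_length
    by (intro sum_pos) (auto simp: words_of_length_lists)
qed

lemma loop_le_total: "loop s a b n \<le> total s n"
proof -
  have "loop s a b n = (\<Sum>w\<in>loops n a b. \<psi> s w)"
    unfolding loop_sum_def
  proof (rule sum.cong[OF refl])
    fix w assume "w \<in> loops n a b"
    from loops_lists[OF this] show "wt p1 p2 s w a b = \<psi> s w" using \<psi>_eq[of w a b s] by simp
  qed
  also have "\<dots> \<le> total s n"
    unfolding total_def
  proof (rule sum_mono2[OF finite_words_of_length])
    show "loops n a b \<subseteq> words_of_length I n" unfolding loops_def by auto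
    show "0 \<le> \<psi> s w" if "w \<in> words_of_length I n - loops n a b" for w
      using that \<psi>_nonneg by (auto simp: words_of_length_lists)
  qed
  finally show ?thesis .
qed

lemma total_le_power:
  assumes "0 \<le> s"
  shows "total s n \<le> (real (card I) * (1 / cmin) powr (\<Sum>k\<in>UNIV. p1 k) * (1 / cmin) powr (\<Sum>k\<in>UNIV. p2 k)) ^ n"
proof -
  let ?A = "\<Sum>k\<in>UNIV. p1 k" and ?B = "\<Sum>k\<in>UNIV. p2 k"
  have A: "p1 k \<le> ?A" for k using p1_nonneg by (intro member_le_sum) auto
  have B: "p2 k \<le> ?B" for k using p2_nonneg by (intro member_le_sum) auto
  have c: "1 \<le> 1 / cmin" using cmin_pos cmin_less_1 by simp
  have quot: "x powr p \<le> ((1 / cmin) powr P) ^ n"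
    if "0 < x" "x \<le> (1 / cmin) ^ n" "0 \<le> p" "p \<le> P" for x p P
  proof -
    have "x powr p \<le> ((1 / cmin) ^ n) powr p" using that by (intro powr_mono2) auto
    also have "\<dots> \<le> ((1 / cmin) ^ n) powr P" using that c by (intro powr_mono) (auto intro: one_le_power)
    also have "\<dots> = ((1 / cmin) powr P) ^ n"
      using cmin_pos by (simp add: powr_realpow[symmetric] powr_powr mult.commute)
    finally show ?thesis .
  qed
  have "\<psi> s w \<le> ((1 / cmin) powr ?A) ^ n * ((1 / cmin) powr ?B) ^ n * 1" if "w \<in> words_of_length I n" for w
  proof -
    have w: "w \<in> lists I" "length w = n" using that by (auto simp: words_of_length_lists)
    note mid = mid_bounds[OF w(1) chamber_lm[OF w(1)]] and pos = len_pos[OF w(1)]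
    have lo: "cmin ^ n \<le> len w (m w)" using len_bounds(1)[OF w(1), of "m w"] w(2) by simp
    then have lo': "cmin ^ n \<le> mid w (l w) (m w)" using mid(3) by linarith
    have hi: "len w (l w) \<le> 1" by (rule len_le_1[OF w(1)])
    have cn: "0 < cmin ^ n" using cmin_pos by simp
    have "len w (l w) / mid w (l w) (m w) \<le> 1 / cmin ^ n"
      using lo' hi mid(5) pos[of "l w"] cn by (intro frac_le) auto
    moreover have "mid w (l w) (m w) / len w (m w) \<le> 1 / cmin ^ n"
      using lo hi mid(4,5) pos[of "m w"] cn by (intro frac_le) auto
    ultimately show ?thesis
      unfolding \<psi>_def wt_def using mid(5) pos p1_nonneg p2_nonneg A B len_le_1[OF w(1)] assms
      by (intro mult_mono quot) (auto simp: power_one_over powr_le1 less_imp_le)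
  qed
  then have "total s n \<le> real (card (words_of_length I n)) * (((1 / cmin) powr ?A) ^ n * ((1 / cmin) powr ?B) ^ n * 1)"
    unfolding total_def by (rule sum_bounded_above)
  then show ?thesis by (simp add: card_words_of_length power_mult_distrib mult.assoc)
qed

lemma \<psi>_append:
  assumes "0 \<le> s"
  obtains \<kappa> where "1 \<le> \<kappa>"
    "\<And>w v. w \<in> lists I \<Longrightarrow> v \<in> lists I \<Longrightarrow> \<psi> s w \<le> \<kappa> ^ length v * \<psi> s (w @ v)"
proof -
  obtain \<kappa> where \<kappa>: "1 \<le> \<kappa>" "\<And>w i l m l' m'. w \<in> lists I \<Longrightarrow> i \<in> I \<Longrightarrow> chamber w l m \<Longrightarrow> chamber (w @ [i]) l' m' \<Longrightarrow>
    wt p1 p2 s w l m \<le> \<kappa> * wt p1 p2 s (w @ [i]) l' m'"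
    using wt_snoc[of p1 p2 s] p1_nonneg p2_nonneg assms by blast
  have "\<psi> s w \<le> \<kappa> ^ length v * \<psi> s (w @ v)" if "w \<in> lists I" "v \<in> lists I" for w v
    using that(2)
  proof (induction v rule: rev_induct)
    case (snoc i v)
    then have "\<psi> s w \<le> \<kappa> ^ length v * \<psi> s (w @ v)" by simp
    also have "\<psi> s (w @ v) \<le> \<kappa> * \<psi> s ((w @ v) @ [i])"
      unfolding \<psi>_def using that snoc by (intro \<kappa>(2) chamber_lm) auto
    finally show ?case using \<kappa>(1) by (simp add: mult_left_mono ac_simps)
  qed simp
  then show thesis using \<kappa>(1) that by blast
qed

text \<open>
  Extending each word to one that induces the identity on the axes costs a bounded factor and
  adds a bounded number of letters; the original word is a prefix of known length of the
  extension, so no loop is counted twice.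
\<close>

lemma total_le_loops:
  assumes "0 \<le> s"
  obtains C L where "0 < C" "\<And>n. total s n \<le> C * (\<Sum>j\<le>L. \<Sum>a\<in>UNIV. \<Sum>b\<in>UNIV. loop s a b (n + j))"
proof -
  obtain \<kappa> where \<kappa>: "1 \<le> \<kappa>"
    "\<And>w v. w \<in> lists I \<Longrightarrow> v \<in> lists I \<Longrightarrow> \<psi> s w \<le> \<kappa> ^ length v * \<psi> s (w @ v)"
    using \<psi>_append[OF assms] by blast
  obtain L where L: "\<And>w. w \<in> lists I \<Longrightarrow> \<exists>w'\<in>lists I. length w' \<le> L \<and> (\<forall>k. src w' (src w k) = k)"
    using bounded_return_words by blast
  then obtain r where r: "\<And>w. w \<in> lists I \<Longrightarrow> r w \<in> lists I" "\<And>w. w \<in> lists I \<Longrightarrow> length (r w) \<le> L"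
    "\<And>w k. w \<in> lists I \<Longrightarrow> src (r w) (src w k) = k"
    by metis
  have "total s n \<le> \<kappa> ^ L * (\<Sum>j\<le>L. \<Sum>a\<in>UNIV. \<Sum>b\<in>UNIV. loop s a b (n + j))" for n
  proof -
    let ?W = "words_of_length I n"
    let ?g = "\<lambda>w. w @ r w"
    let ?f = "\<lambda>w j a b. if ?g w \<in> loops (n + j) a b then wt p1 p2 s (?g w) a b else 0"
    have f_nonneg: "0 \<le> ?f w j a b" for w j a b
      using wt_loops_nonneg by auto
    have "\<psi> s w \<le> \<kappa> ^ L * (\<Sum>j\<le>L. \<Sum>a\<in>UNIV. \<Sum>b\<in>UNIV. ?f w j a b)" if "w \<in> ?W" for w
    proof -
      have w: "w \<in> lists I" "length w = n" using that by (auto simp: words_of_length_lists)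
      let ?j = "length (r w)" and ?a = "l (?g w)" and ?b = "m (?g w)"
      have gw: "?g w \<in> lists I" using w r(1) by simp
      have "?g w \<in> loops (n + ?j) ?a ?b"
        unfolding loops_def using w gw r(3)[OF w(1)] chamber_lm[OF gw]
        by (simp add: words_of_length_lists src_append)
      then have "\<psi> s (?g w) = ?f w ?j ?a ?b" by (simp add: \<psi>_def)
      also have "\<dots> \<le> (\<Sum>b\<in>UNIV. ?f w ?j ?a b)"
        using f_nonneg by (intro member_le_sum[of ?b UNIV "\<lambda>b. ?f w ?j ?a b"]) auto
      also have "\<dots> \<le> (\<Sum>a\<in>UNIV. \<Sum>b\<in>UNIV. ?f w ?j a b)"
        using f_nonneg by (intro member_le_sum[of ?a UNIV "\<lambda>a. \<Sum>b\<in>UNIV. ?f w ?j a b"]) (auto intro!: sum_nonneg)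
      also have "\<dots> \<le> (\<Sum>j\<le>L. \<Sum>a\<in>UNIV. \<Sum>b\<in>UNIV. ?f w j a b)"
        using f_nonneg r(2)[OF w(1)]
        by (intro member_le_sum[of ?j "{..L}" "\<lambda>j. \<Sum>a\<in>UNIV. \<Sum>b\<in>UNIV. ?f w j a b"]) (auto intro!: sum_nonneg)
      finally have le: "\<psi> s (?g w) \<le> (\<Sum>j\<le>L. \<Sum>a\<in>UNIV. \<Sum>b\<in>UNIV. ?f w j a b)" .
      have "\<psi> s w \<le> \<kappa> ^ ?j * \<psi> s (?g w)" using \<kappa>(2) w r(1) by blast
      also have "\<dots> \<le> \<kappa> ^ L * (\<Sum>j\<le>L. \<Sum>a\<in>UNIV. \<Sum>b\<in>UNIV. ?f w j a b)"
        using \<kappa>(1) r(2)[OF w(1)] le \<psi>_pos[OF gw]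
        by (intro mult_mono power_increasing) (auto intro: less_imp_le)
      finally show ?thesis .
    qed
    then have "total s n \<le> (\<Sum>w\<in>?W. \<kappa> ^ L * (\<Sum>j\<le>L. \<Sum>a\<in>UNIV. \<Sum>b\<in>UNIV. ?f w j a b))"
      unfolding total_def by (rule sum_mono)
    also have "\<dots> = \<kappa> ^ L * (\<Sum>j\<le>L. \<Sum>a\<in>UNIV. \<Sum>b\<in>UNIV. \<Sum>w\<in>?W. ?f w j a b)"
      by (simp only: sum_distrib_left[symmetric] sum.swap[of _ _ ?W])
    also have "\<dots> \<le> \<kappa> ^ L * (\<Sum>j\<le>L. \<Sum>a\<in>UNIV. \<Sum>b\<in>UNIV. loop s a b (n + j))"
    proof (intro mult_left_mono sum_mono)
      fix j a b
      have inj: "inj_on ?g {w \<in> ?W. ?g w \<in> loops (n + j) a b}"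
        by (auto simp: inj_on_def words_of_length_lists)
      have "(\<Sum>w\<in>?W. ?f w j a b) = (\<Sum>w\<in>{w \<in> ?W. ?g w \<in> loops (n + j) a b}. wt p1 p2 s (?g w) a b)"
        by (rule sum.inter_filter[symmetric, OF finite_words_of_length])
      also have "\<dots> = (\<Sum>u\<in>?g ` {w \<in> ?W. ?g w \<in> loops (n + j) a b}. wt p1 p2 s u a b)"
        using inj by (subst sum.reindex) auto
      also have "\<dots> \<le> loop s a b (n + j)"
        unfolding loop_sum_def by (intro sum_mono2[OF finite_loops] wt_loops_nonneg) auto
      finally show "(\<Sum>w\<in>?W. ?f w j a b) \<le> loop s a b (n + j)" .
    qed (use \<kappa>(1) in simp)
    finally show ?thesis .
  qed
  then show thesis using that[of "\<kappa> ^ L" L] \<kappa>(1) by simp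
qed

text \<open>
  The growth rate of the sums over all words is the best growth rate of a sum over loops. It is
  an upper bound because every word is a bounded extension away from a loop, and a lower bound
  because the sums over loops are supermultiplicative.
\<close>

definition rate :: "real \<Rightarrow> real" where
  "rate s = Sup {root n (loop s a b n) |a b n. 1 \<le> n}"

lemma bdd_above_loop_roots:
  assumes "0 \<le> s"
  shows "bdd_above {root n (loop s a b n) |a b n. 1 \<le> n}"
proof -
  define K where "K = real (card I) * (1 / cmin) powr (\<Sum>k\<in>UNIV. p1 k) * (1 / cmin) powr (\<Sum>k\<in>UNIV. p2 k)"
  have K: "0 \<le> K" unfolding K_def by simp
  have "root n (loop s a b n) \<le> K" if "1 \<le> n" for n a b
  proof -
    have "loop s a b n \<le> K ^ n"
      using loop_le_total total_le_power[OF assms] unfolding K_def by (meson order_trans)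
    then have "root n (loop s a b n) \<le> root n (K ^ n)" using that by (intro real_root_le_mono) auto
    also have "\<dots> = K" using K that by (intro real_root_power_cancel) auto
    finally show ?thesis .
  qed
  then show ?thesis by (intro bdd_aboveI[of _ K]) auto
qed

lemma loop_le_rate:
  assumes "0 \<le> s" "1 \<le> n"
  shows "loop s a b n \<le> rate s ^ n" "0 \<le> rate s"
proof -
  have le: "root n (loop s a b n) \<le> rate s" for a b
    unfolding rate_def using assms by (intro cSup_upper bdd_above_loop_roots) auto
  moreover have nonneg: "0 \<le> root n (loop s a b n)" for a b
    using loop_sum_nonneg by (rule real_root_ge_zero)
  ultimately show "0 \<le> rate s" by (meson order_trans)
  have "loop s a b n = root n (loop s a b n) ^ n"
    using assms(2) loop_sum_nonneg by (intro real_root_pow_pos2[symmetric]) auto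
  also have "\<dots> \<le> rate s ^ n" using le nonneg by (rule power_mono)
  finally show "loop s a b n \<le> rate s ^ n" .
qed

lemma total_upper:
  assumes "0 \<le> s"
  obtains C where "0 < C" "\<And>n. 1 \<le> n \<Longrightarrow> total s n \<le> C * rate s ^ n"
proof -
  obtain C L where C: "0 < C" "\<And>n. total s n \<le> C * (\<Sum>j\<le>L. \<Sum>a\<in>UNIV. \<Sum>b\<in>UNIV. loop s a b (n + j))"
    using total_le_loops[OF assms] by blast
  define D where "D = C * (\<Sum>j\<le>L. 9 * rate s ^ j)"
  have r0: "0 \<le> rate s" using loop_le_rate(2)[OF assms, of 1] by simp
  have "0 < (\<Sum>j\<le>L. 9 * rate s ^ j)"
    using r0 by (intro sum_pos2[of _ 0]) auto
  then have "0 < D" unfolding D_def using C(1) by simp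
  moreover have "total s n \<le> D * rate s ^ n" if "1 \<le> n" for n
  proof -
    have "(\<Sum>a\<in>UNIV. \<Sum>b\<in>UNIV. loop s a b (n + j)) \<le> 9 * rate s ^ j * rate s ^ n" for j
    proof -
      have "(\<Sum>a\<in>UNIV. \<Sum>b\<in>UNIV. loop s a b (n + j)) \<le> (\<Sum>a\<in>(UNIV :: 3 set). \<Sum>b\<in>(UNIV :: 3 set). rate s ^ (n + j))"
        using that by (intro sum_mono loop_le_rate(1)[OF assms]) simp
      then show ?thesis by (simp add: power_add mult.assoc mult.left_commute mult.commute[of "rate s ^ n"])
    qed
    then have "(\<Sum>j\<le>L. \<Sum>a\<in>UNIV. \<Sum>b\<in>UNIV. loop s a b (n + j)) \<le> (\<Sum>j\<le>L. 9 * rate s ^ j * rate s ^ n)"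
      by (rule sum_mono)
    then have "C * (\<Sum>j\<le>L. \<Sum>a\<in>UNIV. \<Sum>b\<in>UNIV. loop s a b (n + j)) \<le> C * (\<Sum>j\<le>L. 9 * rate s ^ j * rate s ^ n)"
      using C(1) by (intro mult_left_mono) auto
    also have "\<dots> = D * rate s ^ n" unfolding D_def by (simp add: sum_distrib_right)
    finally show ?thesis using C(2)[of n] by linarith
  qed
  ultimately show thesis by (rule that)
qed

lemma rate_pos: "0 \<le> s \<Longrightarrow> 0 < rate s"
proof -
  assume s: "0 \<le> s"
  obtain C where "0 < C" "\<And>n. 1 \<le> n \<Longrightarrow> total s n \<le> C * rate s ^ n" using total_upper[OF s] by blast
  then have "0 < C * rate s" using total_pos[of s 1] by (metis le_numeral_extra(4) less_le_trans power_one_right)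
  then show ?thesis using \<open>0 < C\<close> by (simp add: zero_less_mult_iff)
qed

lemma loop_power: "loop s a b n ^ q \<le> loop s a b (q * n)"
proof (induction q)
  case 0
  have "[] \<in> loops 0 a b" by (simp add: loops_def words_of_length_lists chamber_def)
  moreover have "wt p1 p2 s [] a b = 1" by (simp add: wt_def mid_def)
  moreover have "wt p1 p2 s [] a b \<le> loop s a b 0" if "[] \<in> loops 0 a b"
    unfolding loop_sum_def
    by (rule member_le_sum[OF that _ finite_loops]) (auto intro: wt_loops_nonneg)
  ultimately have "1 \<le> loop s a b 0" by simp
  then show ?case by simp
next
  case (Suc q)
  have "loop s a b n ^ Suc q \<le> loop s a b n * loop s a b (q * n)"
    using Suc loop_sum_nonneg by (simp add: mult_left_mono)
  also have "\<dots> \<le> loop s a b (Suc q * n)" using loop_sum_mult by simp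
  finally show ?case .
qed

lemma total_lower:
  assumes "0 \<le> s" "0 < \<theta>" "\<theta> < rate s"
  shows "\<exists>c>0. \<forall>n. c * \<theta> ^ n \<le> total s n"
proof -
  obtain a b N where N: "1 \<le> N" "\<theta> < root N (loop s a b N)"
  proof -
    have "{root n (loop s a b n) |a b n. 1 \<le> n} \<noteq> {}" by auto
    from less_cSupD[OF this assms(3)[unfolded rate_def]] show thesis using that by blast
  qed
  have "\<theta> ^ N \<le> root N (loop s a b N) ^ N" using N assms(2) by (intro power_mono) auto
  also have "\<dots> = loop s a b N"
    using N(1) loop_sum_nonneg by (intro real_root_pow_pos2) auto
  finally have \<theta>N: "\<theta> ^ N \<le> loop s a b N" .
  obtain \<kappa> where \<kappa>: "1 \<le> \<kappa>"
    "\<And>w v. w \<in> lists I \<Longrightarrow> v \<in> lists I \<Longrightarrow> \<psi> s w \<le> \<kappa> ^ length v * \<psi> s (w @ v)"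
    using \<psi>_append[OF assms(1)] by blast
  obtain i where i: "i \<in> I" using I_nonempty by blast
  have step: "total s n \<le> \<kappa> ^ r * total s (n + r)" for n r
  proof -
    let ?v = "replicate r i"
    have v: "?v \<in> lists I" using i by auto
    have "total s n \<le> (\<Sum>w\<in>words_of_length I n. \<kappa> ^ r * \<psi> s (w @ ?v))"
      unfolding total_def using \<kappa>(2)[OF _ v] by (intro sum_mono) (auto simp: words_of_length_lists)
    also have "\<dots> = \<kappa> ^ r * (\<Sum>u\<in>(\<lambda>w. w @ ?v) ` words_of_length I n. \<psi> s u)"
      by (subst sum.reindex) (auto simp: inj_on_def sum_distrib_left)
    also have "\<dots> \<le> \<kappa> ^ r * total s (n + r)"
      unfolding total_def using \<kappa>(1) v \<psi>_nonneg
      by (intro mult_left_mono sum_mono2 finite_words_of_length) (auto simp: words_of_length_lists)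
    finally show ?thesis .
  qed
  \<comment> \<open>Division with remainder by \<open>N\<close>; both constants account for the remainder.\<close>
  define M where "M = max 1 \<theta>"
  have M: "1 \<le> M" "\<theta> \<le> M" unfolding M_def by auto
  define c where "c = 1 / (\<kappa> ^ N * M ^ N)"
  have "c * \<theta> ^ n \<le> total s n" for n
  proof -
    define q r where "q = n div N" and "r = n mod N"
    have n: "n = q * N + r" "r \<le> N" unfolding q_def r_def using N(1) by (auto intro: mod_le_divisor)
    have "\<theta> ^ n = (\<theta> ^ N) ^ q * \<theta> ^ r" unfolding n(1) by (simp add: power_add power_mult mult.commute)
    also have "\<dots> \<le> loop s a b N ^ q * M ^ N"
    proof (intro mult_mono power_mono \<theta>N)
      have "\<theta> ^ r \<le> M ^ r" using M assms(2) by (intro power_mono) auto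
      also have "\<dots> \<le> M ^ N" using M n(2) by (intro power_increasing) auto
      finally show "\<theta> ^ r \<le> M ^ N" .
    qed (use assms(2) loop_sum_nonneg in auto)
    also have "\<dots> \<le> total s (q * N) * M ^ N"
      using order_trans[OF loop_power loop_le_total] M by (intro mult_right_mono) auto
    also have "\<dots> \<le> (\<kappa> ^ r * total s n) * M ^ N"
      using step[of "q * N" r] M n(1) by (intro mult_right_mono) auto
    also have "\<dots> \<le> (\<kappa> ^ N * total s n) * M ^ N"
      using \<kappa>(1) n(2) M total_pos[of s n] by (intro mult_right_mono power_increasing) auto
    finally show ?thesis unfolding c_def using \<kappa>(1) M by (simp add: field_simps)
  qed
  moreover have "0 < c" unfolding c_def using \<kappa>(1) M by simp
  ultimately show ?thesis by blast
qed

lemma total_root_tendsto: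
  assumes "0 \<le> s"
  shows "(\<lambda>n. root n (total s n)) \<longlonglongrightarrow> rate s"
proof -
  obtain C where "0 < C" "\<And>n. 1 \<le> n \<Longrightarrow> total s n \<le> C * rate s ^ n" using total_upper[OF assms] by blast
  then show ?thesis using rate_pos[OF assms] total_lower[OF assms] by (intro root_growth_limit) auto
qed

text \<open>The weights for \<open>s + h\<close> and \<open>s\<close> differ by the \<open>h\<close>-th power of the shortest edge length.\<close>

lemma rate_add:
  assumes "0 \<le> s" "0 \<le> h"
  shows "rate (s + h) \<le> cmax powr h * rate s" "cmin powr h * rate s \<le> rate (s + h)"
proof -
  have bounds: "(cmin powr h) ^ n * total s n \<le> total (s + h) n" "total (s + h) n \<le> (cmax powr h) ^ n * total s n" for n
  proof -
    have "(cmin powr h) ^ n * \<psi> s w \<le> \<psi> (s + h) w \<and> \<psi> (s + h) w \<le> (cmax powr h) ^ n * \<psi> s w"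
      if "w \<in> words_of_length I n" for w
    proof -
      have w: "w \<in> lists I" "length w = n" using that by (auto simp: words_of_length_lists)
      have eq: "(x powr h) ^ n = (x ^ n) powr h" if "0 < x" for x :: real
        using that by (simp add: powr_realpow[symmetric] powr_powr mult.commute)
      have "(cmin powr h) ^ n \<le> len w (m w) powr h" "len w (m w) powr h \<le> (cmax powr h) ^ n"
        unfolding eq[OF cmin_pos] eq[OF cmax_pos]
        using len_bounds[OF w(1), of "m w"] w(2) assms(2) cmin_pos len_pos[OF w(1), of "m w"]
        by (auto intro!: powr_mono2)
      then show ?thesis using \<psi>_pos[OF w(1), of s] by (auto simp: \<psi>_add mult.commute)
    qed
    then show "(cmin powr h) ^ n * total s n \<le> total (s + h) n" "total (s + h) n \<le> (cmax powr h) ^ n * total s n"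
      unfolding total_def sum_distrib_left by (auto intro!: sum_mono)
  qed
  have rt: "root n (x ^ n * y) = x * root n y" if "1 \<le> n" "0 < x" for n x y
    using that by (simp add: real_root_mult real_root_power_cancel)
  have lim: "(\<lambda>n. c * root n (total s n)) \<longlonglongrightarrow> c * rate s" for c
    by (intro tendsto_mult tendsto_const total_root_tendsto assms(1))
  have lim': "(\<lambda>n. root n (total (s + h) n)) \<longlonglongrightarrow> rate (s + h)"
    by (intro total_root_tendsto) (use assms in simp)
  show "rate (s + h) \<le> cmax powr h * rate s"
  proof (rule LIMSEQ_le[OF lim' lim], intro exI[of _ 1] allI impI)
    fix n :: nat assume n: "1 \<le> n"
    have "root n (total (s + h) n) \<le> root n ((cmax powr h) ^ n * total s n)"
      using n bounds(2) by (intro real_root_le_mono) auto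
    then show "root n (total (s + h) n) \<le> cmax powr h * root n (total s n)"
      using rt[OF n, of "cmax powr h"] cmax_pos by simp
  qed
  show "cmin powr h * rate s \<le> rate (s + h)"
  proof (rule LIMSEQ_le[OF lim lim'], intro exI[of _ 1] allI impI)
    fix n :: nat assume n: "1 \<le> n"
    have "root n ((cmin powr h) ^ n * total s n) \<le> root n (total (s + h) n)"
      using n bounds(1) by (intro real_root_le_mono) auto
    then show "cmin powr h * root n (total s n) \<le> root n (total (s + h) n)"
      using rt[OF n, of "cmin powr h"] cmin_pos by simp
  qed
qed

lemma rate_0_ge_2: "2 \<le> rate 0"
proof (rule LIMSEQ_le_const[OF total_root_tendsto[OF order_refl]], intro exI[of _ 1] allI impI)
  fix n :: nat assume n: "1 \<le> n"
  have "real (card (words_of_length I n)) * 1 \<le> total 0 n"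
    unfolding total_def using \<psi>_0_ge_1 by (intro sum_bounded_below) (auto simp: words_of_length_lists)
  moreover have "(2 :: real) ^ n \<le> real (card I) ^ n" using card_I by (intro power_mono) auto
  ultimately have "2 ^ n \<le> total 0 n" by (simp add: card_words_of_length)
  then have "root n (2 ^ n) \<le> root n (total 0 n)" using n by (intro real_root_le_mono) auto
  then show "2 \<le> root n (total 0 n)" using n by (simp add: real_root_power_cancel)
qed

lemma rate_strict_antimono:
  assumes "0 \<le> s" "s < t"
  shows "rate t < rate s"
proof -
  have "rate t \<le> cmax powr (t - s) * rate s" using rate_add(1)[of s "t - s"] assms by simp
  also have "cmax powr (t - s) < 1"
    using cmax_pos cmax_less_1 assms powr_less_mono2[of "t - s" cmax 1] by simp
  then have "cmax powr (t - s) * rate s < rate s" using rate_pos[OF assms(1)] by simp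
  finally show ?thesis .
qed

text \<open>
  The logarithm of the growth rate is positive at 0, Lipschitz continuous, and decreases at
  least linearly.
\<close>

lemma ex_rate_zero: "\<exists>s>0. rate s = 1"
proof -
  have ln_bounds: "ln (rate (s + h)) \<le> ln (rate s) + h * ln cmax" "ln (rate s) + h * ln cmin \<le> ln (rate (s + h))"
    if "0 \<le> s" "0 \<le> h" for s h
  proof -
    have pos: "0 < rate s" "0 < rate (s + h)" using rate_pos that by auto
    have "ln (rate (s + h)) \<le> ln (cmax powr h * rate s)"
      using rate_add(1)[OF that] pos by (intro ln_mono) auto
    then show "ln (rate (s + h)) \<le> ln (rate s) + h * ln cmax"
      using pos cmax_pos by (simp add: ln_mult ln_powr)
    have "ln (cmin powr h * rate s) \<le> ln (rate (s + h))"
      using rate_add(2)[OF that] pos cmin_pos by (intro ln_mono) auto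
    then show "ln (rate s) + h * ln cmin \<le> ln (rate (s + h))"
      using pos cmin_pos by (simp add: ln_mult ln_powr)
  qed
  have neg: "ln cmax < 0" "ln cmin < 0" using cmax_pos cmax_less_1 cmin_pos cmin_less_1 by auto
  have "(- ln cmin)-lipschitz_on {0..} (\<lambda>s. ln (rate s))"
  proof (rule lipschitz_onI)
    have *: "dist (ln (rate s)) (ln (rate t)) \<le> - ln cmin * dist s t" if "0 \<le> s" "s \<le> t" for s t
    proof -
      have "ln (rate t) \<le> ln (rate s) + (t - s) * ln cmax" "ln (rate s) + (t - s) * ln cmin \<le> ln (rate t)"
        using ln_bounds[of s "t - s"] that by auto
      moreover have "(t - s) * ln cmax \<le> 0" using that neg by (simp add: mult_nonneg_nonpos)
      ultimately show ?thesis using that by (simp add: dist_real_def algebra_simps)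
    qed
    fix s t :: real assume "s \<in> {0..}" "t \<in> {0..}"
    then show "dist (ln (rate s)) (ln (rate t)) \<le> - ln cmin * dist s t"
      using *[of s t] *[of t s] by (cases "s \<le> t") (auto simp: dist_commute)
  qed (use neg in simp)
  then have cont: "continuous_on {0..} (\<lambda>s. ln (rate s))" by (rule lipschitz_on_continuous_on)
  define b where "b = ln (rate 0) / (- ln cmax)"
  have r0: "0 < ln (rate 0)" using rate_0_ge_2 by simp
  have b: "0 < b" unfolding b_def using r0 neg by (simp add: divide_pos_neg)
  have "ln (rate b) \<le> ln (rate 0) + b * ln cmax" using ln_bounds(1)[of 0 b] b by simp
  also have "\<dots> = 0" unfolding b_def using neg by simp
  finally have "ln (rate b) \<le> 0" .
  then obtain s where s: "0 \<le> s" "s \<le> b" "ln (rate s) = 0"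
    using IVT2'[of "\<lambda>s. ln (rate s)" b 0 0] r0 b continuous_on_subset[OF cont, of "{0..b}"] by auto
  then have "rate s = 1" using rate_pos[OF s(1)] by simp
  moreover have "s \<noteq> 0" using r0 s(3) by auto
  ultimately show ?thesis using s(1) by (intro exI[of _ s]) auto
qed

definition s0 :: real where "s0 = (THE s. 0 < s \<and> rate s = 1)"

lemma s0: "0 < s0" "rate s0 = 1"
proof -
  have "\<exists>!s. 0 < s \<and> rate s = 1"
    using ex_rate_zero rate_strict_antimono by (metis less_eq_real_def linorder_neqE_linordered_idom order_less_irrefl)
  from theI'[OF this] show "0 < s0" "rate s0 = 1" unfolding s0_def by auto
qed

lemma sums_bounded_above_s0:
  assumes "s0 < s"
  obtains K where "0 < K" "\<And>n. (\<Sum>j\<le>n. total s j) \<le> K"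
proof -
  have s: "0 \<le> s" using assms s0(1) by simp
  have r: "0 < rate s" "rate s < 1" using rate_pos[OF s] rate_strict_antimono[of s0 s] s0 assms by auto
  obtain C where C: "0 < C" "\<And>n. 1 \<le> n \<Longrightarrow> total s n \<le> C * rate s ^ n" using total_upper[OF s] by blast
  define D where "D = max C (total s 0)"
  have D: "0 < D" unfolding D_def using C(1) by simp
  have le: "total s j \<le> D * rate s ^ j" for j
  proof (cases "j = 0")
    case False
    then have "total s j \<le> C * rate s ^ j" by (intro C(2)) simp
    also have "\<dots> \<le> D * rate s ^ j" using r unfolding D_def by (intro mult_right_mono) auto
    finally show ?thesis .
  qed (simp add: D_def)
  have "(\<Sum>j\<le>n. total s j) \<le> D * (1 / (1 - rate s))" for n
  proof -
    have "(\<Sum>j\<le>n. total s j) \<le> D * (\<Sum>j\<le>n. rate s ^ j)"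
      unfolding sum_distrib_left by (intro sum_mono le)
    also have "(\<Sum>j\<le>n. rate s ^ j) \<le> (\<Sum>j. rate s ^ j)"
      using r by (intro sum_le_suminf summable_geometric) auto
    also have "\<dots> = 1 / (1 - rate s)" using r by (intro suminf_geometric) auto
    finally show ?thesis using D by (simp add: mult_left_mono)
  qed
  moreover have "0 < D * (1 / (1 - rate s))" using D r by simp
  ultimately show thesis using that by blast
qed

lemma big_loop_below_s0:
  assumes "0 \<le> s" "s < s0"
  obtains a b N where "1 \<le> N" "1 \<le> loop s a b N"
proof -
  have "1 < rate s" using rate_strict_antimono[OF assms] s0(2) by simp
  moreover have "{root n (loop s a b n) |a b n. 1 \<le> n} \<noteq> {}" by auto
  ultimately obtain a b N where N: "1 \<le> N" "1 < root N (loop s a b N)"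
    using less_cSupD[of "{root n (loop s a b n) |a b n. 1 \<le> n}" 1] unfolding rate_def by blast
  have "1 \<le> root N (loop s a b N) ^ N" using N by (intro one_le_power) auto
  also have "\<dots> = loop s a b N"
    using N(1) loop_sum_nonneg by (intro real_root_pow_pos2) auto
  finally show thesis using N(1) that by blast
qed

end

context sponge
begin

section \<open>The upper bound\<close>

definition qA_axis :: "3 \<Rightarrow> real" where
  "qA_axis k = real_of_ereal (qA_dim (coord_proj {k} ` F))"

definition upper_plane :: "3 \<Rightarrow> real" where
  "upper_plane k = real_of_ereal (upper_box_dim (coord_proj (- {k}) ` F))"

lemma qA_axis_nonneg: "0 \<le> qA_axis k" and upper_plane_nonneg: "0 \<le> upper_plane k"
  unfolding qA_axis_def upper_plane_def
  using qA_dim_bounds(1)[OF bounded_F F_nonempty] box_dim_real(3)[OF bounded_F F_nonempty]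
  by (auto simp: real_of_ereal_pos)

lemma src_Compl: "w \<in> lists I \<Longrightarrow> src w ` (- {k}) = - {src w k}"
  using bij_image_Compl_eq[OF bij_src, of w "{k}"] by simp

lemma qA_axis_src: "w \<in> lists I \<Longrightarrow> qA_axis (src w k) = qA_axis k"
  unfolding qA_axis_def by (simp add: qA_dim_src)

lemma upper_plane_src: "w \<in> lists I \<Longrightarrow> upper_plane (src w k) = upper_plane k"
  unfolding upper_plane_def using box_dim_src(1)[of w "- {k}"] by (simp add: src_Compl)

text \<open>
  Seen from the longest and the middle axis, a cylinder is a copy of the projection of \<open>F\<close> to a
  plane, stretched by different factors. Cut that projection into pieces whose images have
  size \<open>len w m\<close> along the middle axis. Along the longest axis the images of the pieces are
  longer than that, and the quasi-Assouad dimension tells how many parts they need.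
\<close>

lemma cov_cyl_fibred:
  assumes w: "w \<in> lists I" and axes: "l \<noteq> n" "n \<noteq> m" "l \<noteq> m" "UNIV = {l, n, m}"
    and R: "0 < R" "len w n * R \<le> len w m" and r: "0 < r" "len w l * r \<le> len w m"
    and N: "\<And>x. x \<in> F \<Longrightarrow> real (cov {src w l} r (slab (src w l) x R F)) \<le> N" and N0: "0 \<le> N"
  shows "real (cov UNIV (len w m) (cyl w)) \<le> real (cov (- {src w m}) R F) * N"
proof -
  have src_ne: "src w l \<noteq> src w m" "src w n \<noteq> src w m" using bij_src[OF w] axes by (auto dest!: bij_is_inj injD)
  obtain \<C> where C: "finite \<C>" "\<forall>B\<in>\<C>. thin (- {src w m}) R B" "F \<subseteq> \<Union>\<C>" "card \<C> = cov (- {src w m}) R F"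
    using cov_obtain[OF bounded_F R(1)] by blast
  have piece: "real (cov UNIV (len w m) (word_map S w ` (B \<inter> F))) \<le> N" if B: "B \<in> \<C>" for B
  proof (cases "B \<inter> F = {}")
    case True
    have "cov UNIV (len w m) {} \<le> card ({} :: (real^3) set set)" by (rule cov_le) auto
    then show ?thesis using True N0 by simp
  next
    case False
    then obtain x where x: "x \<in> B" "x \<in> F" by blast
    have thinB: "\<bar>y $ k - z $ k\<bar> \<le> R" if "y \<in> B" "z \<in> B" "k \<noteq> src w m" for y z k
      using C(2) B that unfolding thin_def by blast
    have "cov UNIV (len w m) (word_map S w ` (B \<inter> F)) \<le> cov {src w l} r (slab (src w l) x R F)"
    proof (rule cov_transfer[where h = "inv_into (B \<inter> F) (word_map S w)"])
      show "bounded (slab (src w l) x R F)" by (rule bounded_slab[OF bounded_F])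
      let ?h = "inv_into (B \<inter> F) (word_map S w)"
      have h: "?h y \<in> B" "?h y \<in> F" "word_map S w (?h y) = y" if "y \<in> word_map S w ` (B \<inter> F)" for y
        using inv_into_into[OF that] f_inv_into_f[OF that] by auto
      show "?h ` (word_map S w ` (B \<inter> F)) \<subseteq> slab (src w l) x R F"
        using h thinB[OF _ x(1) src_ne(1)] unfolding slab_def by blast
      fix y z k assume yz: "y \<in> word_map S w ` (B \<inter> F)" "z \<in> word_map S w ` (B \<inter> F)"
        and "\<forall>k\<in>{src w l}. \<bar>?h y $ k - ?h z $ k\<bar> \<le> r"
      then have l: "\<bar>?h y $ src w l - ?h z $ src w l\<bar> \<le> r" by simp
      have eq: "\<bar>y $ k - z $ k\<bar> = len w k * \<bar>?h y $ src w k - ?h z $ src w k\<bar>"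
        using word_map_diff_nth[OF w, of "?h y" k "?h z"] h(3)[OF yz(1)] h(3)[OF yz(2)] by simp
      have "k = l \<or> k = n \<or> k = m" using axes(4) by auto
      then have "len w k * \<bar>?h y $ src w k - ?h z $ src w k\<bar> \<le> len w m"
      proof (elim disjE)
        assume "k = l"
        then show ?thesis
          using order_trans[OF mult_left_mono[OF l] r(2)] len_pos[OF w, of l] by (simp add: less_imp_le)
      next
        assume "k = n"
        then show ?thesis
          using order_trans[OF mult_left_mono[OF thinB[OF h(1)[OF yz(1)] h(1)[OF yz(2)] src_ne(2)]] R(2)]
            len_pos[OF w, of n] by (simp add: less_imp_le)
      next
        assume "k = m"
        then show ?thesis
          using mult_left_mono[OF abs_diff_F_le_1[OF h(2)[OF yz(1)] h(2)[OF yz(2)], of "src w m"], of "len w m"]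
            len_pos[OF w, of m] by simp
      qed
      then show "\<bar>y $ k - z $ k\<bar> \<le> len w m" using eq by simp
    qed (rule r(1))
    then show ?thesis using N[OF x(2)] by (meson of_nat_mono order_trans)
  qed
  have "cov UNIV (len w m) (cyl w) \<le> (\<Sum>B\<in>\<C>. cov UNIV (len w m) (word_map S w ` (B \<inter> F)))"
  proof (rule cov_UN_le[OF C(1) len_pos[OF w]])
    show "bounded (word_map S w ` (B \<inter> F))" for B
      using bounded_cyl[OF w] by (rule bounded_subset) (auto simp: cyl_def)
    show "cyl w \<subseteq> (\<Union>B\<in>\<C>. word_map S w ` (B \<inter> F))"
      using C(3) unfolding cyl_def by blast
  qed
  then have "real (cov UNIV (len w m) (cyl w)) \<le> real (\<Sum>B\<in>\<C>. cov UNIV (len w m) (word_map S w ` (B \<inter> F)))"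
    by (rule of_nat_mono)
  also have "\<dots> = (\<Sum>B\<in>\<C>. real (cov UNIV (len w m) (word_map S w ` (B \<inter> F))))" by simp
  also have "\<dots> \<le> real (card \<C>) * N" using piece by (rule sum_bounded_above)
  finally show ?thesis using C(4) by simp
qed

text \<open>There are only three axes, so constants can be chosen independently of the axis.\<close>

lemma ex_uniform_bound:
  fixes Q :: "3 \<Rightarrow> real \<Rightarrow> bool"
  assumes "\<And>k. \<exists>C>0. Q k C" "\<And>k C C'. Q k C \<Longrightarrow> C \<le> C' \<Longrightarrow> Q k C'"
  obtains C where "0 < C" "\<And>k. Q k C"
proof -
  obtain c where c: "\<And>k. 0 < c k" "\<And>k. Q k (c k)" using assms(1) by metis
  have "c k \<le> (\<Sum>k\<in>UNIV. c k)" for k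
    using c(1) by (intro member_le_sum) (auto intro: less_imp_le)
  then have "Q k (\<Sum>k\<in>UNIV. c k)" for k using assms(2) c(2) by blast
  moreover have "0 < (\<Sum>k\<in>UNIV. c k)" using c(1) by (intro sum_pos) auto
  ultimately show thesis using that by blast
qed

text \<open>
  The permutations relate the axes of the cylinder to other axes of \<open>F\<close>, but dimensions are
  constant on orbits.
\<close>

lemma cov_cyl_upper:
  assumes "0 < e"
  obtains C where "0 < C" "\<And>w l m. w \<in> lists I \<Longrightarrow> chamber w l m \<Longrightarrow>
    real (cov UNIV (len w m) (cyl w)) \<le> C * len w m powr (- e) * wt qA_axis upper_plane 0 w l m"
proof -
  define \<epsilon> where "\<epsilon> = e / 2"
  have \<epsilon>: "0 < \<epsilon>" unfolding \<epsilon>_def using assms by simp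
  obtain C1 where C1: "0 < C1" "\<And>k. \<forall>r R x. x \<in> F \<longrightarrow> 0 < r \<longrightarrow> r \<le> 2 * R \<longrightarrow> R \<le> 1/2 \<longrightarrow>
    real (cov {k} r (slab k x R F)) \<le> C1 * (r powr (- \<epsilon>) * (R / r) powr qA_axis k)"
  proof (rule ex_uniform_bound[of "\<lambda>k C. \<forall>r R x. x \<in> F \<longrightarrow> 0 < r \<longrightarrow> r \<le> 2 * R \<longrightarrow> R \<le> 1/2 \<longrightarrow>
    real (cov {k} r (slab k x R F)) \<le> C * (r powr (- \<epsilon>) * (R / r) powr qA_axis k)"])
    show "\<exists>C>0. \<forall>r R x. x \<in> F \<longrightarrow> 0 < r \<longrightarrow> r \<le> 2 * R \<longrightarrow> R \<le> 1/2 \<longrightarrow>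
      real (cov {k} r (slab k x R F)) \<le> C * (r powr (- \<epsilon>) * (R / r) powr qA_axis k)" for k
      using qA_dim_cov_bound[OF bounded_F F_nonempty \<epsilon>, of k] unfolding qA_axis_def[symmetric]
      by (metis mult.assoc)
    fix k and C C' :: real assume h: "\<forall>r R x. x \<in> F \<longrightarrow> 0 < r \<longrightarrow> r \<le> 2 * R \<longrightarrow> R \<le> 1/2 \<longrightarrow>
      real (cov {k} r (slab k x R F)) \<le> C * (r powr (- \<epsilon>) * (R / r) powr qA_axis k)" and "C \<le> C'"
    then have "C * (r powr (- \<epsilon>) * (R / r) powr qA_axis k) \<le> C' * (r powr (- \<epsilon>) * (R / r) powr qA_axis k)" for r R
      by (intro mult_right_mono) auto
    then show "\<forall>r R x. x \<in> F \<longrightarrow> 0 < r \<longrightarrow> r \<le> 2 * R \<longrightarrow> R \<le> 1/2 \<longrightarrow>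
      real (cov {k} r (slab k x R F)) \<le> C' * (r powr (- \<epsilon>) * (R / r) powr qA_axis k)"
      using h by (meson order_trans)
  qed blast
  obtain C2 where C2: "0 < C2" "\<And>k. \<forall>R. 0 < R \<longrightarrow> R \<le> 1 \<longrightarrow>
    real (cov (- {k}) R F) \<le> C2 * R powr (- (upper_plane k + \<epsilon>))"
  proof (rule ex_uniform_bound[of "\<lambda>k C. \<forall>R. 0 < R \<longrightarrow> R \<le> 1 \<longrightarrow>
    real (cov (- {k}) R F) \<le> C * R powr (- (upper_plane k + \<epsilon>))"])
    fix k
    have "upper_box_dim (coord_proj (- {k}) ` F) = ereal (upper_plane k)"
      unfolding upper_plane_def using box_dim_real(1)[OF bounded_F F_nonempty] by simp
    then have "upper_box_dim (coord_proj (- {k}) ` F) < ereal (upper_plane k + \<epsilon>)" using \<epsilon> by simp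
    from upper_box_dim_bound[OF bounded_F F_nonempty this]
    show "\<exists>C>0. \<forall>R. 0 < R \<longrightarrow> R \<le> 1 \<longrightarrow> real (cov (- {k}) R F) \<le> C * R powr (- (upper_plane k + \<epsilon>))"
      using upper_plane_nonneg[of k] \<epsilon> by (metis add_nonneg_nonneg less_imp_le)
  next
    fix k and C C' :: real assume h: "\<forall>R. 0 < R \<longrightarrow> R \<le> 1 \<longrightarrow> real (cov (- {k}) R F) \<le> C * R powr (- (upper_plane k + \<epsilon>))"
      and "C \<le> C'"
    then have "C * R powr (- (upper_plane k + \<epsilon>)) \<le> C' * R powr (- (upper_plane k + \<epsilon>))" for R
      by (intro mult_right_mono) auto
    then show "\<forall>R. 0 < R \<longrightarrow> R \<le> 1 \<longrightarrow> real (cov (- {k}) R F) \<le> C' * R powr (- (upper_plane k + \<epsilon>))"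
      using h by (meson order_trans)
  qed blast
  define P where "P = (\<Sum>k\<in>UNIV. upper_plane k)"
  have P: "upper_plane k \<le> P" for k
    unfolding P_def using upper_plane_nonneg by (intro member_le_sum) auto
  define C where "C = C2 * C1 * 2 powr (P + \<epsilon>)"
  have "real (cov UNIV (len w m) (cyl w)) \<le> C * len w m powr (- e) * wt qA_axis upper_plane 0 w l m"
    if w: "w \<in> lists I" and ch: "chamber w l m" for w l m
  proof -
    obtain l' n m' where a: "l' \<noteq> n" "n \<noteq> m'" "l' \<noteq> m'" "UNIV = {l', n, m'}" and ch': "chamber w l' m'"
      by (rule ex_chamber[of w]) blast
    have lenm: "len w m = len w m'" using ch ch' unfolding chamber_def by (auto intro: antisym)
    let ?x = "len w l'" and ?y = "len w n" and ?z = "len w m'"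
    have pos: "0 < ?x" "0 < ?y" "0 < ?z" using len_pos[OF w] by auto
    have ord: "?z \<le> ?y" "?y \<le> ?x" "?x \<le> 1" using ch' len_le_1[OF w] unfolding chamber_def by auto
    \<comment> \<open>The factor 2 makes \<open>R \<le> 1/2\<close> even if the two shorter edges have the same length.\<close>
    define R where "R = ?z / (2 * ?y)"
    define r where "r = ?z / ?x"
    have R: "0 < R" "R \<le> 1/2" "?y * R \<le> ?z" unfolding R_def using pos ord by (auto simp: field_simps)
    have r: "0 < r" "?x * r \<le> ?z" "r \<le> 2 * R" unfolding r_def R_def using pos ord by (auto simp: field_simps)
    have Rr: "R / r = (?x / ?y) / 2" unfolding R_def r_def using pos by (simp add: field_simps)
    have "real (cov UNIV ?z (cyl w)) \<le> real (cov (- {src w m'}) R F) * (C1 * (r powr (- \<epsilon>) * (R / r) powr qA_axis (src w l')))"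
      using C1 r R by (intro cov_cyl_fibred[OF w a R(1,3) r(1,2)]) auto
    also have "\<dots> \<le> (C2 * R powr (- (upper_plane (src w m') + \<epsilon>))) * (C1 * (r powr (- \<epsilon>) * (R / r) powr qA_axis (src w l')))"
      using C1(1) C2(2) R by (intro mult_right_mono) auto
    also have "\<dots> = C2 * C1 * (R powr (- upper_plane m' - \<epsilon>)) * r powr (- \<epsilon>) * (R / r) powr qA_axis l'"
      using w by (simp add: qA_axis_src upper_plane_src)
    also have "\<dots> \<le> C2 * C1 * (2 powr (P + \<epsilon>) * (?y / ?z) powr upper_plane m' * ?z powr (- \<epsilon>)) * ?z powr (- \<epsilon>) * (?x / ?y) powr qA_axis l'"
    proof (intro mult_mono mult_nonneg_nonneg)
      have "R powr (- upper_plane m' - \<epsilon>) = (1 / R) powr upper_plane m' * (1 / R) powr \<epsilon>"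
        using R(1) by (simp add: powr_divide powr_diff powr_minus field_simps)
      also have "(1 / R) powr upper_plane m' = 2 powr upper_plane m' * (?y / ?z) powr upper_plane m'"
        unfolding R_def using pos by (subst powr_mult[symmetric]) (simp_all add: field_simps)
      also have "2 powr upper_plane m' * (?y / ?z) powr upper_plane m' * (1 / R) powr \<epsilon> \<le>
        2 powr P * (?y / ?z) powr upper_plane m' * (2 powr \<epsilon> * ?z powr (- \<epsilon>))"
      proof (intro mult_mono mult_nonneg_nonneg)
        show "2 powr upper_plane m' \<le> 2 powr P" using P by simp
        have "1 / R \<le> 2 * (1 / ?z)" unfolding R_def using pos ord by (simp add: field_simps)
        then have "(1 / R) powr \<epsilon> \<le> (2 * (1 / ?z)) powr \<epsilon>" using R(1) \<epsilon> by (intro powr_mono2) auto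
        also have "\<dots> = 2 powr \<epsilon> * ?z powr (- \<epsilon>)"
          using pos by (subst powr_mult) (simp_all add: powr_divide powr_minus_divide)
        finally show "(1 / R) powr \<epsilon> \<le> 2 powr \<epsilon> * ?z powr (- \<epsilon>)" .
      qed auto
      finally show "R powr (- upper_plane m' - \<epsilon>) \<le> 2 powr (P + \<epsilon>) * (?y / ?z) powr upper_plane m' * ?z powr (- \<epsilon>)"
        by (simp add: powr_add ac_simps)
      have "?z \<le> r" unfolding r_def using pos ord by (simp add: field_simps)
      then show "r powr (- \<epsilon>) \<le> ?z powr (- \<epsilon>)" using pos \<epsilon> by (intro powr_mono2') auto
      show "(R / r) powr qA_axis l' \<le> (?x / ?y) powr qA_axis l'"
      proof -
        have "q / 2 \<le> q" if "0 < q" for q :: real using that by simp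
        then have "(?x / ?y) / 2 \<le> ?x / ?y" using divide_pos_pos[OF pos(1,2)] by blast
        then show ?thesis unfolding Rr using pos qA_axis_nonneg by (intro powr_mono2) auto
      qed
    qed (use C1(1) C2(1) in auto)
    also have "\<dots> = C * (?z powr (- \<epsilon>) * ?z powr (- \<epsilon>)) * ((?x / ?y) powr qA_axis l' * (?y / ?z) powr upper_plane m')"
      unfolding C_def by (simp add: ac_simps)
    also have "?z powr (- \<epsilon>) * ?z powr (- \<epsilon>) = ?z powr (- e)"
      by (simp add: powr_add[symmetric] \<epsilon>_def)
    also have "(?x / ?y) powr qA_axis l' * (?y / ?z) powr upper_plane m' = wt qA_axis upper_plane 0 w l' m'"
      unfolding wt_def using mid_eq[OF w a(1)[symmetric] a(2) a(4) a(3)] pos by simp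
    also have "\<dots> = wt qA_axis upper_plane 0 w l m" by (rule wt_chamber_cong[OF w ch' ch])
    finally show ?thesis using lenm by simp
  qed
  moreover have "0 < C" unfolding C_def using C1(1) C2(1) by simp
  ultimately show thesis using that by blast
qed

end

context sponge_weights
begin

text \<open>
  The cylinders whose shortest edge is comparable to \<open>\<delta>\<close> cover \<open>F\<close>. Adding up their covering
  numbers gives \<open>\<delta>\<^bsup>-s\<^esup>\<close> times a sum of weights \<open>\<psi> s w\<close>, and for \<open>s > s0\<close> all such sums are
  bounded by the sum over all words.
\<close>

lemma upper_box_dim_le_s0:
  assumes "\<And>e. 0 < e \<Longrightarrow> \<exists>C>0. \<forall>w\<in>lists I. real (cov UNIV (len w (m w)) (cyl w)) \<le> C * len w (m w) powr (- e) * \<psi> 0 w"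
  shows "upper_box_dim F \<le> ereal s0"
proof (rule ereal_le_epsilon2)
  fix e' :: real assume e': "0 < e'"
  define e where "e = e' / 2"
  have e: "0 < e" unfolding e_def using e' by simp
  define s where "s = s0 + e"
  have s: "s0 < s" "0 \<le> s" unfolding s_def using e s0(1) by auto
  obtain C where C: "0 < C" "\<And>w. w \<in> lists I \<Longrightarrow> real (cov UNIV (len w (m w)) (cyl w)) \<le> C * len w (m w) powr (- e) * \<psi> 0 w"
    using assms[OF e] by blast
  obtain K where K: "0 < K" "\<And>n. (\<Sum>j\<le>n. total s j) \<le> K" using sums_bounded_above_s0[OF s(1)] by blast
  define C' where "C' = C * cmin powr (- (s + e)) * K"
  have C': "0 < C'" unfolding C'_def using C(1) K(1) cmin_pos by simp
  have "real (cov UNIV \<delta> F) \<le> C' * \<delta> powr (- (s + e))" if \<delta>: "0 < \<delta>" "\<delta> < 1" for \<delta>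
  proof -
    define \<mu> where "\<mu> w = len w (m w)" for w
    define T where "T = {w \<in> lists I. cmin * \<delta> \<le> \<mu> w \<and> \<mu> w \<le> \<delta>}"
    obtain n where n: "cmax ^ n < cmin * \<delta>"
      using real_arch_pow_inv[of "cmin * \<delta>" cmax] \<delta> cmin_pos cmax_less_1 by auto
    have T_sub: "T \<subseteq> (\<Union>j\<le>n. words_of_length I j)"
    proof
      fix w assume w: "w \<in> T"
      then have "cmax ^ n < cmax ^ length w"
        using n len_bounds(2)[of w "m w"] unfolding T_def \<mu>_def by auto
      then have "length w < n" using cmax_pos cmax_less_1 by simp
      then show "w \<in> (\<Union>j\<le>n. words_of_length I j)"
        using w unfolding T_def by (auto simp: words_of_length_lists)
    qed
    have fin: "finite (\<Union>j\<le>n. words_of_length I j)" using finite_words_of_length by auto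
    have finT: "finite T" using T_sub fin by (rule finite_subset)
    have "F \<subseteq> (\<Union>w\<in>T. cyl w)"
    proof
      fix x assume x: "x \<in> F"
      have "cmin * \<mu> w \<le> \<mu> (w @ [i])" if "w \<in> lists I" "i \<in> I" for w i
      proof -
        have "cmin * \<mu> w \<le> cmin * len w (m (w @ [i]))"
          unfolding \<mu>_def using chamber_lm[OF that(1)] cmin_pos unfolding chamber_def by simp
        also have "\<dots> \<le> \<mu> (w @ [i])" unfolding \<mu>_def by (rule len_snoc_bounds(1)[OF that])
        finally show ?thesis .
      qed
      moreover have "\<mu> w \<le> cmax ^ length w" if "w \<in> lists I" for w
        unfolding \<mu>_def by (rule len_bounds(2)[OF that])
      moreover have "\<mu> [] = 1" unfolding \<mu>_def by simp
      ultimately obtain w where "w \<in> lists I" "x \<in> cyl w" "cmin * \<delta> \<le> \<mu> w" "\<mu> w \<le> \<delta>"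
        using stopping_word[of \<mu> x \<delta>] x \<delta>(1) less_imp_le[OF \<delta>(2)] by blast
      then show "x \<in> (\<Union>w\<in>T. cyl w)" unfolding T_def by blast
    qed
    then have "cov UNIV \<delta> F \<le> (\<Sum>w\<in>T. cov UNIV \<delta> (cyl w))"
      using bounded_cyl by (intro cov_UN_le[OF finT \<delta>(1)]) (auto simp: T_def)
    then have "real (cov UNIV \<delta> F) \<le> real (\<Sum>w\<in>T. cov UNIV \<delta> (cyl w))" by (rule of_nat_mono)
    also have "\<dots> = (\<Sum>w\<in>T. real (cov UNIV \<delta> (cyl w)))" by simp
    also have "\<dots> \<le> (\<Sum>w\<in>T. C * (cmin * \<delta>) powr (- (s + e)) * \<psi> s w)"
    proof (rule sum_mono)
      fix w assume "w \<in> T"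
      then have w: "w \<in> lists I" "cmin * \<delta> \<le> \<mu> w" "\<mu> w \<le> \<delta>" unfolding T_def by auto
      have \<mu>pos: "0 < \<mu> w" unfolding \<mu>_def by (rule len_pos[OF w(1)])
      have "cov UNIV \<delta> (cyl w) \<le> cov UNIV (\<mu> w) (cyl w)"
        using w \<mu>pos bounded_cyl by (intro cov_mono) auto
      then have "real (cov UNIV \<delta> (cyl w)) \<le> C * \<mu> w powr (- e) * \<psi> 0 w"
        using C(2)[OF w(1)] unfolding \<mu>_def by linarith
      also have "\<psi> 0 w = \<mu> w powr (- s) * \<psi> s w"
        using \<psi>_add[of 0 s w] \<mu>pos unfolding \<mu>_def by (simp add: powr_minus field_simps)
      also have "C * \<mu> w powr (- e) * (\<mu> w powr (- s) * \<psi> s w) = C * \<mu> w powr (- (s + e)) * \<psi> s w"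
        by (simp add: powr_add[symmetric] ac_simps)
      also have "\<dots> \<le> C * (cmin * \<delta>) powr (- (s + e)) * \<psi> s w"
        using w C(1) \<psi>_nonneg[OF w(1)] cmin_pos \<delta> s e
        by (intro mult_right_mono mult_left_mono powr_mono2') auto
      finally show "real (cov UNIV \<delta> (cyl w)) \<le> C * (cmin * \<delta>) powr (- (s + e)) * \<psi> s w" .
    qed
    also have "\<dots> = C * (cmin * \<delta>) powr (- (s + e)) * (\<Sum>w\<in>T. \<psi> s w)" by (simp add: sum_distrib_left)
    also have "\<dots> \<le> C * (cmin * \<delta>) powr (- (s + e)) * K"
    proof (rule mult_left_mono)
      have "(\<Sum>w\<in>T. \<psi> s w) \<le> (\<Sum>w\<in>(\<Union>j\<le>n. words_of_length I j). \<psi> s w)"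
        using \<psi>_nonneg by (intro sum_mono2[OF fin T_sub]) (auto simp: words_of_length_lists)
      also have "\<dots> = (\<Sum>j\<le>n. total s j)"
        unfolding total_def using finite_words_of_length
        by (intro sum.UNION_disjoint) (auto simp: words_of_length_def)
      also have "\<dots> \<le> K" by (rule K(2))
      finally show "(\<Sum>w\<in>T. \<psi> s w) \<le> K" .
    qed (use C(1) in simp)
    also have "\<dots> = C' * \<delta> powr (- (s + e))"
      unfolding C'_def using cmin_pos \<delta> by (subst powr_mult) (simp_all add: ac_simps)
    finally show ?thesis .
  qed
  then have "upper_box_dim (coord_proj UNIV ` F) \<le> ereal (s + e)"
    using C' by (intro upper_box_dim_le[OF bounded_F F_nonempty, of C']) auto
  also have "s + e = s0 + e'" unfolding s_def e_def by simp
  finally show "upper_box_dim F \<le> ereal s0 + ereal e'" by (simp add: coord_proj_UNIV)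
qed

end

context sponge
begin

section \<open>Disjoint cuboids\<close>

lemma bij_S: "i \<in> I \<Longrightarrow> bij (S i)"
proof -
  assume i: "i \<in> I"
  let ?A = "linear_part (S i)"
  have S_eq: "S i x = ?A *v x + S i 0" for x
    using S_diff[OF i, of x 0] by (simp add: algebra_simps)
  have inj: "inj (S i)"
  proof (rule injI)
    fix x y assume "S i x = S i y"
    then have "\<bar>x $ src1 i k - y $ src1 i k\<bar> = 0" for k
      using abs_S_diff_nth[OF i, of x k y] len1_pos[OF i, of k] by simp
    moreover have "\<exists>k. j = src1 i k" for j using bij_src1[OF i] by (meson bij_pointE)
    ultimately have "x $ j = y $ j" for j by (metis abs_eq_0 right_minus_eq)
    then show "x = y" by (simp add: vec_eq_iff)
  qed
  then have "inj ((*v) ?A)" unfolding inj_def by (metis S_eq)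
  then have "surj ((*v) ?A)" by (intro linear_injective_imp_surjective) auto
  then have "surj (S i)" unfolding surj_def by (metis S_eq diff_add_cancel)
  with inj show ?thesis by (rule bijI)
qed

lemma bij_word_map: "w \<in> lists I \<Longrightarrow> bij (word_map S w)"
proof (induction w)
  case Nil
  show ?case by (simp only: word_map_Nil bij_id)
next
  case (Cons i w)
  then show ?case unfolding word_map_Cons by (intro bij_comp bij_S) auto
qed

definition osc_box :: "real^3 \<Rightarrow> real^3 \<Rightarrow> bool" where
  "osc_box u v \<longleftrightarrow> box u v \<noteq> {} \<and> (\<forall>i\<in>I. S i ` box u v \<subseteq> box u v) \<and>
     disjoint_family_on (\<lambda>i. S i ` box u v) I"

lemma word_map_box_subset:
  assumes "osc_box u v" "w \<in> lists I"
  shows "word_map S w ` box u v \<subseteq> box u v"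
  using assms(2)
proof (induction w)
  case (Cons i w)
  then have "word_map S (i # w) ` box u v \<subseteq> S i ` box u v" by auto
  moreover have "i \<in> I" using Cons by auto
  then have "S i ` box u v \<subseteq> box u v" using assms(1) unfolding osc_box_def by blast
  ultimately show ?case by (rule order_trans)
qed simp

lemma word_map_box_disjoint:
  assumes "osc_box u v" "w \<in> lists I" "w' \<in> lists I" "length w = length w'" "w \<noteq> w'"
  shows "word_map S w ` box u v \<inter> word_map S w' ` box u v = {}"
  using assms(4,2,3,5)
proof (induction w w' rule: list_induct2)
  case (Cons i w j w')
  then have ij: "i \<in> I" "j \<in> I" "w \<in> lists I" "w' \<in> lists I" by auto
  have im: "word_map S (i # w) ` box u v = S i ` (word_map S w ` box u v)" for i w
    by (simp add: image_comp)
  show ?case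
  proof (cases "i = j")
    case True
    then have "w \<noteq> w'" using Cons.prems by simp
    then have "word_map S w ` box u v \<inter> word_map S w' ` box u v = {}" using Cons.IH ij by blast
    then show ?thesis
      unfolding im True using bij_is_inj[OF bij_S[OF ij(2)]] by (simp add: image_Int[symmetric])
  next
    case False
    then have "S i ` box u v \<inter> S j ` box u v = {}"
      using assms(1) ij unfolding osc_box_def disjoint_family_on_def by blast
    then show ?thesis
      unfolding im using word_map_box_subset[OF assms(1)] ij by blast
  qed
qed simp

lemma F_subset_closed_box:
  assumes "osc_box u v"
  shows "F \<subseteq> cbox u v"
proof (rule attractor_subset)
  have ne: "box u v \<noteq> {}" using assms unfolding osc_box_def by blast
  have cl: "closure (box u v) = cbox u v" using ne by (rule closure_box)
  show "cbox u v \<noteq> {}" using ne box_subset_cbox[of u v] by blast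
  fix i assume i: "i \<in> I"
  obtain c where c: "c-lipschitz_on UNIV (S i)"
    using ifs i unfolding sponge_ifs_def by blast
  have "continuous_on (closure (box u v)) (S i)"
    using lipschitz_on_continuous_on[OF c] by (rule continuous_on_subset) simp
  then have "S i ` closure (box u v) \<subseteq> cbox u v"
    using assms i box_subset_cbox[of u v] unfolding osc_box_def
    by (intro image_closure_subset) auto
  then show "S i ` cbox u v \<subseteq> cbox u v" unfolding cl .
qed (rule closed_cbox)

text \<open>
  A set of diameter \<open>\<delta>\<close> meets boundedly many cylinders whose cuboids are disjoint and have edges
  of length at least \<open>\<delta>\<close>: starting at a point in the intersection, move into the cuboid by a
  distance of order \<open>\<delta>\<close> to find a point whose \<open>\<delta>\<close>-neighbourhood, up to a constant, belongs to
  this cuboid only.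
\<close>

lemma inner_point:
  assumes uv: "osc_box u v" and w: "w \<in> lists I" and \<delta>: "0 < \<delta>" "\<And>k. \<delta> \<le> len w k" and p: "p \<in> cyl w"
    and h: "\<And>k. h \<le> (v $ k - u $ k) / 2" "0 < h"
  obtains q where "q \<in> word_map S w ` box u v" "\<And>k. \<exists>j. \<bar>q $ k - p $ k\<bar> \<le> \<delta> * (v $ j - u $ j)"
    "\<And>x. (\<And>k. \<bar>x $ k - q $ k\<bar> < \<delta> * h) \<Longrightarrow> x \<in> word_map S w ` box u v"
proof -
  obtain y where y: "y \<in> F" "p = word_map S w y" using p unfolding cyl_def by blast
  then have "y \<in> cbox u v" using F_subset_closed_box[OF uv] by blast
  then have yb: "u $ j \<le> y $ j" "y $ j \<le> v $ j" for j by (auto simp: mem_box_cart)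
  define g where "g = inv_into UNIV (src w)"
  have g: "src w (g j) = j" "g (src w k) = k" for j k
    using bij_src[OF w] unfolding g_def
    by (auto intro!: f_inv_into_f inv_into_f_f simp: bij_is_surj bij_is_inj)
  \<comment> \<open>The fraction of the way to the centre: in the image, a step of length of order \<open>\<delta>\<close> along every axis.\<close>
  define \<tau> where "\<tau> j = \<delta> / len w (g j)" for j
  have \<tau>: "0 < \<tau> j" "\<tau> j \<le> 1" for j
    unfolding \<tau>_def using \<delta> len_pos[OF w] by auto
  define c where "c j = (u $ j + v $ j) / 2" for j
  define H where "H j = (v $ j - u $ j) / 2" for j
  have H: "h \<le> H j" "0 < H j" for j using h(1)[of j] h(2) unfolding H_def by auto
  have yc: "\<bar>c j - y $ j\<bar> \<le> H j" for j unfolding c_def H_def using yb[of j] by (simp add: abs_le_iff field_simps)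
  define z where "z = (\<chi> j. y $ j + \<tau> j * (c j - y $ j))"
  have zc: "\<bar>z $ j - c j\<bar> \<le> (1 - \<tau> j) * H j" for j
  proof -
    have "z $ j - c j = - ((1 - \<tau> j) * (c j - y $ j))" unfolding z_def by (simp add: algebra_simps)
    then have "\<bar>z $ j - c j\<bar> = (1 - \<tau> j) * \<bar>c j - y $ j\<bar>" using \<tau>(2)[of j] by (simp add: abs_mult)
    then show ?thesis using yc[of j] \<tau>(2)[of j] by (simp add: mult_left_mono)
  qed
  have in_box: "t \<in> box u v" if "\<And>j. \<bar>t $ j - z $ j\<bar> < \<tau> j * H j" for t :: "real^3"
    unfolding mem_box_cart
  proof
    fix j
    have "\<bar>t $ j - c j\<bar> < \<tau> j * H j + (1 - \<tau> j) * H j" using that[of j] zc[of j] by linarith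
    also have "\<dots> = H j" by (simp add: algebra_simps)
    finally have "\<bar>t $ j - c j\<bar> < H j" .
    moreover have "c j + H j = v $ j" "c j - H j = u $ j" unfolding c_def H_def by (simp_all add: field_simps)
    ultimately show "u $ j < t $ j \<and> t $ j < v $ j" by linarith
  qed
  show thesis
  proof (rule that[of "word_map S w z"])
    show "word_map S w z \<in> word_map S w ` box u v"
      using in_box[of z] \<tau> H by (intro imageI) simp
    show "\<exists>j. \<bar>word_map S w z $ k - p $ k\<bar> \<le> \<delta> * (v $ j - u $ j)" for k
    proof
      let ?j = "src w k"
      have "\<bar>word_map S w z $ k - p $ k\<bar> = len w k * (\<tau> ?j * \<bar>c ?j - y $ ?j\<bar>)"
        unfolding y(2) word_map_diff_nth[OF w] using \<tau>(1)[of ?j] by (simp add: z_def abs_mult)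
      also have "\<dots> = \<delta> * \<bar>c ?j - y $ ?j\<bar>" unfolding \<tau>_def g(2) using len_pos[OF w, of k] by simp
      also have "\<dots> \<le> \<delta> * (v $ ?j - u $ ?j)"
        using yc[of ?j] H(2)[of ?j] \<delta>(1) unfolding H_def by (intro mult_left_mono) auto
      finally show "\<bar>word_map S w z $ k - p $ k\<bar> \<le> \<delta> * (v $ ?j - u $ ?j)" .
    qed
    fix x assume x: "\<And>k. \<bar>x $ k - word_map S w z $ k\<bar> < \<delta> * h"
    obtain t where t: "x = word_map S w t" using bij_word_map[OF w] by (meson bij_pointE)
    have "t \<in> box u v"
    proof (rule in_box)
      fix j
      have "len w (g j) * \<bar>t $ j - z $ j\<bar> < \<delta> * h"
        using x[of "g j"] unfolding t word_map_diff_nth[OF w] g by simp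
      then have "\<bar>t $ j - z $ j\<bar> < \<tau> j * h"
        unfolding \<tau>_def using len_pos[OF w, of "g j"] by (simp add: field_simps)
      also have "\<dots> \<le> \<tau> j * H j" using H \<tau>(1)[of j] by (simp add: mult_left_mono)
      finally show "\<bar>t $ j - z $ j\<bar> < \<tau> j * H j" .
    qed
    then show "x \<in> word_map S w ` box u v" unfolding t by (rule imageI)
  qed
qed

lemma osc_multiplicity:
  assumes uv: "osc_box u v"
  obtains M :: nat where "0 < M" "\<And>T B \<delta>. finite T \<Longrightarrow> T \<subseteq> lists I \<Longrightarrow>
    disjoint_family_on (\<lambda>w. word_map S w ` box u v) T \<Longrightarrow> 0 < \<delta> \<Longrightarrow> (\<And>w k. w \<in> T \<Longrightarrow> \<delta> \<le> len w k) \<Longrightarrow>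
    thin UNIV \<delta> B \<Longrightarrow> card {w \<in> T. B \<inter> cyl w \<noteq> {}} \<le> M"
proof -
  have ne: "u $ k < v $ k" for k
    using uv unfolding osc_box_def by (auto simp: interval_eq_empty_cart not_le)
  define h where "h = Min (range (\<lambda>k. (v $ k - u $ k) / 2))"
  define H where "H = Max (range (\<lambda>k. v $ k - u $ k))"
  have h: "h \<le> (v $ k - u $ k) / 2" for k unfolding h_def by (intro Min_le) auto
  have h0: "0 < h" unfolding h_def using ne by (subst Min_gr_iff) auto
  have H: "v $ k - u $ k \<le> H" for k unfolding H_def by (intro Max_ge) auto
  have hH: "h \<le> H" 
  proof -
    fix k :: 3
    have "(v $ k - u $ k) / 2 \<le> v $ k - u $ k" using ne[of k] by (simp add: field_simps)
    then show ?thesis using h[of k] H[of k] by (meson order_trans)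
  qed
  define M where "M = nat \<lceil>(10 * (1 + 2 * H) / h) ^ 3\<rceil>"
  have "0 < (10 * (1 + 2 * H) / h) ^ 3" using h0 hH by simp
  then have "0 < M" unfolding M_def by simp
  moreover have "card {w \<in> T. B \<inter> cyl w \<noteq> {}} \<le> M"
    if T: "finite T" "T \<subseteq> lists I" "disjoint_family_on (\<lambda>w. word_map S w ` box u v) T"
      and \<delta>: "0 < \<delta>" "\<And>w k. w \<in> T \<Longrightarrow> \<delta> \<le> len w k" and B: "thin UNIV \<delta> B" for T B \<delta>
  proof -
    define T' where "T' = {w \<in> T. B \<inter> cyl w \<noteq> {}}"
    have "\<exists>q p. p \<in> B \<and> q \<in> word_map S w ` box u v \<and> (\<forall>k. \<bar>q $ k - p $ k\<bar> \<le> \<delta> * H) \<and>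
      (\<forall>x. (\<forall>k. \<bar>x $ k - q $ k\<bar> < \<delta> * h) \<longrightarrow> x \<in> word_map S w ` box u v)" if wT: "w \<in> T'" for w
    proof -
      have w: "w \<in> lists I" "\<And>k. \<delta> \<le> len w k" using wT T(2) \<delta>(2) unfolding T'_def by auto
      obtain p where p: "p \<in> B" "p \<in> cyl w" using wT unfolding T'_def by blast
      obtain q where q: "q \<in> word_map S w ` box u v" "\<And>k. \<exists>j. \<bar>q $ k - p $ k\<bar> \<le> \<delta> * (v $ j - u $ j)"
        "\<And>x. (\<And>k. \<bar>x $ k - q $ k\<bar> < \<delta> * h) \<Longrightarrow> x \<in> word_map S w ` box u v"
        using inner_point[OF uv w(1) \<delta>(1) w(2) p(2) h h0] by metis
      have "\<bar>q $ k - p $ k\<bar> \<le> \<delta> * H" for k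
        using q(2)[of k] H \<delta>(1) by (meson less_imp_le mult_left_mono order_trans)
      then show ?thesis using p(1) q(1,3) by blast
    qed
    then obtain q p where p: "\<And>w. w \<in> T' \<Longrightarrow> p w \<in> B"
      and q: "\<And>w. w \<in> T' \<Longrightarrow> q w \<in> word_map S w ` box u v"
      and qp: "\<And>w k. w \<in> T' \<Longrightarrow> \<bar>q w $ k - p w $ k\<bar> \<le> \<delta> * H"
      and nbhd: "\<And>w x. w \<in> T' \<Longrightarrow> (\<And>k. \<bar>x $ k - q w $ k\<bar> < \<delta> * h) \<Longrightarrow> x \<in> word_map S w ` box u v"
      by metis
    have sep: "\<exists>k. \<delta> * h / 2 < \<bar>q w $ k - q w' $ k\<bar>" if ww: "w \<in> T'" "w' \<in> T'" "w \<noteq> w'" for w w'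
    proof (rule ccontr)
      assume "\<not> ?thesis"
      then have "\<bar>q w $ k - q w' $ k\<bar> \<le> \<delta> * h / 2" for k by (auto simp: not_less)
      moreover have "\<delta> * h / 2 < \<delta> * h" using \<delta>(1) h0 by simp
      ultimately have "\<bar>q w $ k - q w' $ k\<bar> < \<delta> * h" for k by (meson le_less_trans)
      then have "q w \<in> word_map S w' ` box u v" using nbhd[OF ww(2)] by blast
      moreover have "q w \<in> word_map S w ` box u v" using q[OF ww(1)] .
      ultimately show False
        using T(3) ww unfolding T'_def disjoint_family_on_def by blast
    qed
    have finT': "finite T'" unfolding T'_def using T(1) by simp
    have inj: "inj_on q T'"
    proof (rule inj_onI, rule ccontr)
      fix w w' assume "w \<in> T'" "w' \<in> T'" "q w = q w'" "w \<noteq> w'"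
      then obtain k where "\<delta> * h / 2 < 0" using sep[of w w'] by auto
      then show False using \<delta>(1) h0 by (simp add: mult_less_0_iff)
    qed
    have sepX: "separated UNIV (\<delta> * h / 2) (q ` T')"
      unfolding separated_def
    proof (intro ballI impI)
      fix x y assume "x \<in> q ` T'" "y \<in> q ` T'" "x \<noteq> y"
      then obtain w w' where "w \<in> T'" "w' \<in> T'" "w \<noteq> w'" "x = q w" "y = q w'" by blast
      then show "\<exists>k\<in>UNIV. \<delta> * h / 2 < \<bar>x $ k - y $ k\<bar>" using sep by simp
    qed
    have thinX: "thin UNIV (\<delta> * (1 + 2 * H)) (q ` T')"
      unfolding thin_def
    proof (intro ballI)
      fix x x' k assume "x \<in> q ` T'" "x' \<in> q ` T'"
      then obtain w w' where ww: "w \<in> T'" "w' \<in> T'" "x = q w" "x' = q w'" by blast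
      have "\<bar>p w $ k - p w' $ k\<bar> \<le> \<delta>" using B p ww unfolding thin_def by blast
      then have "\<bar>x $ k - x' $ k\<bar> \<le> \<delta> + 2 * (\<delta> * H)" 
        using qp[OF ww(1), of k] qp[OF ww(2), of k] unfolding ww(3,4) by linarith
      then show "\<bar>x $ k - x' $ k\<bar> \<le> \<delta> * (1 + 2 * H)" by (simp add: algebra_simps)
    qed
    have "card T' = card (q ` T')" using inj by (simp add: card_image)
    also have "\<dots> \<le> cov UNIV (\<delta> * h / 2) (q ` T')"
      using finT' \<delta>(1) h0 sepX by (intro card_separated_le) (auto intro: finite_imp_bounded)
    finally have "real (card T') \<le> real (cov UNIV (\<delta> * h / 2) (q ` T'))" by simp
    also have "\<dots> \<le> (5 * (\<delta> * (1 + 2 * H)) / (\<delta> * h / 2)) ^ 3"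
    proof (rule cov_thin_le[OF _ _ thinX])
      show "0 < \<delta> * h / 2" using \<delta>(1) h0 by simp
      have "h / 2 \<le> 1 + 2 * H" using h0 hH by simp
      then have "\<delta> * (h / 2) \<le> \<delta> * (1 + 2 * H)" using \<delta>(1) by (intro mult_left_mono) auto
      then show "\<delta> * h / 2 \<le> \<delta> * (1 + 2 * H)" by simp
    qed
    also have "5 * (\<delta> * (1 + 2 * H)) / (\<delta> * h / 2) = 10 * (1 + 2 * H) / h"
      using \<delta>(1) h0 by (simp add: field_simps)
    finally have "real (card T') \<le> (10 * (1 + 2 * H) / h) ^ 3" .
    then show ?thesis unfolding M_def T'_def by linarith
  qed
  ultimately show thesis by (rule that)
qed

text \<open>
  Words over the alphabet of the loops of length \<open>N\<close>, stopped when the shortest edge has length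
  about \<open>d\<close>. They are the loops \<open>w\<close> followed by the words obtained for \<open>d / len w m\<close>, and since the
  weights of the loops add up to at least 1, by induction so do the weights of these words.
\<close>

lemma stopped_loops:
  assumes uv: "osc_box u v" and N: "1 \<le> N" "1 \<le> loop_sum p1 p2 s l m N" and d: "0 < d" "d \<le> 1 / cmin ^ N"
  obtains T where "finite T" "T \<subseteq> lists I" "\<And>w. w \<in> T \<Longrightarrow> chamber w l m"
    "\<And>w. w \<in> T \<Longrightarrow> cmin ^ N * d \<le> len w m \<and> len w m \<le> d"
    "disjoint_family_on (\<lambda>w. word_map S w ` box u v) T" "1 \<le> (\<Sum>w\<in>T. wt p1 p2 s w l m)"
proof -
  define Q where "Q d T \<longleftrightarrow> finite T \<and> T \<subseteq> lists I \<and> (\<forall>w\<in>T. (\<forall>k. src w k = k) \<and> chamber w l m) \<and>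
    (\<forall>w\<in>T. cmin ^ N * d \<le> len w m \<and> len w m \<le> d) \<and>
    disjoint_family_on (\<lambda>w. word_map S w ` box u v) T \<and> 1 \<le> (\<Sum>w\<in>T. wt p1 p2 s w l m)" for d T
  let ?W = "loops N l m"
  have W: "w \<in> lists I" "length w = N" "\<forall>k. src w k = k" "chamber w l m" if "w \<in> ?W" for w
    using that unfolding loops_def by (auto simp: words_of_length_lists)
  have cN: "0 < cmin ^ N" "cmin ^ N \<le> 1" using cmin_pos cmin_less_1 by (auto intro: power_le_one)
  have claim: "\<exists>T. Q d T" if "cmax ^ n \<le> d" "d \<le> 1 / cmin ^ N" for n d
    using that
  proof (induction n arbitrary: d)
    case 0
    have "Q d {[]}"
      unfolding Q_def using 0 cN
      by (simp add: chamber_def disjoint_family_on_def wt_def mid_def field_simps)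
    then show ?case by blast
  next
    case (Suc n)
    show ?case
    proof (cases "1 \<le> d")
      case True
      have "cmax ^ n \<le> 1" using cmax_pos cmax_less_1 by (intro power_le_one) auto
      then show ?thesis using Suc.IH[of d] Suc.prems(2) True by simp
    next
      case False
      have d0: "0 < d" using Suc.prems(1) cmax_pos zero_less_power[of cmax "Suc n"] by linarith
      have "\<exists>T. Q (d / len w m) T" if w: "w \<in> ?W" for w
      proof (rule Suc.IH)
        have len: "cmin ^ N \<le> len w m" "len w m \<le> cmax ^ N" "0 < len w m"
          using len_bounds[OF W(1)[OF w], of m] len_pos[OF W(1)[OF w], of m] W(2)[OF w] by auto
        have "cmax ^ N \<le> cmax ^ 1" using N(1) cmax_pos cmax_less_1 by (intro power_decreasing) auto
        then have "cmax ^ n * len w m \<le> cmax ^ n * cmax"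
          using len(2) cmax_pos by (intro mult_left_mono) auto
        then show "cmax ^ n \<le> d / len w m"
          using Suc.prems(1) len(3) by (simp add: field_simps)
        show "d / len w m \<le> 1 / cmin ^ N"
          using False d0 len(1) cN by (intro frac_le) auto
      qed
      then obtain U where U: "\<And>w. w \<in> ?W \<Longrightarrow> Q (d / len w m) (U w)" by metis
      define f where "f = (\<lambda>(w :: 'i list, x :: 'i list). w @ x)"
      define A where "A = Sigma ?W U"
      have A: "w \<in> ?W" "x \<in> U w" "x \<in> lists I" "\<forall>k. src x k = k" "chamber x l m"
        "cmin ^ N * (d / len w m) \<le> len x m" "len x m \<le> d / len w m" if "(w, x) \<in> A" for w x
        using that U[of w] unfolding A_def Q_def by auto
      have finA: "finite A" unfolding A_def using finite_loops U unfolding Q_def by (intro finite_SigmaI) auto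
      have f_eq: "f (w, x) = w @ x" for w x unfolding f_def by simp
      have inj: "inj_on f A"
      proof (rule inj_onI)
        fix a b assume ab: "a \<in> A" "b \<in> A" "f a = f b"
        obtain w x w' x' where eq: "a = (w, x)" "b = (w', x')" by (cases a, cases b) blast
        have "length w = length w'" using W(2)[OF A(1)] ab unfolding eq by metis
        then show "a = b" using ab(3) unfolding eq f_eq by simp
      qed
      have "Q d (f ` A)"
        unfolding Q_def
      proof (intro conjI)
        show "finite (f ` A)" using finA by simp
        show "f ` A \<subseteq> lists I"
        proof
          fix y assume "y \<in> f ` A"
          then obtain w x where "(w, x) \<in> A" "y = w @ x" by (auto simp: f_eq)
          then show "y \<in> lists I" using W(1)[OF A(1)] A(3) by auto
        qed
        show "\<forall>y\<in>f ` A. (\<forall>k. src y k = k) \<and> chamber y l m"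
        proof
          fix y assume "y \<in> f ` A"
          then obtain w x where wx: "(w, x) \<in> A" "y = w @ x" by (auto simp: f_eq)
          note w = W[OF A(1)[OF wx(1)]] and x = A(3-5)[OF wx(1)]
          show "(\<forall>k. src y k = k) \<and> chamber y l m"
            unfolding wx(2) using chamber_mult(1)[OF w(1) x(1) w(3) w(4) x(3)] w(3) x(2) by (simp add: src_append)
        qed
        show "\<forall>y\<in>f ` A. cmin ^ N * d \<le> len y m \<and> len y m \<le> d"
        proof
          fix y assume "y \<in> f ` A"
          then obtain w x where wx: "(w, x) \<in> A" "y = w @ x" by (auto simp: f_eq)
          note w = W[OF A(1)[OF wx(1)]]
          have "len y m = len w m * len x m" unfolding wx(2) using w(3) by (simp add: len_append)
          then show "cmin ^ N * d \<le> len y m \<and> len y m \<le> d"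
            using A(6,7)[OF wx(1)] len_pos[OF w(1), of m] by (simp add: field_simps)
        qed
        show "disjoint_family_on (\<lambda>w. word_map S w ` box u v) (f ` A)"
          unfolding disjoint_family_on_def
        proof (intro ballI impI)
          fix y y' assume "y \<in> f ` A" "y' \<in> f ` A" and ne: "y \<noteq> y'"
          then obtain w x w' x' where wx: "(w, x) \<in> A" "y = w @ x" "(w', x') \<in> A" "y' = w' @ x'"
            by (auto simp: f_eq)
          note w = W[OF A(1)[OF wx(1)]] and w' = W[OF A(1)[OF wx(3)]]
          have im: "word_map S (w @ x) ` box u v = word_map S w ` (word_map S x ` box u v)" for w x
            by (simp add: word_map_append image_comp)
          show "word_map S y ` box u v \<inter> word_map S y' ` box u v = {}"
          proof (cases "w = w'")
            case True
            then have "x \<noteq> x'" using ne wx by simp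
            then have "word_map S x ` box u v \<inter> word_map S x' ` box u v = {}"
              using U[OF A(1)[OF wx(1)]] A(2)[OF wx(1)] A(2)[OF wx(3)] True
              unfolding Q_def disjoint_family_on_def by blast
            then show ?thesis
              unfolding wx im True using bij_is_inj[OF bij_word_map[OF w'(1)]] by (simp add: image_Int[symmetric])
          next
            case False
            then have "word_map S w ` box u v \<inter> word_map S w' ` box u v = {}"
              using w w' by (intro word_map_box_disjoint[OF uv]) auto
            then show ?thesis
              unfolding wx im using word_map_box_subset[OF uv A(3)[OF wx(1)]] word_map_box_subset[OF uv A(3)[OF wx(3)]]
              by blast
          qed
        qed
        have "1 \<le> (\<Sum>w\<in>?W. wt p1 p2 s w l m)" using N(2) unfolding loop_sum_def .
        also have "\<dots> \<le> (\<Sum>w\<in>?W. wt p1 p2 s w l m * (\<Sum>x\<in>U w. wt p1 p2 s x l m))"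
        proof (rule sum_mono)
          fix w assume "w \<in> ?W"
          then show "wt p1 p2 s w l m \<le> wt p1 p2 s w l m * (\<Sum>x\<in>U w. wt p1 p2 s x l m)"
            using U[of w] wt_loops_nonneg[of w N l m p1 p2 s] mult_left_mono[of 1 "\<Sum>x\<in>U w. wt p1 p2 s x l m" "wt p1 p2 s w l m"]
            unfolding Q_def by simp
        qed
        also have "\<dots> = (\<Sum>(w, x)\<in>A. wt p1 p2 s w l m * wt p1 p2 s x l m)"
          unfolding A_def sum_distrib_left using finite_loops U unfolding Q_def by (intro sum.Sigma) auto
        also have "\<dots> = (\<Sum>a\<in>A. wt p1 p2 s (f a) l m)"
        proof (rule sum.cong[OF refl])
          fix a assume a: "a \<in> A"
          obtain w x where wx: "a = (w, x)" by (cases a)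
          note w = W[OF A(1)[OF a[unfolded wx]]] and x = A(3-5)[OF a[unfolded wx]]
          show "(case a of (w, x) \<Rightarrow> wt p1 p2 s w l m * wt p1 p2 s x l m) = wt p1 p2 s (f a) l m"
            unfolding wx f_eq using chamber_mult(2)[OF w(1) x(1) w(3) w(4) x(3)] by simp
        qed
        also have "\<dots> = (\<Sum>y\<in>f ` A. wt p1 p2 s y l m)" using inj by (simp add: sum.reindex)
        finally show "1 \<le> (\<Sum>y\<in>f ` A. wt p1 p2 s y l m)" .
      qed
      then show ?thesis by blast
    qed
  qed
  obtain n where "cmax ^ n < d" using real_arch_pow_inv[OF d(1) cmax_less_1] by blast
  then obtain T where T: "Q d T" using claim[of n d] d(2) by auto
  show thesis by (rule that[of T]) (use T[unfolded Q_def] in blast)+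
qed

end

context sponge_weights
begin

text \<open>
  For \<open>s < s0\<close> there is a length \<open>N\<close> for which the loops of one chamber have weights with sum at
  least 1. Concatenations of these loops, stopped at scale \<open>d\<close>, still have total weight at
  least 1, and by the open set condition their covering numbers add up.
\<close>

lemma lower_box_dim_ge_s0:
  assumes "COSC I S"
    and "\<And>e. 0 < e \<Longrightarrow> \<exists>c>0. \<forall>w\<in>lists I. c * len w (m w) powr e * \<psi> 0 w \<le> real (cov UNIV (len w (m w)) (cyl w))"
  shows "ereal s0 \<le> lower_box_dim F"
proof (rule ereal_le_if_reals_below_le)
  fix t assume "ereal t < ereal s0"
  show "ereal t \<le> lower_box_dim F"
  proof (cases "0 \<le> t")
    case False
    then have "ereal t \<le> 0" by simp
    also have "0 \<le> lower_box_dim F"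
      using lower_box_dim_nonneg[OF bounded_F F_nonempty, of UNIV] by (simp add: coord_proj_UNIV)
    finally show ?thesis .
  next
    case True
    define s where "s = (t + s0) / 2"
    define e where "e = s - t"
    have s: "0 \<le> s" "s < s0" "0 < e" unfolding s_def e_def using True \<open>ereal t < ereal s0\<close> by auto
    obtain u v where uv: "osc_box u v" using assms(1) unfolding COSC_def osc_box_def by blast
    obtain c where c: "0 < c" "\<And>w. w \<in> lists I \<Longrightarrow> c * len w (m w) powr e * \<psi> 0 w \<le> real (cov UNIV (len w (m w)) (cyl w))"
      using assms(2)[OF s(3)] by blast
    obtain M :: nat where M: "0 < M" "\<And>T B \<delta>. finite T \<Longrightarrow> T \<subseteq> lists I \<Longrightarrow>
      disjoint_family_on (\<lambda>w. word_map S w ` box u v) T \<Longrightarrow> 0 < \<delta> \<Longrightarrow> (\<And>w k. w \<in> T \<Longrightarrow> \<delta> \<le> len w k) \<Longrightarrow>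
      thin UNIV \<delta> B \<Longrightarrow> card {w \<in> T. B \<inter> cyl w \<noteq> {}} \<le> M"
      using osc_multiplicity[OF uv] by blast
    obtain a b N where N: "1 \<le> N" "1 \<le> loop s a b N" using big_loop_below_s0[OF s(1,2)] by blast
    define g where "g = cmin ^ N"
    have g: "0 < g" unfolding g_def using cmin_pos by simp
    define c' where "c' = c * g powr t / M"
    have c': "0 < c'" unfolding c'_def using c(1) M(1) g by simp
    have "c' * \<delta> powr (- t) \<le> real (cov UNIV \<delta> F)" if \<delta>: "0 < \<delta>" "\<delta> < 1" for \<delta>
    proof -
      define d where "d = \<delta> / g"
      have d: "0 < d" "d \<le> 1 / cmin ^ N" "cmin ^ N * d = \<delta>"
      proof -
        have "0 < \<delta> / g" "\<delta> / g \<le> 1 / g" "g * (\<delta> / g) = \<delta>"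
          using \<delta> g by (auto intro: divide_right_mono)
        then show "0 < d" "d \<le> 1 / cmin ^ N" "cmin ^ N * d = \<delta>" unfolding d_def g_def by auto
      qed
      obtain T where T: "finite T" "T \<subseteq> lists I" "\<And>w. w \<in> T \<Longrightarrow> chamber w a b"
        "\<And>w. w \<in> T \<Longrightarrow> cmin ^ N * d \<le> len w b \<and> len w b \<le> d"
        "disjoint_family_on (\<lambda>w. word_map S w ` box u v) T" "1 \<le> (\<Sum>w\<in>T. wt p1 p2 s w a b)"
        using stopped_loops[OF uv N d(1,2)] by blast
      have "c * d powr (- t) * 1 \<le> c * d powr (- t) * (\<Sum>w\<in>T. wt p1 p2 s w a b)"
        using T(6) c(1) by (intro mult_left_mono) auto
      also have "\<dots> = (\<Sum>w\<in>T. c * d powr (- t) * wt p1 p2 s w a b)" by (simp add: sum_distrib_left)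
      also have "\<dots> \<le> (\<Sum>w\<in>T. real (cov UNIV \<delta> (cyl w)))"
      proof (rule sum_mono)
        fix w assume "w \<in> T"
        then have w: "w \<in> lists I" "chamber w a b" "\<delta> \<le> len w b" "len w b \<le> d"
          using T d(3) by auto
        have b: "len w (m w) = len w b"
          using w(2) chamber_lm[OF w(1)] unfolding chamber_def by (auto intro: antisym)
        have pos: "0 < len w b" by (rule len_pos[OF w(1)])
        have "wt p1 p2 s w a b = \<psi> s w" using \<psi>_eq[OF w(1,2), of s] by simp
        also have "\<dots> = len w b powr s * \<psi> 0 w" using \<psi>_add[of 0 s w] b by simp
        finally have "c * d powr (- t) * wt p1 p2 s w a b = c * d powr (- t) * len w b powr s * \<psi> 0 w" by simp
        also have "\<dots> \<le> c * len w b powr (- t) * len w b powr s * \<psi> 0 w"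
          using c(1) True pos w(4) \<psi>_nonneg[OF w(1), of 0]
          by (intro mult_right_mono mult_left_mono powr_mono2') auto
        also have "\<dots> = c * len w b powr e * \<psi> 0 w"
          unfolding e_def using pos by (simp add: powr_diff powr_minus field_simps)
        also have "\<dots> \<le> real (cov UNIV (len w b) (cyl w))" using c(2)[OF w(1)] b by simp
        also have "\<dots> \<le> real (cov UNIV \<delta> (cyl w))"
          using cov_mono[OF bounded_cyl[OF w(1)] \<delta>(1) order_refl order_refl w(3)] by simp
        finally show "c * d powr (- t) * wt p1 p2 s w a b \<le> real (cov UNIV \<delta> (cyl w))" .
      qed
      also have "\<dots> = real (\<Sum>w\<in>T. cov UNIV \<delta> (cyl w))" by simp
      also have "(\<Sum>w\<in>T. cov UNIV \<delta> (cyl w)) \<le> M * cov UNIV \<delta> F"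
      proof (rule sum_cov_le[OF bounded_F \<delta>(1) T(1)])
        show "cyl w \<subseteq> F" if "w \<in> T" for w using that T(2) cyl_subset by blast
        have "\<delta> \<le> len w k" if "w \<in> T" for w k
          using T(3)[OF that] T(4)[OF that] d(3) unfolding chamber_def by (metis order_trans)
        then show "card {w \<in> T. B \<inter> cyl w \<noteq> {}} \<le> M" if "thin UNIV \<delta> B" for B
          using M(2)[OF T(1,2,5) \<delta>(1) _ that] by blast
      qed
      finally have "c * d powr (- t) \<le> real M * real (cov UNIV \<delta> F)" by simp
      moreover have "d powr (- t) = g powr t * \<delta> powr (- t)"
        unfolding d_def using \<delta> g by (simp add: powr_divide powr_minus field_simps)
      ultimately show ?thesis unfolding c'_def using M(1) by (simp add: field_simps)
    qed
    then have "ereal t \<le> lower_box_dim (coord_proj UNIV ` F)"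
      using c' by (intro lower_box_dim_ge[OF bounded_F, of c']) auto
    then show ?thesis by (simp add: coord_proj_UNIV)
  qed
qed

end

context sponge
begin

section \<open>The lower bound for a cylinder\<close>

definition lower_axis :: "3 \<Rightarrow> real" where
  "lower_axis k = real_of_ereal (box_dim (coord_proj {k} ` F))"

definition lower_plane :: "3 \<Rightarrow> real" where
  "lower_plane k = real_of_ereal (lower_box_dim (coord_proj (- {k}) ` F))"

lemma box_dim_axis: "box_dim (coord_proj {k} ` F) = lower_box_dim (coord_proj {k} ` F)"
  unfolding box_dim_def using axis_box_dim_exists[of k] by (intro the_equality) auto

lemma ereal_lower_axis: "ereal (lower_axis k) = lower_box_dim (coord_proj {k} ` F)"
  unfolding lower_axis_def box_dim_axis by (rule box_dim_real(2)[OF bounded_F F_nonempty])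

lemma ereal_lower_plane: "ereal (lower_plane k) = lower_box_dim (coord_proj (- {k}) ` F)"
  unfolding lower_plane_def by (rule box_dim_real(2)[OF bounded_F F_nonempty])

lemma lower_axis_nonneg: "0 \<le> lower_axis k" and lower_plane_nonneg: "0 \<le> lower_plane k"
  using lower_box_dim_nonneg[OF bounded_F F_nonempty] ereal_lower_axis[of k] ereal_lower_plane[of k]
  by (metis ereal_less_eq(5))+

lemma lower_axis_src: "w \<in> lists I \<Longrightarrow> lower_axis (src w k) = lower_axis k"
  unfolding lower_axis_def box_dim_axis using box_dim_src(2)[of w "{k}"] by simp

lemma lower_plane_src: "w \<in> lists I \<Longrightarrow> lower_plane (src w k) = lower_plane k"
  unfolding lower_plane_def using box_dim_src(2)[of w "- {k}"] by (simp add: src_Compl)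

lemma uniform_lower_cov_bound:
  fixes d :: "3 \<Rightarrow> real" and K :: "3 \<Rightarrow> 3 set"
  assumes "\<And>k. ereal (d k) = lower_box_dim (coord_proj (K k) ` F)" "0 < e"
  obtains C where "0 < C" "\<And>k \<delta>. 0 < \<delta> \<Longrightarrow> \<delta> \<le> 1 \<Longrightarrow> \<delta> powr (- (d k - e)) \<le> C * real (cov (K k) \<delta> F)"
proof -
  define Q where "Q k C \<longleftrightarrow> (\<forall>\<delta>. 0 < \<delta> \<longrightarrow> \<delta> \<le> 1 \<longrightarrow> \<delta> powr (- (d k - e)) \<le> C * real (cov (K k) \<delta> F))" for k C
  obtain C where C: "0 < C" "\<And>k. Q k C"
  proof (rule ex_uniform_bound[of Q])
    fix k
    have "ereal (d k - e) < lower_box_dim (coord_proj (K k) ` F)"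
      unfolding assms(1)[symmetric] using assms(2) by simp
    then obtain C where C: "0 < C" "\<And>\<delta>. 0 < \<delta> \<Longrightarrow> \<delta> \<le> 1 \<Longrightarrow> C * \<delta> powr (- (d k - e)) \<le> real (cov (K k) \<delta> F)"
      using lower_box_dim_bound[OF bounded_F F_nonempty] by blast
    then have "Q k (1 / C)" unfolding Q_def by (simp add: pos_le_divide_eq mult.commute)
    then show "\<exists>C>0. Q k C" using C(1) by (intro exI[of _ "1 / C"]) simp
  next
    fix k and C C' :: real assume h: "Q k C" and "C \<le> C'"
    then have "C * real (cov (K k) \<delta> F) \<le> C' * real (cov (K k) \<delta> F)" for \<delta> by (intro mult_right_mono) auto
    then show "Q k C'" using h unfolding Q_def by (meson order_trans)
  qed blast
  from C(1) C(2)[unfolded Q_def] show thesis by (intro that) auto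
qed

text \<open>
  Cylinders whose long edge in the plane of the axes \<open>a\<close>, \<open>b\<close> is parallel to \<open>a\<close> can be found in
  sufficient number if all cylinders are of this kind, or if a cylinder of the other kind can
  be turned by a word that swaps the two axes.
\<close>

definition alignable :: "3 \<Rightarrow> 3 \<Rightarrow> bool" where
  "alignable a b \<longleftrightarrow> (\<forall>w\<in>lists I. len w b \<le> len w a) \<or> (\<exists>j\<in>lists I. src j a = b \<and> src j b = a)"

lemma aligned_cylinders:
  assumes "alignable a b"
  obtains c where "0 < c" "c \<le> 1" "\<And>\<rho>. 0 < \<rho> \<Longrightarrow> \<rho> \<le> 1 \<Longrightarrow>
    \<exists>(X :: (real^3) set) v. finite X \<and> c * real (cov {a, b} \<rho> F) \<le> real (card X) \<and>
      (\<forall>x\<in>X. v x \<in> lists I \<and> c * \<rho> \<le> len (v x) a) \<and>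
      (\<forall>x\<in>X. \<forall>y\<in>X. x \<noteq> y \<longrightarrow> (\<forall>p\<in>cyl (v x). \<forall>q\<in>cyl (v y). \<exists>k\<in>{a, b}. \<rho> < \<bar>p $ k - q $ k\<bar>))"
proof -
  obtain j where j: "j \<in> lists I" "(\<forall>w\<in>lists I. len w b \<le> len w a) \<or> src j a = b \<and> src j b = a"
    using assms unfolding alignable_def by (metis lists.Nil)
  define \<kappa> where "\<kappa> = cmin ^ length j"
  have \<kappa>: "0 < \<kappa>" "\<kappa> \<le> 1" unfolding \<kappa>_def using cmin_pos cmin_less_1 by (auto intro: power_le_one)
  have len_j: "\<kappa> \<le> len j k" for k unfolding \<kappa>_def by (rule len_bounds(1)[OF j(1)])
  have \<kappa>1: "1 \<le> 1 / \<kappa>" using \<kappa> by simp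
  obtain c0 where c0: "0 < c0" "\<And>\<rho>. 0 < \<rho> \<Longrightarrow> \<rho> \<le> 1 \<Longrightarrow>
    \<exists>X v. finite X \<and> X \<subseteq> F \<and> separated {a, b} ((2 + 1 / \<kappa>) * \<rho>) X \<and> c0 * real (cov {a, b} \<rho> F) \<le> real (card X) \<and>
      (\<forall>x\<in>X. v x \<in> lists I \<and> x \<in> cyl (v x) \<and> (\<forall>k\<in>{a, b}. len (v x) k \<le> \<rho>) \<and> (\<exists>k\<in>{a, b}. cmin * \<rho> \<le> len (v x) k))"
    by (rule separated_cylinders[of "{a, b}" "2 + 1 / \<kappa>"]) (use \<kappa>1 in auto)
  \<comment> \<open>The separation \<open>2 + 1 / \<kappa>\<close> leaves a gap of \<open>\<rho> / \<kappa>\<close> between cylinders of size \<open>\<rho>\<close>, which the map of \<open>j\<close> shrinks to no less than \<open>\<rho>\<close>.\<close>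
  define c where "c = min (c0 / 2) (\<kappa> * cmin)"
  have c: "0 < c" "c \<le> c0 / 2" "c \<le> \<kappa> * cmin" unfolding c_def using c0(1) \<kappa>(1) cmin_pos by auto
  have \<kappa>c: "\<kappa> * cmin \<le> cmin" "cmin \<le> 1" using \<kappa> cmin_pos cmin_less_1 by (auto simp: mult_le_cancel_right1)
  show thesis
  proof (rule that[OF c(1)])
    show "c \<le> 1" using c(3) \<kappa>c by linarith
    fix \<rho> :: real assume \<rho>: "0 < \<rho>" "\<rho> \<le> 1"
    obtain X v where X: "finite X" "separated {a, b} ((2 + 1 / \<kappa>) * \<rho>) X" "c0 * real (cov {a, b} \<rho> F) \<le> real (card X)"
      and v_all: "\<forall>x\<in>X. v x \<in> lists I \<and> x \<in> cyl (v x) \<and> (\<forall>k\<in>{a, b}. len (v x) k \<le> \<rho>) \<and> (\<exists>k\<in>{a, b}. cmin * \<rho> \<le> len (v x) k)"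
      using c0(2)[OF \<rho>] by blast
    have v: "v x \<in> lists I" "x \<in> cyl (v x)" "\<And>k. k \<in> {a, b} \<Longrightarrow> len (v x) k \<le> \<rho>"
      "cmin * \<rho> \<le> len (v x) a \<or> cmin * \<rho> \<le> len (v x) b" if "x \<in> X" for x
      using bspec[OF v_all that] by auto
    have sep: "\<exists>k\<in>{a, b}. \<rho> / \<kappa> < \<bar>p $ k - q $ k\<bar>"
      if xy: "x \<in> X" "y \<in> X" "x \<noteq> y" and pq: "p \<in> cyl (v x)" "q \<in> cyl (v y)" for x y p q
    proof -
      obtain k where k: "k \<in> {a, b}" "(2 + 1 / \<kappa>) * \<rho> < \<bar>x $ k - y $ k\<bar>"
        using X(2) xy unfolding separated_def by blast
      have "\<bar>p $ k - x $ k\<bar> \<le> \<rho>" "\<bar>q $ k - y $ k\<bar> \<le> \<rho>"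
        using abs_diff_cyl_le[OF v(1)[OF xy(1)] pq(1) v(2)[OF xy(1)], of k] v(3)[OF xy(1) k(1)]
          abs_diff_cyl_le[OF v(1)[OF xy(2)] pq(2) v(2)[OF xy(2)], of k] v(3)[OF xy(2) k(1)] by linarith+
      moreover have "(2 + 1 / \<kappa>) * \<rho> = 2 * \<rho> + \<rho> / \<kappa>" by (simp add: algebra_simps)
      ultimately have "\<rho> / \<kappa> < \<bar>p $ k - q $ k\<bar>" using k(2) by linarith
      then show ?thesis using k(1) by blast
    qed
    define Xa where "Xa = {x \<in> X. cmin * \<rho> \<le> len (v x) a}"
    define Xb where "Xb = {x \<in> X. cmin * \<rho> \<le> len (v x) b}"
    have Xab: "X = Xa \<union> Xb" "finite Xa" "finite Xb" "Xa \<subseteq> X" "Xb \<subseteq> X"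
      unfolding Xa_def Xb_def using v(4) X(1) by auto
    have count: "c * real (cov {a, b} \<rho> F) \<le> real (card Y)" if "card X \<le> 2 * card Y" for Y :: "(real^3) set"
    proof -
      have "c * real (cov {a, b} \<rho> F) \<le> c0 / 2 * real (cov {a, b} \<rho> F)"
        using c(2) by (intro mult_right_mono) auto
      then show ?thesis using X(3) that by linarith
    qed
    show "\<exists>(X :: (real^3) set) v. finite X \<and> c * real (cov {a, b} \<rho> F) \<le> real (card X) \<and>
      (\<forall>x\<in>X. v x \<in> lists I \<and> c * \<rho> \<le> len (v x) a) \<and>
      (\<forall>x\<in>X. \<forall>y\<in>X. x \<noteq> y \<longrightarrow> (\<forall>p\<in>cyl (v x). \<forall>q\<in>cyl (v y). \<exists>k\<in>{a, b}. \<rho> < \<bar>p $ k - q $ k\<bar>))"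
    proof (cases "card X \<le> 2 * card Xa")
      case True
      have "\<forall>x\<in>Xa. v x \<in> lists I \<and> c * \<rho> \<le> len (v x) a"
      proof
        fix x assume x: "x \<in> Xa"
        have "c * \<rho> \<le> cmin * \<rho>" using c(3) \<kappa>c \<rho> by (intro mult_right_mono) auto
        then show "v x \<in> lists I \<and> c * \<rho> \<le> len (v x) a" using x v(1) unfolding Xa_def by auto
      qed
      moreover have "\<exists>k\<in>{a, b}. \<rho> < \<bar>p $ k - q $ k\<bar>"
        if xy: "x \<in> Xa" "y \<in> Xa" "x \<noteq> y" and pq: "p \<in> cyl (v x)" "q \<in> cyl (v y)" for x y p q
      proof -
        have "\<rho> \<le> \<rho> / \<kappa>" using \<rho> \<kappa> by (simp add: field_simps)
        moreover have "x \<in> X" "y \<in> X" using xy Xab(4) by auto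
        from sep[OF this xy(3) pq] obtain k where "k \<in> {a, b}" "\<rho> / \<kappa> < \<bar>p $ k - q $ k\<bar>" by (elim bexE)
        ultimately show ?thesis by (meson le_less_trans)
      qed
      ultimately show ?thesis
        using Xab(2) count[OF True] by (intro exI[of _ Xa] exI[of _ v] conjI ballI impI) blast+
    next
      case False
      have "card X \<le> card Xa + card Xb" unfolding Xab(1) by (rule card_Un_le)
      then have Xb2: "card X \<le> 2 * card Xb" using False by linarith
      have swap: "src j a = b" "src j b = a"
      proof -
        have "\<not> (\<forall>w\<in>lists I. len w b \<le> len w a)"
        proof
          assume "\<forall>w\<in>lists I. len w b \<le> len w a"
          then have "Xb \<subseteq> Xa" unfolding Xa_def Xb_def using v(1) by (auto intro: order_trans)
          then have "X = Xa" using Xab(1) by blast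
          then show False using False by simp
        qed
        then show "src j a = b" "src j b = a" using j(2) by auto
      qed
      have "\<forall>x\<in>Xb. j @ v x \<in> lists I \<and> c * \<rho> \<le> len (j @ v x) a"
      proof
        fix x assume x: "x \<in> Xb"
        have "c * \<rho> \<le> \<kappa> * cmin * \<rho>" using c(3) \<rho> by (intro mult_right_mono) auto
        also have "\<dots> = \<kappa> * (cmin * \<rho>)" by simp
        also have "\<dots> \<le> len j a * len (v x) b"
          using len_j[of a] x \<kappa>(1) cmin_pos \<rho> unfolding Xb_def by (intro mult_mono) auto
        also have "\<dots> = len (j @ v x) a" using swap by (simp add: len_append)
        finally show "j @ v x \<in> lists I \<and> c * \<rho> \<le> len (j @ v x) a"
          using j(1) v(1) x Xab(5) by auto
      qed
      moreover have "\<exists>k\<in>{a, b}. \<rho> < \<bar>p $ k - q $ k\<bar>"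
        if xy: "x \<in> Xb" "y \<in> Xb" "x \<noteq> y" and pq: "p \<in> cyl (j @ v x)" "q \<in> cyl (j @ v y)" for x y p q
      proof -
        obtain p' where p': "p' \<in> cyl (v x)" "p = word_map S j p'" using pq(1) unfolding cyl_append by blast
        obtain q' where q': "q' \<in> cyl (v y)" "q = word_map S j q'" using pq(2) unfolding cyl_append by blast
        obtain k' where k': "k' \<in> {a, b}" "\<rho> / \<kappa> < \<bar>p' $ k' - q' $ k'\<bar>"
          using sep[OF subsetD[OF Xab(5) xy(1)] subsetD[OF Xab(5) xy(2)] xy(3) p'(1) q'(1)] by (elim bexE)
        obtain k where k: "k \<in> {a, b}" "src j k = k'" using k'(1) swap by blast
        have "\<rho> = \<kappa> * (\<rho> / \<kappa>)" using \<kappa>(1) by simp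
        also have "\<dots> < \<kappa> * \<bar>p' $ k' - q' $ k'\<bar>" using k'(2) \<kappa>(1) by (intro mult_strict_left_mono)
        also have "\<dots> \<le> len j k * \<bar>p' $ k' - q' $ k'\<bar>" using len_j by (intro mult_right_mono) auto
        also have "\<dots> = \<bar>p $ k - q $ k\<bar>" unfolding p'(2) q'(2) word_map_diff_nth[OF j(1)] k(2) ..
        finally show ?thesis using k(1) by blast
      qed
      ultimately show ?thesis
        using Xab(3) count[OF Xb2] by (intro exI[of _ Xb] exI[of _ "\<lambda>x. j @ v x"] conjI ballI impI) blast+
    qed
  qed
qed

text \<open>
  Compare \<open>cov_cyl_upper\<close>: the pieces of the projection to the plane are now separated copies of
  \<open>F\<close> with their long edges in the direction of the longest axis, so that each of them needs as
  many parts along that axis as the projection of \<open>F\<close> to an axis does.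
\<close>

lemma cov_cyl_lower_aligned:
  assumes "alignable a b" "0 < e"
  obtains c where "0 < c" "\<And>w l n m. w \<in> lists I \<Longrightarrow> l \<noteq> n \<Longrightarrow> n \<noteq> m \<Longrightarrow> l \<noteq> m \<Longrightarrow> UNIV = {l, n, m} \<Longrightarrow>
    chamber w l m \<Longrightarrow> src w l = a \<Longrightarrow> src w n = b \<Longrightarrow>
    c * len w m powr e * wt lower_axis lower_plane 0 w l m \<le> real (cov UNIV (len w m) (cyl w))"
proof -
  obtain c1 where c1: "0 < c1" "c1 \<le> 1" "\<And>\<rho>. 0 < \<rho> \<Longrightarrow> \<rho> \<le> 1 \<Longrightarrow>
    \<exists>(X :: (real^3) set) v. finite X \<and> c1 * real (cov {a, b} \<rho> F) \<le> real (card X) \<and>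
      (\<forall>x\<in>X. v x \<in> lists I \<and> c1 * \<rho> \<le> len (v x) a) \<and>
      (\<forall>x\<in>X. \<forall>y\<in>X. x \<noteq> y \<longrightarrow> (\<forall>p\<in>cyl (v x). \<forall>q\<in>cyl (v y). \<exists>k\<in>{a, b}. \<rho> < \<bar>p $ k - q $ k\<bar>))"
    by (rule aligned_cylinders[OF assms(1)]) blast
  obtain C1 where C1: "0 < C1" "\<And>k \<delta>. 0 < \<delta> \<Longrightarrow> \<delta> \<le> 1 \<Longrightarrow> \<delta> powr (- (lower_axis k - e)) \<le> C1 * real (cov {k} \<delta> F)"
    using uniform_lower_cov_bound[of lower_axis "\<lambda>k. {k}", OF ereal_lower_axis assms(2)] by blast
  obtain C2 where C2: "0 < C2" "\<And>k \<delta>. 0 < \<delta> \<Longrightarrow> \<delta> \<le> 1 \<Longrightarrow> \<delta> powr (- (lower_plane k - e)) \<le> C2 * real (cov (- {k}) \<delta> F)"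
    using uniform_lower_cov_bound[of lower_plane "\<lambda>k. - {k}", OF ereal_lower_plane assms(2)] by blast
  define D where "D = (5 / c1) ^ 3 * C1"
  have D: "0 < D" unfolding D_def using c1(1) C1(1) by simp
  define c where "c = c1 / (C2 * D)"
  have c: "0 < c" unfolding c_def using c1(1) C2(1) D by simp
  have "c * len w m powr e * wt lower_axis lower_plane 0 w l m \<le> real (cov UNIV (len w m) (cyl w))"
    if w: "w \<in> lists I" and axes: "l \<noteq> n" "n \<noteq> m" "l \<noteq> m" "UNIV = {l, n, m}" and ch: "chamber w l m"
      and ab: "src w l = a" "src w n = b" for w l n m
  proof -
    let ?x = "len w l" and ?y = "len w n" and ?z = "len w m"
    have pos: "0 < ?x" "0 < ?y" "0 < ?z" using len_pos[OF w] by auto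
    have ord: "?z \<le> ?y" "?y \<le> ?x" "?x \<le> 1" using ch len_le_1[OF w] unfolding chamber_def by auto
    define R where "R = ?z / ?y"
    have R: "0 < R" "R \<le> 1" "?z = ?y * R" unfolding R_def using pos ord by auto
    define q where "q = ?y / ?x"
    have q: "0 < q" "q \<le> 1" unfolding q_def using pos ord by auto
    have plane: "{a, b} = - {src w m}"
    proof -
      have "- {m} = {l, n}" using axes by auto
      then show ?thesis using src_Compl[OF w, of m] ab by auto
    qed
    obtain X :: "(real^3) set" and v where X: "finite X" "c1 * real (cov {a, b} R F) \<le> real (card X)"
      and v_all: "\<forall>x\<in>X. v x \<in> lists I \<and> c1 * R \<le> len (v x) a"
      and sep: "\<forall>x\<in>X. \<forall>y\<in>X. x \<noteq> y \<longrightarrow> (\<forall>p\<in>cyl (v x). \<forall>q\<in>cyl (v y). \<exists>k\<in>{a, b}. R < \<bar>p $ k - q $ k\<bar>)"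
      using c1(3)[OF R(1,2)] by blast
    have v: "v x \<in> lists I" "c1 * R \<le> len (v x) a" if "x \<in> X" for x using bspec[OF v_all that] by auto
    have piece: "q powr (- (lower_axis l - e)) / D \<le> real (cov UNIV ?z (cyl (w @ v t)))" if t: "t \<in> X" for t
    proof -
      have wv: "w @ v t \<in> lists I" using w v(1)[OF t] by simp
      have "len (w @ v t) l = ?x * len (v t) a" using ab by (simp add: len_append)
      then have len: "?z \<le> len (w @ v t) l * (q / c1)"
      proof -
        have "?z = (?x * (c1 * R)) * (q / c1)" unfolding q_def R(3) using pos c1(1) by simp
        also have "\<dots> \<le> (?x * len (v t) a) * (q / c1)"
          using v(2)[OF t] pos q c1(1) by (intro mult_right_mono mult_left_mono) auto
        finally show ?thesis using \<open>len (w @ v t) l = ?x * len (v t) a\<close> by simp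
      qed
      let ?k = "src (w @ v t) l"
      have "q powr (- (lower_axis l - e)) = q powr (- (lower_axis ?k - e))"
        using lower_axis_src[OF wv] by simp
      also have "\<dots> \<le> C1 * real (cov {?k} q F)" using C1(2) q by blast
      also have "\<dots> \<le> C1 * ((5 * (q / c1) / q) ^ 3 * real (cov {?k} (q / c1) F))"
        using C1(1) q c1(1,2) bounded_F by (intro mult_left_mono cov_refine) (auto simp: field_simps)
      also have "\<dots> = D * real (cov (src (w @ v t) ` {l}) (q / c1) F)"
        unfolding D_def using q by simp
      also have "\<dots> \<le> D * real (cov UNIV ?z (cyl (w @ v t)))"
      proof -
        have "cov (src (w @ v t) ` {l}) (q / c1) F \<le> cov {l} ?z (cyl (w @ v t))"
          using len pos by (intro cov_src_le_cov_cyl[OF wv]) auto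
        also have "\<dots> \<le> cov UNIV ?z (cyl (w @ v t))"
          using pos by (intro cov_mono[OF bounded_cyl[OF wv]]) auto
        finally show ?thesis using D by simp
      qed
      finally show ?thesis using D by (simp add: field_simps)
    qed
    have plane_lower: "R powr (- (lower_plane m - e)) / C2 * c1 \<le> real (card X)"
    proof -
      have "R powr (- (lower_plane m - e)) = R powr (- (lower_plane (src w m) - e))"
        using lower_plane_src[OF w] by simp
      also have "\<dots> \<le> C2 * real (cov {a, b} R F)" unfolding plane using C2(2) R by blast
      finally have "R powr (- (lower_plane m - e)) / C2 \<le> real (cov {a, b} R F)"
        using C2(1) by (simp add: field_simps)
      then have "R powr (- (lower_plane m - e)) / C2 * c1 \<le> real (cov {a, b} R F) * c1"
        using c1(1) by (intro mult_right_mono) auto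
      then show ?thesis using X(2) by (simp add: mult.commute)
    qed
    have quot: "(?x / ?y) powr lower_axis l = q powr (- lower_axis l)" "(?y / ?z) powr lower_plane m = R powr (- lower_plane m)"
      unfolding q_def R_def using pos by (simp_all add: powr_divide powr_minus field_simps)
    have "c * ?z powr e * wt lower_axis lower_plane 0 w l m =
      c * (?z powr e * ((?x / ?y) powr lower_axis l * (?y / ?z) powr lower_plane m))"
      unfolding wt_def using mid_eq[OF w axes(1)[symmetric] axes(2) axes(4) axes(3)] pos by simp
    also have "\<dots> \<le> c * (q powr (- (lower_axis l - e)) * R powr (- (lower_plane m - e)))"
    proof (rule mult_left_mono)
      have "?z powr e \<le> (?z / ?x) powr e"
        using pos ord assms(2) by (intro powr_mono2) (auto simp: field_simps)
      also have "\<dots> = q powr e * R powr e"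
        unfolding q_def R_def using pos by (subst powr_mult[symmetric]) (auto simp: field_simps)
      finally have "?z powr e * (q powr (- lower_axis l) * R powr (- lower_plane m)) \<le>
        (q powr e * R powr e) * (q powr (- lower_axis l) * R powr (- lower_plane m))"
        by (intro mult_right_mono) auto
      also have "\<dots> = (q powr e * q powr (- lower_axis l)) * (R powr e * R powr (- lower_plane m))"
        by (simp add: ac_simps)
      also have "\<dots> = q powr (- (lower_axis l - e)) * R powr (- (lower_plane m - e))"
        by (simp add: powr_add[symmetric])
      finally show "?z powr e * ((?x / ?y) powr lower_axis l * (?y / ?z) powr lower_plane m) \<le>
        q powr (- (lower_axis l - e)) * R powr (- (lower_plane m - e))"
        unfolding quot .
    qed (use c in simp)
    also have "\<dots> = (R powr (- (lower_plane m - e)) / C2 * c1) * (q powr (- (lower_axis l - e)) / D)"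
      unfolding c_def by simp
    also have "\<dots> \<le> real (card X) * (q powr (- (lower_axis l - e)) / D)"
      using plane_lower D by (intro mult_right_mono) auto
    also have "\<dots> = (\<Sum>t\<in>X. q powr (- (lower_axis l - e)) / D)" by simp
    also have "\<dots> \<le> (\<Sum>t\<in>X. real (cov UNIV ?z (cyl (w @ v t))))" using piece by (rule sum_mono)
    also have "\<dots> = real (\<Sum>t\<in>X. cov UNIV ?z (cyl (w @ v t)))" by simp
    also have "(\<Sum>t\<in>X. cov UNIV ?z (cyl (w @ v t))) \<le> cov UNIV ?z (cyl w)"
    proof (rule sum_cov_separated[OF bounded_cyl[OF w] pos(3) X(1)])
      show "cyl (w @ v t) \<subseteq> cyl w" if "t \<in> X" for t
        using cyl_subset[OF v(1)[OF that]] unfolding cyl_append by (auto simp: cyl_def)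
      fix s t p q assume st: "s \<in> X" "t \<in> X" "s \<noteq> t" and pq: "p \<in> cyl (w @ v s)" "q \<in> cyl (w @ v t)"
      obtain p' where p': "p' \<in> cyl (v s)" "p = word_map S w p'" using pq(1) unfolding cyl_append by blast
      obtain q' where q': "q' \<in> cyl (v t)" "q = word_map S w q'" using pq(2) unfolding cyl_append by blast
      obtain k' where k': "k' \<in> {a, b}" "R < \<bar>p' $ k' - q' $ k'\<bar>" using sep st p'(1) q'(1) by blast
      obtain k where k: "k \<in> {l, n}" "src w k = k'" using k'(1) ab by blast
      have "?y \<le> len w k" using k(1) ord by auto
      have "?z < ?y * \<bar>p' $ k' - q' $ k'\<bar>" unfolding R(3) using k'(2) pos(2) by (intro mult_strict_left_mono)
      also have "\<dots> \<le> len w k * \<bar>p' $ k' - q' $ k'\<bar>" using \<open>?y \<le> len w k\<close> by (intro mult_right_mono) auto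
      also have "\<dots> = \<bar>p $ k - q $ k\<bar>" unfolding p'(2) q'(2) word_map_diff_nth[OF w] k(2) ..
      finally show "\<exists>k\<in>UNIV. ?z < \<bar>p $ k - q $ k\<bar>" by blast
    qed
    finally show ?thesis by simp
  qed
  with c show thesis by (rule that)
qed

text \<open>
  The axes \<open>src w l\<close> and \<open>src w n\<close> are those of \<open>F\<close> that become the longest and the middle one of
  the cylinder.
\<close>

definition aligned_word :: "'i list \<Rightarrow> bool" where
  "aligned_word w \<longleftrightarrow> (\<exists>l n m. l \<noteq> n \<and> n \<noteq> m \<and> l \<noteq> m \<and> UNIV = {l, n, m} \<and> chamber w l m \<and>
     alignable (src w l) (src w n))"

lemma cov_cyl_lower:
  assumes "0 < e" "\<And>w. w \<in> lists I \<Longrightarrow> aligned_word w"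
  shows "\<exists>c>0. \<forall>w\<in>lists I. \<forall>l m. chamber w l m \<longrightarrow>
    c * len w m powr e * wt lower_axis lower_plane 0 w l m \<le> real (cov UNIV (len w m) (cyl w))"
proof -
  define Q where "Q a b c \<longleftrightarrow> (\<forall>w l n m. w \<in> lists I \<longrightarrow> l \<noteq> n \<longrightarrow> n \<noteq> m \<longrightarrow> l \<noteq> m \<longrightarrow> UNIV = {l, n, m} \<longrightarrow>
    chamber w l m \<longrightarrow> src w l = a \<longrightarrow> src w n = b \<longrightarrow>
    c * len w m powr e * wt lower_axis lower_plane 0 w l m \<le> real (cov UNIV (len w m) (cyl w)))" for a b and c :: real
  have "\<exists>c>0. alignable a b \<longrightarrow> Q a b c" for a b
  proof (cases "alignable a b")
    case True
    then show ?thesis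
      by (rule cov_cyl_lower_aligned[OF _ assms(1)]) (unfold Q_def, blast)
  qed (auto intro: exI[of _ 1])
  then obtain c where c: "\<And>a b. 0 < c a b" "\<And>a b. alignable a b \<Longrightarrow> Q a b (c a b)" by metis
  define c0 where "c0 = Min (range (\<lambda>(a, b). c a b))"
  have c0: "0 < c0" unfolding c0_def using c(1) by (subst Min_gr_iff) auto
  have c0_le: "c0 \<le> c a b" for a b unfolding c0_def by (rule Min_le) auto
  have "c0 * len w m powr e * wt lower_axis lower_plane 0 w l m \<le> real (cov UNIV (len w m) (cyl w))"
    if w: "w \<in> lists I" and ch: "chamber w l m" for w l m
  proof -
    obtain l' n m' where a: "l' \<noteq> n" "n \<noteq> m'" "l' \<noteq> m'" "UNIV = {l', n, m'}" and ch': "chamber w l' m'"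
      and al: "alignable (src w l') (src w n)"
      using assms(2)[OF w] unfolding aligned_word_def by blast
    have lenm: "len w m = len w m'" using ch ch' unfolding chamber_def by (auto intro: antisym)
    have wt: "wt lower_axis lower_plane 0 w l m = wt lower_axis lower_plane 0 w l' m'"
      by (rule wt_chamber_cong[OF w ch ch'])
    have "c0 * len w m powr e * wt lower_axis lower_plane 0 w l m \<le>
      c (src w l') (src w n) * len w m' powr e * wt lower_axis lower_plane 0 w l' m'"
      unfolding lenm wt using c0_le wt_pos[OF w ch', of lower_axis lower_plane 0]
      by (intro mult_right_mono) auto
    also have "\<dots> \<le> real (cov UNIV (len w m') (cyl w))"
      using c(2)[OF al] w a ch' unfolding Q_def by blast
    finally show ?thesis unfolding lenm .
  qed
  then show ?thesis using c0 by blast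
qed

end

section \<open>Singular values and edge lengths\<close>

lemma cubic_roots_unique:
  fixes a b c a' b' c' :: real
  assumes "a \<ge> b" "b \<ge> c" "a' \<ge> b'" "b' \<ge> c'"
    and eq: "\<And>t. (t - a) * (t - b) * (t - c) = (t - a') * (t - b') * (t - c')"
  shows "a = a'" "b = b'" "c = c'"
proof -
  have "a = a' \<or> a = b' \<or> a = c'" "a' = a \<or> a' = b \<or> a' = c" using eq[of a] eq[of a'] by auto
  then show a: "a = a'" using assms(1-4) by auto
  have quad: "(t - b) * (t - c) = (t - b') * (t - c')" if "t \<noteq> a" for t
    using eq[of t] that a by (simp add: mult.assoc)
  have "(a + 1 - b) * (a + 1 - c) = (a + 1 - b') * (a + 1 - c')" "(a + 2 - b) * (a + 2 - c) = (a + 2 - b') * (a + 2 - c')"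
    by (rule quad, simp)+
  then have sum: "b + c = b' + c'" by (simp add: algebra_simps)
  have "(a + 1 - b) * (a + 1 - c) = (a + 1) * (a + 1) - (a + 1) * (b + c) + b * c"
    "(a + 1 - b') * (a + 1 - c') = (a + 1) * (a + 1) - (a + 1) * (b' + c') + b' * c'"
    by (simp_all add: algebra_simps)
  then have prod: "b * c = b' * c'"
    using quad[of "a + 1"] sum by simp
  have "(b - b') * (b - c') = b * b - b * (b' + c') + b' * c'" by (simp add: algebra_simps)
  also have "\<dots> = 0" unfolding sum[symmetric] prod[symmetric] by (simp add: algebra_simps)
  finally have "b = b' \<or> b = c'" by simp
  then show "b = b'" using sum assms(2,4) by auto
  then show "c = c'" using sum by simp
qed

lemma singular_values_eqI:
  fixes A :: "real^3^3"
  assumes "a \<ge> b" "b \<ge> c" "c \<ge> 0" "\<And>t. det (mat t - transpose A ** A) = (t - a\<^sup>2) * (t - b\<^sup>2) * (t - c\<^sup>2)"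
  shows "singular_values A = [a, b, c]"
  unfolding singular_values_def
proof (rule the_equality)
  show "length [a, b, c] = CARD(3) \<and> sorted_wrt (\<ge>) [a, b, c] \<and> (\<forall>x\<in>set [a, b, c]. 0 \<le> x) \<and>
    (\<forall>t. det (mat t - transpose A ** A) = (\<Prod>x\<leftarrow>[a, b, c]. t - x\<^sup>2))"
    using assms by (auto simp: mult.assoc)
  fix xs :: "real list" assume xs: "length xs = CARD(3) \<and> sorted_wrt (\<ge>) xs \<and> (\<forall>x\<in>set xs. 0 \<le> x) \<and>
    (\<forall>t. det (mat t - transpose A ** A) = (\<Prod>x\<leftarrow>xs. t - x\<^sup>2))"
  then have "length xs = Suc (Suc (Suc 0))" by simp
  then obtain x y z where xyz: "xs = [x, y, z]" by (auto simp: length_Suc_conv)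
  have ord: "x \<ge> y" "y \<ge> z" "z \<ge> 0" using xs unfolding xyz by auto
  have "(t - x\<^sup>2) * (t - y\<^sup>2) * (t - z\<^sup>2) = (t - a\<^sup>2) * (t - b\<^sup>2) * (t - c\<^sup>2)" for t
    using xs assms(4)[of t] unfolding xyz by (simp add: mult.assoc)
  moreover have "x\<^sup>2 \<ge> y\<^sup>2" "y\<^sup>2 \<ge> z\<^sup>2" "a\<^sup>2 \<ge> b\<^sup>2" "b\<^sup>2 \<ge> c\<^sup>2" using ord assms(1-3) by (auto intro!: power_mono)
  ultimately have "x\<^sup>2 = a\<^sup>2" "y\<^sup>2 = b\<^sup>2" "z\<^sup>2 = c\<^sup>2" by (rule cubic_roots_unique[of "y\<^sup>2" "x\<^sup>2" "z\<^sup>2" "b\<^sup>2" "a\<^sup>2" "c\<^sup>2", rotated 4])+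
  then show "xs = [a, b, c]" unfolding xyz using ord assms(1-3) by (auto simp: power2_eq_iff_nonneg)
qed

context sponge
begin

lemma abs_linear_part_nth:
  assumes "w \<in> lists I"
  shows "\<bar>linear_part (word_map S w) $ k $ j\<bar> = (if j = src w k then len w k else 0)"
proof -
  have "linear_part (word_map S w) $ k $ j = word_map S w (axis j 1) $ k - word_map S w 0 $ k"
    unfolding linear_part_def matrix_def by simp
  then have "\<bar>linear_part (word_map S w) $ k $ j\<bar> = len w k * \<bar>axis j 1 $ src w k - (0 :: real^3) $ src w k\<bar>"
    using word_map_diff_nth[OF assms] by metis
  then show ?thesis by (auto simp: axis_def)
qed

text \<open>The product of the transposed matrix with the matrix is diagonal, with the squares of the edge lengths as entries.\<close>

lemma singular_values_word:
  assumes w: "w \<in> lists I" and axes: "l \<noteq> n" "n \<noteq> m" "l \<noteq> m" "UNIV = {l, n, m}" and ch: "chamber w l m"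
  shows "singular_values (linear_part (word_map S w)) = [len w l, len w n, len w m]"
proof (rule singular_values_eqI)
  show "len w n \<le> len w l" "len w m \<le> len w n" using ch unfolding chamber_def by auto
  show "0 \<le> len w m" using len_pos[OF w] by (rule less_imp_le)
  fix t :: real
  define A where "A = linear_part (word_map S w)"
  have A0: "A $ k $ j = 0" if "j \<noteq> src w k" for k j
    using abs_linear_part_nth[OF w, of k j] that unfolding A_def by simp
  have A1: "(A $ k $ src w k)\<^sup>2 = (len w k)\<^sup>2" for k
    using abs_linear_part_nth[OF w, of k "src w k"] unfolding A_def by (metis power2_abs)
  have inj: "inj (src w)" and bij: "bij (src w)" using bij_src[OF w] by (auto dest: bij_is_inj)
  have ATA: "(transpose A ** A) $ i $ j = (\<Sum>k\<in>UNIV. A $ k $ i * A $ k $ j)" for i j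
    by (simp add: matrix_matrix_mult_def transpose_def)
  have off: "(mat t - transpose A ** A) $ i $ j = 0" if "i \<noteq> j" for i j
  proof -
    have zero: "A $ k $ i * A $ k $ j = 0" for k using A0[of i k] A0[of j k] that by (cases "i = src w k") auto
    have "(transpose A ** A) $ i $ j = 0" unfolding ATA using zero by (intro sum.neutral) auto
    then show ?thesis using that by (simp add: mat_def)
  qed
  have diag: "(mat t - transpose A ** A) $ src w k $ src w k = t - (len w k)\<^sup>2" for k
  proof -
    have "(transpose A ** A) $ src w k $ src w k = (\<Sum>k'\<in>{k}. A $ k' $ src w k * A $ k' $ src w k)"
      unfolding ATA
    proof (rule sum.mono_neutral_right)
      show "\<forall>k'\<in>UNIV - {k}. A $ k' $ src w k * A $ k' $ src w k = 0"
      proof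
        fix k' assume "k' \<in> UNIV - {k}"
        then have "src w k \<noteq> src w k'" using inj by (auto simp: inj_eq)
        then show "A $ k' $ src w k * A $ k' $ src w k = 0" using A0 by simp
      qed
    qed auto
    then show ?thesis using A1[of k] by (simp add: mat_def power2_eq_square)
  qed
  have "det (mat t - transpose A ** A) = (\<Prod>i\<in>UNIV. (mat t - transpose A ** A) $ i $ i)"
    using off by (rule det_diagonal)
  also have "\<dots> = (\<Prod>k\<in>UNIV. (mat t - transpose A ** A) $ src w k $ src w k)"
    by (rule prod.reindex_bij_betw[OF bij, symmetric])
  also have "\<dots> = (\<Prod>k\<in>{l, n, m}. t - (len w k)\<^sup>2)" unfolding diag axes(4) ..
  also have "\<dots> = (t - (len w l)\<^sup>2) * (t - (len w n)\<^sup>2) * (t - (len w m)\<^sup>2)" using axes(1-3) by simp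
  finally show "det (mat t - transpose (linear_part (word_map S w)) ** linear_part (word_map S w)) =
    (t - (len w l)\<^sup>2) * (t - (len w n)\<^sup>2) * (t - (len w m)\<^sup>2)" unfolding A_def .
qed

lemma sing_fun_eq_wt:
  assumes w: "w \<in> lists I" and ch: "chamber w l m" and p: "q1 w = p1 l" "q2 w = p2 m"
  shows "sing_fun S q1 q2 s w = wt p1 p2 s w l m"
proof -
  obtain l' n m' where a: "l' \<noteq> n" "n \<noteq> m'" "l' \<noteq> m'" "UNIV = {l', n, m'}" and ch': "chamber w l' m'"
    by (rule ex_chamber[of w]) blast
  have eq: "len w l' = len w l" "len w m' = len w m"
    using ch ch' unfolding chamber_def by (auto intro: antisym)
  have mid: "len w n = mid w l m"
    using mid_eq[OF w a(1)[symmetric] a(2) a(4) a(3)] eq unfolding mid_def by simp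
  have alpha: "alpha S 1 w = len w l" "alpha S 2 w = mid w l m" "alpha S 3 w = len w m"
    unfolding alpha_def singular_values_word[OF w a ch'] using eq mid by simp_all
  have pos: "0 < len w l" "0 < mid w l m" "0 < len w m" using len_pos[OF w] mid_bounds(5)[OF w ch] by auto
  then show ?thesis
    unfolding sing_fun_def alpha p wt_def by (simp add: powr_divide powr_diff field_simps)
qed

lemma edge_length_eq_len:
  assumes "w \<in> lists I"
  shows "edge_length (word_map S w ` unit_cube) k = len w k"
proof -
  let ?E = "(\<lambda>x. x $ k) ` word_map S w ` unit_cube"
  define e :: "real^3" where "e = axis (src w k) 1"
  have cube: "0 \<in> unit_cube" "e \<in> unit_cube" unfolding unit_cube_def e_def by (auto simp: mem_box_cart axis_def)
  have dist: "dist (word_map S w x $ k) (word_map S w y $ k) \<le> len w k" if "x \<in> unit_cube" "y \<in> unit_cube" for x y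
  proof -
    have "0 \<le> x $ src w k" "x $ src w k \<le> 1" "0 \<le> y $ src w k" "y $ src w k \<le> 1"
      using that unfolding unit_cube_def by (auto simp: mem_box_cart)
    then have "\<bar>x $ src w k - y $ src w k\<bar> \<le> 1" by linarith
    then show ?thesis
      unfolding dist_real_def word_map_diff_nth[OF assms] using len_pos[OF assms, of k] by simp
  qed
  have "diameter ?E \<le> len w k"
    using dist[unfolded dist_real_def] len_pos[OF assms, of k]
    by (intro diameter_le) (auto simp: less_imp_le)
  moreover have "len w k \<le> diameter ?E"
  proof -
    have "bounded ?E"
      unfolding bounded_two_points using dist by blast
    moreover have "word_map S w e $ k \<in> ?E" "word_map S w 0 $ k \<in> ?E" using cube by auto
    ultimately have "dist (word_map S w e $ k) (word_map S w 0 $ k) \<le> diameter ?E"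
      by (rule diameter_bounded_bound)
    then show ?thesis unfolding dist_real_def word_map_diff_nth[OF assms] by (simp add: e_def)
  qed
  ultimately show ?thesis unfolding edge_length_def by (rule antisym)
qed

lemma words_lists: "w \<in> words I \<longleftrightarrow> w \<in> lists I \<and> w \<noteq> []"
  unfolding words_def by (auto simp: words_of_length_lists Suc_le_eq)

lemma axis_choice_chamber:
  assumes "axis_choice I S l m" "w \<in> lists I"
  shows "chamber w (l w) (m w)"
proof (cases "w = []")
  case False
  then have "w \<in> words I" using assms(2) by (simp add: words_lists)
  then have "\<forall>k. edge_length (word_map S w ` unit_cube) k \<le> edge_length (word_map S w ` unit_cube) (l w) \<and>
     edge_length (word_map S w ` unit_cube) (m w) \<le> edge_length (word_map S w ` unit_cube) k"
    using assms(1) unfolding axis_choice_def by blast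
  then show ?thesis unfolding chamber_def edge_length_eq_len[OF assms(2)] .
qed (simp add: chamber_def)

end

context sponge_weights
begin

lemma pressure_eq_rate:
  assumes "\<And>w. w \<in> words I \<Longrightarrow> q1 w = p1 (l w)" "\<And>w. w \<in> words I \<Longrightarrow> q2 w = p2 (m w)" "0 \<le> s"
  shows "pressure I S q1 q2 s = rate s"
proof -
  have "(\<Sum>w\<in>words_of_length I n. sing_fun S q1 q2 s w) = total s n" if "1 \<le> n" for n
    unfolding total_def
  proof (rule sum.cong[OF refl])
    fix w assume "w \<in> words_of_length I n"
    then have w: "w \<in> lists I" "w \<in> words I" using that by (auto simp: words_of_length_lists words_lists)
    show "sing_fun S q1 q2 s w = \<psi> s w"
      unfolding \<psi>_def using sing_fun_eq_wt[OF w(1) chamber_lm[OF w(1)]] assms(1,2)[OF w(2)] by simp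
  qed
  then have "eventually (\<lambda>n. root n (total s n) = root n (\<Sum>w\<in>words_of_length I n. sing_fun S q1 q2 s w)) sequentially"
    unfolding eventually_sequentially by (intro exI[of _ 1]) simp
  from Lim_transform_eventually[OF total_root_tendsto[OF assms(3)] this]
  show ?thesis unfolding pressure_def by (rule limI)
qed

lemma pressure_zero_eq_s0:
  assumes "\<And>w. w \<in> words I \<Longrightarrow> q1 w = p1 (l w)" "\<And>w. w \<in> words I \<Longrightarrow> q2 w = p2 (m w)"
  shows "pressure_zero I S q1 q2 = s0"
proof -
  have "0 < s \<and> pressure I S q1 q2 s = 1 \<longleftrightarrow> 0 < s \<and> rate s = 1" for s
    using pressure_eq_rate[of q1 q2 s] assms by (cases "0 < s") auto
  then show ?thesis unfolding pressure_zero_def s0_def by simp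
qed

end

context sponge
begin

lemma upper_box_dim_le_upper_s0:
  assumes "axis_choice I S l m"
  shows "upper_box_dim F \<le> ereal (upper_s0 I S F l m)"
proof -
  interpret sponge_weights I S F qA_axis upper_plane l m
    by unfold_locales (auto simp: qA_axis_nonneg upper_plane_nonneg axis_choice_chamber[OF assms])
  have "upper_s0 I S F l m = s0"
    unfolding upper_s0_def
    by (rule pressure_zero_eq_s0) (auto simp: upper_p1_def upper_p2_def qA_axis_def upper_plane_def proj1_def proj2_def)
  moreover have "upper_box_dim F \<le> ereal s0"
  proof (rule upper_box_dim_le_s0)
    fix e :: real assume "0 < e"
    then obtain C where "0 < C" "\<And>w l m. w \<in> lists I \<Longrightarrow> chamber w l m \<Longrightarrow>
      real (cov UNIV (len w m) (cyl w)) \<le> C * len w m powr (- e) * wt qA_axis upper_plane 0 w l m"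
      using cov_cyl_upper by blast
    then show "\<exists>C>0. \<forall>w\<in>lists I. real (cov UNIV (len w (m w)) (cyl w)) \<le> C * len w (m w) powr (- e) * \<psi> 0 w"
      unfolding \<psi>_def using chamber_lm by blast
  qed
  ultimately show ?thesis by simp
qed

lemma lower_s0_le_lower_box_dim:
  assumes "axis_choice I S l m" "COSC I S" "\<And>w. w \<in> lists I \<Longrightarrow> aligned_word w"
  shows "ereal (lower_s0 I S F l m) \<le> lower_box_dim F"
proof -
  interpret sponge_weights I S F lower_axis lower_plane l m
    by unfold_locales (auto simp: lower_axis_nonneg lower_plane_nonneg axis_choice_chamber[OF assms(1)])
  have "lower_s0 I S F l m = s0"
    unfolding lower_s0_def
    by (rule pressure_zero_eq_s0) (auto simp: lower_p1_def lower_p2_def lower_axis_def lower_plane_def proj1_def proj2_def)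
  moreover have "ereal s0 \<le> lower_box_dim F"
  proof (rule lower_box_dim_ge_s0[OF assms(2)])
    fix e :: real assume "0 < e"
    then obtain c where "0 < c" "\<forall>w\<in>lists I. \<forall>l m. chamber w l m \<longrightarrow>
      c * len w m powr e * wt lower_axis lower_plane 0 w l m \<le> real (cov UNIV (len w m) (cyl w))"
      using cov_cyl_lower assms(3) by blast
    then show "\<exists>c>0. \<forall>w\<in>lists I. c * len w (m w) powr e * \<psi> 0 w \<le> real (cov UNIV (len w (m w)) (cyl w))"
      unfolding \<psi>_def using chamber_lm by blast
  qed
  ultimately show ?thesis by simp
qed


section \<open>The three classes\<close>

lemma ordered_sponge_words:
  assumes "ordered_sponge I S \<sigma>" "w \<in> lists I"
  shows "src w k = k" "len w (\<sigma> 2) \<le> len w (\<sigma> 1)" "len w (\<sigma> 3) \<le> len w (\<sigma> 2)"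
proof -
  have src1: "src1 i k = k" if "i \<in> I" for i k
  proof -
    have "linear_part (S i) $ k $ src1 i k \<noteq> 0" using len1_pos[OF that, of k] unfolding len1_def by auto
    then show ?thesis using assms(1) that unfolding ordered_sponge_def Let_def by metis
  qed
  have len1: "len1 i (\<sigma> 2) \<le> len1 i (\<sigma> 1)" "len1 i (\<sigma> 3) \<le> len1 i (\<sigma> 2)" if "i \<in> I" for i
    using assms(1) that unfolding ordered_sponge_def Let_def len1_def src1[OF that] by auto
  have "(\<forall>k. src w k = k) \<and> len w (\<sigma> 2) \<le> len w (\<sigma> 1) \<and> len w (\<sigma> 3) \<le> len w (\<sigma> 2)"
    using assms(2)
  proof (induction w)
    case (Cons i w)
    then have i: "i \<in> I" and w: "w \<in> lists I" by auto
    show ?case using Cons len1[OF i] src1[OF i] len1_pos[OF i] len_pos[OF w]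
      by (auto intro!: mult_mono simp: less_imp_le)
  qed simp
  then show "src w k = k" "len w (\<sigma> 2) \<le> len w (\<sigma> 1)" "len w (\<sigma> 3) \<le> len w (\<sigma> 2)" by auto
qed

lemma ordered_sponge_aligned:
  assumes "ordered_sponge I S \<sigma>" "w \<in> lists I"
  shows "aligned_word w"
  unfolding aligned_word_def
proof (intro exI conjI)
  have bij: "bij \<sigma>" using assms(1) unfolding ordered_sponge_def by simp
  then have inj: "inj \<sigma>" by (rule bij_is_inj)
  show "\<sigma> 1 \<noteq> \<sigma> 2" "\<sigma> 2 \<noteq> \<sigma> 3" "\<sigma> 1 \<noteq> \<sigma> 3" using inj by (auto dest!: injD)
  show U: "UNIV = {\<sigma> 1, \<sigma> 2, \<sigma> 3}" using bij_is_surj[OF bij] unfolding UNIV_3 by auto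
  have "len w k \<le> len w (\<sigma> 1) \<and> len w (\<sigma> 3) \<le> len w k" for k
  proof -
    have "k = \<sigma> 1 \<or> k = \<sigma> 2 \<or> k = \<sigma> 3" using U by auto
    then show ?thesis using ordered_sponge_words(2,3)[OF assms] by auto
  qed
  then show "chamber w (\<sigma> 1) (\<sigma> 3)" unfolding chamber_def by blast
  show "alignable (src w (\<sigma> 1)) (src w (\<sigma> 2))"
    unfolding alignable_def ordered_sponge_words(1)[OF assms] using ordered_sponge_words(2)[OF assms(1)] by blast
qed

lemma S2_sponge_words:
  assumes "S2_sponge I S" "w \<in> lists I"
  shows "src w 3 = 3" "len w 3 \<le> len w k"
proof -
  have *: "src1 i 3 = 3 \<and> (\<forall>k. len1 i 3 \<le> len1 i k)" if i: "i \<in> I" for i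
  proof -
    let ?A = "linear_part (S i)"
    obtain a b c where A: "?A = diag_matrix a b c \<or> ?A = swap_matrix a b c" and abc: "min \<bar>a\<bar> \<bar>b\<bar> \<ge> \<bar>c\<bar>"
      using assms(1) i unfolding S2_sponge_def by blast
    have nz: "?A $ k $ src1 i k \<noteq> 0" for k using len1_pos[OF i, of k] unfolding len1_def by auto
    have ent: "?A $ 3 $ 1 = 0" "?A $ 3 $ 2 = 0" "?A $ 3 $ 3 = c"
      "?A $ 1 $ j \<in> {0, a, b}" "?A $ 2 $ j \<in> {0, a, b}" for j
      using A exhaust_3[of j] unfolding diag_matrix_def swap_matrix_def by auto
    have src3: "src1 i 3 = 3" using nz[of 3] ent(1,2) exhaust_3[of "src1 i 3"] by metis
    have "len1 i 3 \<le> len1 i k" for k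
    proof -
      have 3: "len1 i 3 = \<bar>c\<bar>" unfolding len1_def src3 ent(3) ..
      have 12: "len1 i 1 \<in> {\<bar>a\<bar>, \<bar>b\<bar>}" "len1 i 2 \<in> {\<bar>a\<bar>, \<bar>b\<bar>}"
        using nz[of 1] nz[of 2] ent(4)[of "src1 i 1"] ent(5)[of "src1 i 2"] unfolding len1_def by auto
      have "k = 1 \<or> k = 2 \<or> k = 3" by (rule exhaust_3)
      then show ?thesis using 3 12 abc by auto
    qed
    with src3 show ?thesis by blast
  qed
  have "src w 3 = 3 \<and> (\<forall>k. len w 3 \<le> len w k)"
    using assms(2)
  proof (induction w)
    case (Cons i w)
    then have i: "i \<in> I" and w: "w \<in> lists I" by auto
    show ?case using Cons *[OF i] len1_pos[OF i] len_pos[OF w]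
      by (auto intro!: mult_mono simp: less_imp_le)
  qed simp
  then show "src w 3 = 3" "len w 3 \<le> len w k" by auto
qed

lemma S2_sponge_swap:
  assumes "S2_sponge I S"
  shows "\<exists>j\<in>lists I. src j 1 = 2 \<and> src j 2 = 1"
proof -
  obtain i a b c where i: "i \<in> I" and A: "linear_part (S i) = swap_matrix a b c"
    using assms unfolding S2_sponge_def by blast
  have nz: "linear_part (S i) $ k $ src1 i k \<noteq> 0" for k using len1_pos[OF i, of k] unfolding len1_def by auto
  have "linear_part (S i) $ 1 $ 1 = 0" "linear_part (S i) $ 1 $ 3 = 0"
    "linear_part (S i) $ 2 $ 2 = 0" "linear_part (S i) $ 2 $ 3 = 0"
    unfolding A swap_matrix_def by simp_all
  then have "src1 i 1 = 2" "src1 i 2 = 1"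
    using nz[of 1] nz[of 2] exhaust_3[of "src1 i 1"] exhaust_3[of "src1 i 2"] by metis+
  then show ?thesis using i by (intro bexI[of _ "[i]"]) auto
qed

lemma S2_sponge_aligned:
  assumes "S2_sponge I S" "w \<in> lists I"
  shows "aligned_word w"
proof -
  note words = S2_sponge_words[OF assms]
  have swap: "alignable 1 2" "alignable 2 1"
    using S2_sponge_swap[OF assms(1)] unfolding alignable_def by blast+
  have inj: "inj (src w)" using bij_src[OF assms(2)] by (rule bij_is_inj)
  have ne3: "src w 1 \<noteq> 3" "src w 2 \<noteq> 3" and ne: "src w 1 \<noteq> src w 2"
  proof -
    have "src w 1 \<noteq> src w 3" "src w 2 \<noteq> src w 3" "src w 1 \<noteq> src w 2" using inj by (simp_all add: inj_eq)
    then show "src w 1 \<noteq> 3" "src w 2 \<noteq> 3" "src w 1 \<noteq> src w 2" unfolding words(1) by auto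
  qed
  have al: "alignable (src w 1) (src w 2)" "alignable (src w 2) (src w 1)"
    using exhaust_3[of "src w 1"] exhaust_3[of "src w 2"] ne3 ne swap by metis+
  have ch: "chamber w a 3" if "len w b \<le> len w a" "UNIV = {a, b, 3}" for a b
    unfolding chamber_def
  proof
    fix k
    have "k = a \<or> k = b \<or> k = 3" using that(2) by auto
    then show "len w k \<le> len w a \<and> len w 3 \<le> len w k" using that(1) words(2) by auto
  qed
  have U: "(UNIV :: 3 set) = {1, 2, 3}" "(UNIV :: 3 set) = {2, 1, 3}" by (auto simp: UNIV_3)
  show ?thesis
  proof (cases "len w 2 \<le> len w 1")
    case True
    then show ?thesis
      unfolding aligned_word_def using U(1) al(1) ch[OF True U(1)]
      by (intro exI[of _ 1] exI[of _ 2] exI[of _ 3] conjI) simp_all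
  next
    case False
    then have le: "len w 1 \<le> len w 2" by simp
    show ?thesis
      unfolding aligned_word_def using U(2) al(2) ch[OF le U(2)]
      by (intro exI[of _ 2] exI[of _ 1] exI[of _ 3] conjI) simp_all
  qed
qed

text \<open>
  The permutations of the axes induced by words form a group that contains the generators of
  \<open>G\<close>; if \<open>G\<close> has six elements, these are all permutations.
\<close>

lemma S3_sponge_all_permutations:
  assumes "S3_sponge I S" "bij g"
  shows "\<exists>w\<in>lists I. src w = g"
proof -
  let ?G = "BijGroup (UNIV :: 3 set)"
  let ?H = "(\<lambda>i. axis_perm (linear_part (S i))) ` I"
  have carrier: "carrier ?G = {f. bij f}"
    by (auto simp: BijGroup_def Bij_def)
  have mult: "f \<otimes>\<^bsub>?G\<^esub> h = f \<circ> h" if "bij f" "bij h" for f h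
    using that by (auto simp: BijGroup_def Bij_def compose_def fun_eq_iff)
  have one: "\<one>\<^bsub>?G\<^esub> = id" by (auto simp: BijGroup_def)
  have grp: "group ?G" by (rule group_BijGroup)
  have H: "axis_perm (linear_part (S i)) \<in> src ` lists I" "inv\<^bsub>?G\<^esub> (axis_perm (linear_part (S i))) \<in> src ` lists I"
    if i: "i \<in> I" for i
  proof -
    let ?p = "axis_perm (linear_part (S i))"
    have p: "?p (src1 i k) = k" for k unfolding src1_def by (rule axis_perm_row_axis[OF gen_perm[OF i]])
    have s: "src [i] = src1 i" by auto
    have i': "[i] \<in> lists I" using i by simp
    obtain w where w: "w \<in> lists I" "\<And>k. src w (src [i] k) = k" using ex_return_word[OF i'] by blast
    have "?p k = src w k" for k
      using p w(2) bij_src1[OF i] unfolding s by (metis bij_pointE)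
    then have pw: "?p = src w" by auto
    then show "?p \<in> src ` lists I" using w(1) by blast
    have bij: "bij ?p" unfolding pw by (rule bij_src[OF w(1)])
    have "src1 i \<circ> ?p = id"
    proof
      fix k obtain j where "k = src1 i j" using bij_src1[OF i] by (meson bij_pointE)
      then show "(src1 i \<circ> ?p) k = id k" using p by simp
    qed
    then have "src1 i \<otimes>\<^bsub>?G\<^esub> ?p = \<one>\<^bsub>?G\<^esub>" using bij bij_src1[OF i] by (simp add: mult one)
    then have "inv\<^bsub>?G\<^esub> ?p = src1 i"
      using bij bij_src1[OF i] by (intro group.inv_equality[OF grp]) (auto simp: carrier)
    then show "inv\<^bsub>?G\<^esub> ?p \<in> src ` lists I" using s i' by (metis imageI)
  qed
  have gen: "f \<in> src ` lists I" if "f \<in> generate ?G (carrier ?G \<inter> ?H)" for f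
    using that
  proof (induction rule: generate.induct)
    case one
    have "id = src []" by auto
    then show ?case unfolding \<open>\<one>\<^bsub>?G\<^esub> = id\<close> by blast
  next
    case (eng f h)
    then obtain u v where uv: "u \<in> lists I" "v \<in> lists I" "f = src u" "h = src v" by blast
    then have "f \<otimes>\<^bsub>?G\<^esub> h = src (v @ u)"
      using bij_src by (subst mult) (auto simp: src_append)
    moreover have "v @ u \<in> lists I" using uv by simp
    ultimately show ?case by blast
  qed (use H in auto)
  have "card (generate ?G (carrier ?G \<inter> ?H)) = card (carrier (sym_group 3))"
  proof -
    obtain f where "f \<in> iso (subgroup_generated ?G ?H) (sym_group 3)"
      using assms(1) unfolding S3_sponge_def is_iso_def by blast
    then show ?thesis
      unfolding iso_def carrier_subgroup_generated by (auto dest: bij_betw_same_card)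
  qed
  also have "\<dots> = fact 3"
  proof -
    have "card {p. p permutes {1..3::nat}} = fact 3" by (rule card_permutations) simp_all
    then show ?thesis by (simp add: sym_group_def)
  qed
  also have "\<dots> = card {f :: 3 \<Rightarrow> 3. bij f}"
  proof -
    have "{f :: 3 \<Rightarrow> 3. bij f} = {f. f permutes UNIV}" by (auto simp: permutes_def bij_iff)
    then show ?thesis by (simp add: card_permutations[of "UNIV :: 3 set" 3])
  qed
  finally have card: "card (generate ?G (carrier ?G \<inter> ?H)) = card {f :: 3 \<Rightarrow> 3. bij f}" .
  have "generate ?G (carrier ?G \<inter> ?H) \<subseteq> {f. bij f}"
    using gen bij_src by blast
  then have "generate ?G (carrier ?G \<inter> ?H) = {f. bij f}"
    using card by (intro card_subset_eq) auto
  then show ?thesis using gen assms(2) by blast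
qed

lemma S3_sponge_transitive:
  assumes "S3_sponge I S"
  shows "\<exists>w\<in>lists I. src w a = b \<and> src w b = a"
proof -
  have "bij (Transposition.transpose a b)" by simp
  then obtain w where "w \<in> lists I" "src w = Transposition.transpose a b"
    using S3_sponge_all_permutations[OF assms] by blast
  then show ?thesis by (intro bexI[of _ w]) simp_all
qed

lemma S3_sponge_aligned:
  assumes "S3_sponge I S"
  shows "aligned_word w"
proof -
  obtain l n m where "l \<noteq> n" "n \<noteq> m" "l \<noteq> m" "UNIV = {l, n, m}" "chamber w l m" by (rule ex_chamber)
  moreover have "alignable (src w l) (src w n)"
    unfolding alignable_def using S3_sponge_transitive[OF assms] by (rule disjI2)
  ultimately show ?thesis
    unfolding aligned_word_def by (intro exI[of _ l] exI[of _ n] exI[of _ m] conjI)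
qed

text \<open>Hence in each class the dimensions of the chosen projections do not depend on the word.\<close>

lemma chosen_axes_same_orbit:
  assumes "S3_sponge I S \<or> S2_sponge I S \<and> S2_choice I l m \<or>
      (\<exists>\<sigma>. ordered_sponge I S \<sigma> \<and> ordered_choice I \<sigma> l m)"
    and "w \<in> words I" "w' \<in> words I"
  shows "(\<exists>j\<in>lists I. src j (l w) = l w') \<and> (\<exists>j\<in>lists I. src j (m w) = m w')"
  using assms(1)
proof (elim disjE)
  assume "S3_sponge I S"
  then show ?thesis using S3_sponge_transitive by blast
next
  assume S2: "S2_sponge I S \<and> S2_choice I l m"
  then have l: "l w \<in> {1, 2}" "l w' \<in> {1, 2}" and m: "m w = 3" "m w' = 3"
    using assms(2,3) unfolding S2_choice_def by auto
  obtain j where j: "j \<in> lists I" "src j 1 = 2" "src j 2 = 1" using S2_sponge_swap S2 by blast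
  consider "l w = l w'" | "l w = 1" "l w' = 2" | "l w = 2" "l w' = 1" using l by auto
  then have "\<exists>j\<in>lists I. src j (l w) = l w'"
  proof cases
    case 1
    then show ?thesis by (intro bexI[of _ "[]"]) auto
  qed (use j in \<open>auto intro!: bexI[of _ j]\<close>)
  moreover have "\<exists>j\<in>lists I. src j (m w) = m w'" using m by (intro bexI[of _ "[]"]) auto
  ultimately show ?thesis by blast
next
  assume "\<exists>\<sigma>. ordered_sponge I S \<sigma> \<and> ordered_choice I \<sigma> l m"
  then have "l w = l w'" "m w = m w'" using assms(2,3) unfolding ordered_choice_def by auto
  then show ?thesis by (intro conjI bexI[of _ "[]"]) auto
qed

lemma upper_s0_eq_lower_s0:
  assumes "S3_sponge I S \<or> S2_sponge I S \<and> S2_choice I l m \<or>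
      (\<exists>\<sigma>. ordered_sponge I S \<sigma> \<and> ordered_choice I \<sigma> l m)"
    and "w \<in> words I" "upper_p1 F l w = lower_p1 F l w" "upper_p2 F m w = lower_p2 F m w"
  shows "upper_s0 I S F l m = lower_s0 I S F l m"
proof -
  have p: "upper_p1 F l w' = qA_axis (l w')" "lower_p1 F l w' = lower_axis (l w')"
    "upper_p2 F m w' = upper_plane (m w')" "lower_p2 F m w' = lower_plane (m w')" for w'
    by (auto simp: upper_p1_def upper_p2_def lower_p1_def lower_p2_def qA_axis_def upper_plane_def
        lower_axis_def lower_plane_def proj1_def proj2_def)
  have eq: "upper_p1 F l w' = lower_p1 F l w'" "upper_p2 F m w' = lower_p2 F m w'" if w': "w' \<in> words I" for w'
  proof -
    obtain j j' where j: "j \<in> lists I" "src j (l w) = l w'" and j': "j' \<in> lists I" "src j' (m w) = m w'"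
      using chosen_axes_same_orbit[OF assms(1,2) w'] by blast
    show "upper_p1 F l w' = lower_p1 F l w'"
      using assms(3) qA_axis_src[OF j(1), of "l w"] lower_axis_src[OF j(1), of "l w"] unfolding p j(2) by simp
    show "upper_p2 F m w' = lower_p2 F m w'"
      using assms(4) upper_plane_src[OF j'(1), of "m w"] lower_plane_src[OF j'(1), of "m w"] unfolding p j'(2) by simp
  qed
  have "root n (\<Sum>w\<in>words_of_length I n. sing_fun S (upper_p1 F l) (upper_p2 F m) s w) =
    root n (\<Sum>w\<in>words_of_length I n. sing_fun S (lower_p1 F l) (lower_p2 F m) s w)" for n s
  proof (cases "n = 0")
    case False
    then have "w \<in> words I" if "w \<in> words_of_length I n" for w
      using that by (auto simp: words_of_length_lists words_lists)
    then have "(\<Sum>w\<in>words_of_length I n. sing_fun S (upper_p1 F l) (upper_p2 F m) s w) =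
      (\<Sum>w\<in>words_of_length I n. sing_fun S (lower_p1 F l) (lower_p2 F m) s w)"
      unfolding sing_fun_def using eq by (intro sum.cong refl) simp
    then show ?thesis by simp
  qed simp
  then have "pressure I S (upper_p1 F l) (upper_p2 F m) s = pressure I S (lower_p1 F l) (lower_p2 F m) s" for s
    unfolding pressure_def by simp
  then show ?thesis unfolding upper_s0_def lower_s0_def pressure_zero_def by simp
qed

end

theorem theorem5p2:
  fixes I :: "'i set" and S :: "'i \<Rightarrow> real^3 \<Rightarrow> real^3" and F :: "(real^3) set"
    and l m :: "'i list \<Rightarrow> 3"
  assumes "sponge_ifs I S" and "attractor I S F" and "axis_choice I S l m"
  shows "upper_box_dim F \<le> ereal (upper_s0 I S F l m) \<and>
    ((S3_sponge I S \<or> S2_sponge I S \<or> (\<exists>\<sigma>. ordered_sponge I S \<sigma>)) \<and> COSC I S \<longrightarrow>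
       ereal (lower_s0 I S F l m) \<le> lower_box_dim F \<and>
       lower_box_dim F \<le> upper_box_dim F \<and>
       upper_box_dim F \<le> ereal (upper_s0 I S F l m)) \<and>
    ((S3_sponge I S \<or>
      S2_sponge I S \<and> S2_choice I l m \<or>
      (\<exists>\<sigma>. ordered_sponge I S \<sigma> \<and> ordered_choice I \<sigma> l m)) \<and> COSC I S \<longrightarrow>
       (\<forall>w\<in>words I. upper_p1 F l w = lower_p1 F l w \<and> upper_p2 F m w = lower_p2 F m w \<longrightarrow>
          lower_box_dim F = upper_box_dim F \<and>
          box_dim F = ereal (upper_s0 I S F l m) \<and>
          upper_s0 I S F l m = lower_s0 I S F l m))"
proof -
  interpret sponge I S F using assms(1,2) by unfold_locales
  have upper: "upper_box_dim F \<le> ereal (upper_s0 I S F l m)"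
    by (rule upper_box_dim_le_upper_s0[OF assms(3)])
  have lower: "ereal (lower_s0 I S F l m) \<le> lower_box_dim F"
    if "S3_sponge I S \<or> S2_sponge I S \<or> (\<exists>\<sigma>. ordered_sponge I S \<sigma>)" "COSC I S"
    using that(1) S3_sponge_aligned S2_sponge_aligned ordered_sponge_aligned
    by (intro lower_s0_le_lower_box_dim[OF assms(3) that(2)]) blast
  have equal: "lower_box_dim F = upper_box_dim F \<and> box_dim F = ereal (upper_s0 I S F l m) \<and>
      upper_s0 I S F l m = lower_s0 I S F l m"
    if cls: "S3_sponge I S \<or> S2_sponge I S \<and> S2_choice I l m \<or>
      (\<exists>\<sigma>. ordered_sponge I S \<sigma> \<and> ordered_choice I \<sigma> l m)" "COSC I S"
      and w: "w \<in> words I" "upper_p1 F l w = lower_p1 F l w" "upper_p2 F m w = lower_p2 F m w" for w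
  proof -
    have s0: "upper_s0 I S F l m = lower_s0 I S F l m" by (rule upper_s0_eq_lower_s0[OF cls(1) w])
    have "ereal (upper_s0 I S F l m) \<le> lower_box_dim F" using lower cls unfolding s0 by blast
    then have "lower_box_dim F = ereal (upper_s0 I S F l m)" "upper_box_dim F = ereal (upper_s0 I S F l m)"
      using upper lower_box_dim_le_upper_box_dim[of F] by (meson antisym order_trans)+
    then show ?thesis unfolding box_dim_def using s0 by auto
  qed
  show ?thesis using upper lower lower_box_dim_le_upper_box_dim[of F] equal by blast
qed

end
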